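(* Let $q$ be a power of a prime $p$ with $q\equiv 3\pmod 4$ and $q\ge 7$, let $3\le n\le p$, and let $e$ be an even divisor of $q-1$. Then \[ N_n(e)\ge\theta(e)^n\Bigl(q-\frac{n-1}{2}W(e)^n\sqrt q\Bigr). \] Moreover, if \[ q\ge\frac{(n-1)^2}{4}W(q-1)^{2n}=(n-1)^2\,2^{2(n\omega(q-1)-1)}, \] then there exist $n$ consecutive primitive elements in $\mathbb{F}_q$.
   Context: $\omega(m)$ is the number of distinct prime factors of $m$, $W(m)=2^{\omega(m)}$, and $\theta(m)=\prod_{\ell\mid m,\ \ell\text{ prime}}(1-\ell^{-1})$. For a divisor $e$ of $q-1$, $g\in\mathbb{F}_q$ is $e$-free if $g\ne 0$ and whenever $g=h^d$ with $h\in\mathbb{F}_q$ and $d\mid e$, then $d=1$ (so primitive elements are exactly the $(q-1)$-free elements). $N_n(e)$ denotes the number of $g\in\mathbb{F}_q$ such that $g,g+1,\dots,g+n-1$ are all $e$-free. "$n$ consecutive primitive elements" means some $g$ with $g,\dots,g+n-1$ all primitive. *)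

theory Defs
  imports
    Complex_Main
    "HOL-Library.Cardinality"
    "HOL-Computational_Algebra.Primes"
begin

definition prime_omega :: "nat \<Rightarrow> nat" where
  "prime_omega m = card (prime_factors m)"

definition prime_W :: "nat \<Rightarrow> nat" where
  "prime_W m = 2 ^ prime_omega m"

definition prime_theta :: "nat \<Rightarrow> real" where
  "prime_theta m = (\<Prod>l\<in>prime_factors m. 1 - 1 / real l)"

definition primitive_element :: "'a::{field,finite} \<Rightarrow> bool" where
  "primitive_element g \<longleftrightarrow> range (\<lambda>k::nat. g ^ k) = - {0}"

definition e_free :: "nat \<Rightarrow> 'a::{field,finite} \<Rightarrow> bool" where
  "e_free e g \<longleftrightarrow> g \<noteq> 0 \<and> (\<forall>h d. d dvd e \<and> g = h ^ d \<longrightarrow> d = 1)"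

(* The type argument selects the finite field in which the elements are counted. *)
definition num_consecutive_free :: "'a::{field,finite} itself \<Rightarrow> nat \<Rightarrow> nat \<Rightarrow> nat" where
  "num_consecutive_free _ n e = card {g::'a. \<forall>i<n. e_free e (g + of_nat i)}"

end

theory Submission
  imports Defs
    "HOL-Algebra.Multiplicative_Group"
    "HOL-Algebra.Algebraic_Closure_Type"
    "HOL-Number_Theory.Cong"
    "HOL-Analysis.Complex_Transcendental"
    "Jordan_Normal_Form.Char_Poly"
begin

text \<open>
  The count is expanded over tuples of multiplicative characters. Every nontrivial tuple of characters at \<open>n\<close>
  distinct points has a character sum of modulus at most \<open>(n - 1) \<surd>q\<close> (Weil). Since \<open>-1\<close> is not a square,
  the reflection \<open>g \<mapsto> - (g + n - 1)\<close> negates the sums of the tuples with an odd number of characters of even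
  order; these tuples cancel in pairs and carry exactly half of the total weight \<open>W(e)\<^sup>n\<close>.

  Weil's bound has an elementary proof for products of linear forms. The associated L-function is a polynomial of
  degree at most \<open>n - 1\<close> whose reciprocal roots have the character sums over the extension fields as negated
  power sums, so it suffices to bound those over the extensions of degree \<open>2 s\<close> by a constant times \<open>q\<^sup>s\<close>. There
  the character becomes a \<open>d\<close>-th power residue symbol of a polynomial \<open>h\<close>, and with \<open>P = q\<^sup>s\<close> and
  \<open>G = h\<^bsup>(P-1)/d\<^esup>\<close> one counts coefficients to find a nonzero combination \<open>H\<close> of the \<open>X\<^bsup>a+iP\<^esup> G\<^sup>j\<close> that vanishes
  wherever \<open>h\<^bsup>(P\<^sup>2-1)/d\<^esup>\<close> takes a prescribed value. Because \<open>P\<close> is a power of \<open>q\<close>, raising \<open>H\<close> to the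
  power \<open>P\<close> turns this into one polynomial identity, so no derivatives occur.\<close>

hide_const (open) Coset.order Divisibility.prime Divisibility.irreducible UnivPoly.coeff UnivPoly.monom
  Ring_Divisibility.mult_of Polynomials.degree Polynomials.lead_coeff

section \<open>Characters of a finite field\<close>

text \<open>Half of the total weight is W(e)^n / 2, but it contains the weight 1 of the trivial
  tuple, so the error is only (W(e)^n / 2 - 1) (n - 1) sqrt q. The saved term (n - 1) sqrt q exceeds
  \<open>n\<close>, the number of g with some g + i = 0 that the main term loses. This makes the
  bound strict for n < q, and strictness gives existence even when q equals its threshold. For n = q
  the claimed bound is negative.

  The polynomial method bounds each fibre of the residue symbol only from above; the lower bounds
  follow because the fibres and a few zeros fill the whole field. Even degrees suffice because the
  criterion for power sums is applied to the squares of the reciprocal roots.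

  The delicate point is that H is nonzero: powers of G must be independent modulo X^P over
  polynomials of small degree. This is where h(0) must be nonzero and no smaller multiple of the
  orders of h may be divisible by d. Hence the points are translated away from 0, and the common
  divisor of the exponents and q - 1 is moved into the character.\<close>

lemma ring_of_type_power:
  "x [^]\<^bsub>(ring_of_type_algebra :: 'a::field ring)\<^esub> (n::nat) = x ^ n"
  by (induction n) (simp_all add: ring_of_type_algebra_def nat_pow_def mult.commute)

lemma ex_primitive_element: "\<exists>g::'a::{field,finite}. primitive_element g"
proof -
  let ?R = "ring_of_type_algebra :: 'a ring"
  interpret R: Ring.field ?R
    by (rule field_from_type_algebra)
  have carr: "carrier (mult_of ?R) = - {0}"
    by (auto simp: mult_of_simps) (auto simp: ring_of_type_algebra_def)
  have "finite (carrier ?R)" by simp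
  from R.finite_field_mult_group_has_gen[OF this]
  obtain a where "carrier (mult_of ?R) = {a [^]\<^bsub>?R\<^esub> i | i::nat. i \<in> UNIV}"
    by (elim bexE)
  then have "primitive_element a"
    unfolding primitive_element_def ring_of_type_power carr by auto
  then show ?thesis ..
qed

lemma card_nonzero: "card (- {0::'a::{zero,finite}}) = CARD('a) - 1"
  by (simp add: Compl_eq_Diff_UNIV card_Diff_singleton)

lemma finite_field_power_card_minus_1:
  fixes x :: "'a::{field,finite}"
  assumes "x \<noteq> 0"
  shows "x ^ (CARD('a) - 1) = 1"
proof -
  let ?S = "- {0::'a}"
  have "(\<Prod>y\<in>?S. x * y) = (\<Prod>y\<in>?S. y)"
    by (rule prod.reindex_bij_witness[of _ "\<lambda>y. y / x" "\<lambda>y. x * y"]) (use assms in auto)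
  moreover have "(\<Prod>y\<in>?S. x * y) = x ^ (CARD('a) - 1) * (\<Prod>y\<in>?S. y)"
    by (simp add: prod.distrib card_nonzero del: One_nat_def)
  moreover have "(\<Prod>y\<in>?S. y) \<noteq> 0" by simp
  ultimately show ?thesis by simp
qed

lemma finite_field_power_card:
  fixes x :: "'a::{field,finite}"
  shows "x ^ CARD('a) = x"
proof (cases "x = 0")
  case False
  have "x ^ CARD('a) = x ^ (CARD('a) - 1) * x"
    by (metis power_minus_mult zero_less_card_finite)
  then show ?thesis using finite_field_power_card_minus_1[OF False] by simp
qed (simp add: power_0_left)

lemma finite_field_power_card_power:
  fixes x :: "'a::{field,finite}"
  shows "x ^ (CARD('a) ^ s) = x"
  by (induction s) (simp_all add: power_mult finite_field_power_card)

lemma card_finite_field_ge_2: "CARD('a::{field,finite}) \<ge> 2"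
proof -
  have "card {0, 1::'a} \<le> CARD('a)" by (rule card_mono) auto
  then show ?thesis by simp
qed

definition field_gen :: "'a::{field,finite}" where
  "field_gen = (SOME g. primitive_element g)"

lemma primitive_field_gen: "primitive_element (field_gen :: 'a::{field,finite})"
  unfolding field_gen_def by (rule someI_ex) (rule ex_primitive_element)

lemma field_gen_nonzero [simp]: "(field_gen :: 'a::{field,finite}) \<noteq> 0"
proof
  assume "(field_gen :: 'a) = 0"
  then have "(field_gen :: 'a) ^ 1 = 0" by simp
  moreover have "(field_gen :: 'a) ^ 1 \<in> - {0}"
    using primitive_field_gen unfolding primitive_element_def by blast
  ultimately show False by simp
qed

lemma field_gen_power_mod:
  "(field_gen :: 'a::{field,finite}) ^ (k mod (CARD('a) - 1)) = field_gen ^ k"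
proof -
  have "(field_gen :: 'a) ^ k = field_gen ^ ((CARD('a) - 1) * (k div (CARD('a) - 1)) + k mod (CARD('a) - 1))"
    by simp
  also have "\<dots> = field_gen ^ (k mod (CARD('a) - 1))"
    unfolding power_add power_mult by (simp add: finite_field_power_card_minus_1 del: One_nat_def)
  finally show ?thesis by simp
qed

lemma bij_betw_field_gen_power:
  "bij_betw (\<lambda>k. (field_gen :: 'a::{field,finite}) ^ k) {..<CARD('a) - 1} (- {0})"
proof -
  have pos: "CARD('a) - 1 > 0" using card_finite_field_ge_2[where 'a='a] by simp
  have "(\<lambda>k. (field_gen :: 'a) ^ k) ` {..<CARD('a) - 1} = range (\<lambda>k. field_gen ^ k)"
  proof (intro subset_antisym image_subsetI)
    fix k show "(field_gen :: 'a) ^ k \<in> (\<lambda>k. field_gen ^ k) ` {..<CARD('a) - 1}"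
      by (rule image_eqI[of _ _ "k mod (CARD('a) - 1)"]) (use pos in \<open>auto simp: field_gen_power_mod simp del: One_nat_def\<close>)
  qed auto
  then have im: "(\<lambda>k. (field_gen :: 'a) ^ k) ` {..<CARD('a) - 1} = - {0}"
    using primitive_field_gen unfolding primitive_element_def by simp
  then have "inj_on (\<lambda>k. (field_gen :: 'a) ^ k) {..<CARD('a) - 1}"
    by (intro eq_card_imp_inj_on) (simp_all add: card_nonzero del: One_nat_def)
  with im show ?thesis by (simp add: bij_betw_def)
qed

lemma field_gen_power_eq_iff:
  "(field_gen :: 'a::{field,finite}) ^ i = field_gen ^ j \<longleftrightarrow> [i = j] (mod (CARD('a) - 1))"
proof -
  have pos: "CARD('a) - 1 > 0" using card_finite_field_ge_2[where 'a='a] by simp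
  have "(field_gen :: 'a) ^ i = field_gen ^ j \<longleftrightarrow>
      (field_gen :: 'a) ^ (i mod (CARD('a) - 1)) = field_gen ^ (j mod (CARD('a) - 1))"
    by (simp add: field_gen_power_mod del: One_nat_def)
  also have "\<dots> \<longleftrightarrow> i mod (CARD('a) - 1) = j mod (CARD('a) - 1)"
    using bij_betw_field_gen_power[where 'a='a] pos
    by (auto simp: bij_betw_def inj_on_def)
  finally show ?thesis by (simp only: unique_euclidean_semiring_class.cong_def)
qed

section \<open>The discrete logarithm and a generating character\<close>

definition field_log :: "'a::{field,finite} \<Rightarrow> nat" where
  "field_log x = (SOME k. field_gen ^ k = x)"

lemma field_gen_power_log:
  assumes "x \<noteq> 0" shows "field_gen ^ field_log x = x"
proof -
  have "x \<in> range (\<lambda>k. field_gen ^ k)"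
    using primitive_field_gen assms unfolding primitive_element_def by auto
  then show ?thesis unfolding field_log_def by (auto intro: someI)
qed

text \<open>A faithful character, sending \<open>field_gen\<close> to exp(2 pi i / (q - 1)). Every
  multiplicative character is a power of it, so a tuple of characters can be encoded by a tuple of
  exponents inside \<open>field_char\<close>.\<close>

definition field_char :: "'a::{field,finite} \<Rightarrow> complex" where
  "field_char x = (if x = 0 then 0 else cis (2 * pi * real (field_log x) / real (CARD('a) - 1)))"

lemma field_char_0 [simp]: "field_char 0 = 0"
  by (simp add: field_char_def)

lemma cis_eq_1_iff_nat:
  assumes "N > 0"
  shows "cis (2 * pi * real k / real N) = 1 \<longleftrightarrow> N dvd k"
proof
  assume "cis (2 * pi * real k / real N) = 1"
  then have "exp (\<i> * complex_of_real (2 * pi * real k / real N)) = 1" by (simp add: cis_conv_exp)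
  then obtain n :: int where "2 * pi * real k / real N = of_int (2 * n) * pi"
    unfolding exp_eq_1 by auto
  then have "pi * (2 * real k) = pi * (2 * (of_int n * real N))"
    using assms by (simp add: divide_eq_eq mult_ac)
  then have "real k = of_int n * real N" by simp
  then have "real_of_int (int k) = real_of_int (n * int N)" by simp
  then have "int k = n * int N" by (simp only: of_int_eq_iff)
  then have "int N dvd int k" by simp
  then show "N dvd k" by simp
next
  assume "N dvd k"
  then obtain t where "k = N * t" by auto
  then have "2 * pi * real k / real N = 2 * pi * of_int (int t)" using assms by simp
  then show "cis (2 * pi * real k / real N) = 1"
    by (simp only: cis_multiple_2pi Ints_of_int)
qed

text \<open>\<open>field_log\<close> picks one of many exponents; any two differ by a multiple of q
  - 1, hence by full turns of the angle. Multiplicativity rests on this independence of the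
  choice.\<close>

lemma field_char_gen_power:
  "field_char ((field_gen :: 'a::{field,finite}) ^ k) = cis (2 * pi * real k / real (CARD('a) - 1))"
proof -
  let ?N = "CARD('a) - 1"
  have N: "?N > 0" using card_finite_field_ge_2[where 'a='a] by simp
  define j where "j = field_log ((field_gen :: 'a) ^ k)"
  have "(field_gen :: 'a) ^ j = field_gen ^ k"
    unfolding j_def by (rule field_gen_power_log) simp
  then have "[int j = int k] (mod int ?N)"
    unfolding field_gen_power_eq_iff by (simp add: cong_int_iff del: One_nat_def)
  then obtain t where "int k = int j + int ?N * t"
    unfolding cong_iff_lin by blast
  then have "real_of_int (int k) = real_of_int (int j + int ?N * t)" by (rule arg_cong)
  then have "real k = real j + of_int t * real ?N" by (simp del: One_nat_def of_nat_diff)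
  then have "2 * pi * real k / real ?N = 2 * pi * real j / real ?N + 2 * pi * of_int t"
    using N by (simp add: add_divide_distrib distrib_left del: One_nat_def of_nat_diff)
  then have "cis (2 * pi * real k / real ?N) = cis (2 * pi * real j / real ?N) * cis (2 * pi * of_int t)"
    by (simp only: cis_mult)
  then have "cis (2 * pi * real k / real ?N) = cis (2 * pi * real j / real ?N)"
    by (simp only: cis_multiple_2pi Ints_of_int mult_1_right)
  then show ?thesis by (simp add: field_char_def j_def)
qed

lemma field_char_mult: "field_char (x * y) = field_char x * field_char (y :: 'a::{field,finite})"
proof (cases "x = 0 \<or> y = 0")
  case False
  then have "x * y = field_gen ^ (field_log x + field_log y)"
    by (simp add: power_add field_gen_power_log)
  then have "field_char (x * y) = field_char (field_gen ^ field_log x :: 'a) * field_char (field_gen ^ field_log y :: 'a)"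
    by (simp only: field_char_gen_power) (simp add: cis_mult add_divide_distrib distrib_left)
  then show ?thesis using False by (simp add: field_gen_power_log)
qed auto

lemma field_char_1 [simp]: "field_char 1 = 1"
  using field_char_gen_power[of 0] by simp

lemma field_char_power: "field_char (x ^ n) = field_char x ^ n"
  by (induction n) (simp_all add: field_char_mult)

lemma field_char_prod: "field_char (\<Prod>i\<in>A. f i) = (\<Prod>i\<in>A. field_char (f i))"
  by (induction A rule: infinite_finite_induct) (simp_all add: field_char_mult)

lemma norm_field_char: "x \<noteq> 0 \<Longrightarrow> norm (field_char x) = 1"
  by (simp add: field_char_def)

lemma field_char_eq_1_iff: "field_char x = 1 \<longleftrightarrow> x = 1"
proof
  assume ch: "field_char x = 1"
  have N: "CARD('a) - 1 > 0" using card_finite_field_ge_2[where 'a='a] by simp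
  from ch have "x \<noteq> 0" by auto
  with ch have "CARD('a) - 1 dvd field_log x"
    unfolding field_char_def using cis_eq_1_iff_nat[OF N] by simp
  then have "field_gen ^ field_log x = (field_gen :: 'a) ^ 0"
    unfolding field_gen_power_eq_iff by (simp add: cong_0_iff)
  then show "x = 1" using \<open>x \<noteq> 0\<close> by (simp add: field_gen_power_log)
qed simp

lemma field_char_gen_power_eq_1_iff:
  "field_char ((field_gen :: 'a::{field,finite}) ^ k) = 1 \<longleftrightarrow> CARD('a) - 1 dvd k"
  using field_gen_power_eq_iff[of k 0, where 'a='a] by (simp add: field_char_eq_1_iff cong_0_iff)

text \<open>An element of order \<open>d\<close> permutes the roots and multiplies the sum by a
  number other than 1. This later cancels the main term common to all fibres.\<close>

lemma sum_field_char_roots_of_unity: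
  fixes d :: nat
  assumes "d dvd CARD('a::{field,finite}) - 1" "d > 1"
  shows "(\<Sum>c | c ^ d = (1::'a). field_char c) = 0"
proof -
  let ?N = "CARD('a) - 1"
  have N: "?N > 0" using card_finite_field_ge_2[where 'a='a] by simp
  define z where "z = (field_gen :: 'a) ^ (?N div d)"
  have z0: "z \<noteq> 0" by (simp add: z_def)
  have zd: "z ^ d = 1"
    unfolding z_def power_mult[symmetric] dvd_div_mult_self[OF assms(1)]
    by (rule finite_field_power_card_minus_1) simp
  have z1: "field_char z \<noteq> 1"
  proof -
    have "?N div d < ?N" "?N div d > 0"
      using assms N dvd_imp_le[OF assms(1) N] by (simp_all add: div_greater_zero_iff del: One_nat_def)
    then show ?thesis unfolding z_def field_char_gen_power_eq_1_iff by (auto dest: dvd_imp_le)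
  qed
  have "(\<Sum>c | c ^ d = (1::'a). field_char c) = (\<Sum>c | c ^ d = (1::'a). field_char (z * c))"
    by (rule sum.reindex_bij_witness[of _ "\<lambda>c. z * c" "\<lambda>c. c / z"])
       (use z0 zd in \<open>auto simp: power_mult_distrib power_divide\<close>)
  also have "\<dots> = field_char z * (\<Sum>c | c ^ d = (1::'a). field_char c)"
    by (simp add: field_char_mult sum_distrib_left)
  finally show ?thesis using z1 by (simp add: algebra_simps)
qed

section \<open>Frobenius\<close>

text \<open>The polynomial (1 + X)^q - X^q - 1 has degree below q and vanishes at all q elements, so
  all its coefficients are 0.\<close>

lemma of_nat_card_choose_eq_0:
  assumes "0 < i" "i < CARD('a::{field,finite})"
  shows "of_nat (CARD('a) choose i) = (0::'a)"
proof -
  let ?q = "CARD('a)"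
  define p :: "'a poly" where "p = [:1, 1:] ^ ?q - monom 1 ?q - 1"
  have coeff_p: "coeff p j = (if 0 < j \<and> j < ?q then of_nat (?q choose j) else 0)" for j
    unfolding p_def by (auto simp: coeff_linear_power coeff_monom coeff_eq_0 degree_power_eq coeff_1
        coeff_linear_poly_power dest: not_less_iff_gr_or_eq[THEN iffD1])
  have "degree p < ?q"
    by (rule le_less_trans[OF degree_le[of "?q - 1"]]) (use coeff_p in auto)
  moreover have "poly p x = 0" for x
    by (simp add: p_def poly_monom finite_field_power_card)
  ultimately have "p = 0"
    using card_poly_roots_bound[of p] by fastforce
  then show ?thesis using coeff_p[of i] assms by simp
qed

text \<open>Stated for any commutative ring of the same characteristic because it serves both
  polynomials and the algebraic closure.\<close>

lemma frobenius_add: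
  fixes x y :: "'b::comm_ring_1"
  assumes "CHAR('b) = CHAR('a::{field,finite})"
  shows "(x + y) ^ CARD('a) = x ^ CARD('a) + y ^ CARD('a)"
proof -
  let ?q = "CARD('a)"
  have q: "?q > 0" by simp
  have "of_nat (?q choose i) = (0::'b)" if "0 < i" "i < ?q" for i
    using of_nat_card_choose_eq_0[OF that] assms by (simp add: of_nat_eq_0_iff_char_dvd)
  then have "(x + y) ^ ?q = (\<Sum>i\<le>?q. if i \<in> {0, ?q} then x ^ i * y ^ (?q - i) else 0)"
    unfolding binomial_ring by (intro sum.cong) auto
  also have "\<dots> = (\<Sum>i\<in>{0, ?q}. x ^ i * y ^ (?q - i))"
    by (subst sum.inter_restrict[symmetric]) (auto intro: sum.cong)
  finally show ?thesis using q by (simp add: add.commute)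
qed

lemma frobenius_power_add:
  fixes x y :: "'b::comm_ring_1"
  assumes "CHAR('b) = CHAR('a::{field,finite})"
  shows "(x + y) ^ (CARD('a) ^ s) = x ^ (CARD('a) ^ s) + y ^ (CARD('a) ^ s)"
  by (induction s) (simp_all add: power_mult mult.commute[of "CARD('a)"] frobenius_add[OF assms])

lemma frobenius_power_sum:
  fixes f :: "'c \<Rightarrow> 'b::comm_ring_1"
  assumes "CHAR('b) = CHAR('a::{field,finite})"
  shows "(\<Sum>i\<in>A. f i) ^ (CARD('a) ^ s) = (\<Sum>i\<in>A. f i ^ (CARD('a) ^ s))"
  by (induction A rule: infinite_finite_induct)
     (simp_all add: power_0_left frobenius_power_add[OF assms])

lemma frobenius_power_minus:
  fixes x :: "'b::comm_ring_1"
  assumes "CHAR('b) = CHAR('a::{field,finite})"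
  shows "(- x) ^ (CARD('a) ^ s) = - (x ^ (CARD('a) ^ s))"
proof -
  have "(x + - x) ^ (CARD('a) ^ s) = x ^ (CARD('a) ^ s) + (- x) ^ (CARD('a) ^ s)"
    by (rule frobenius_power_add[OF assms])
  then show ?thesis by (simp add: power_0_left eq_neg_iff_add_eq_0 add.commute)
qed

lemma frobenius_power_diff:
  fixes x y :: "'b::comm_ring_1"
  assumes "CHAR('b) = CHAR('a::{field,finite})"
  shows "(x - y) ^ (CARD('a) ^ s) = x ^ (CARD('a) ^ s) - y ^ (CARD('a) ^ s)"
  using frobenius_power_add[OF assms, of x "- y" s]
  by (simp add: frobenius_power_minus[OF assms])

text \<open>The coefficients are fixed by Frobenius. The point is that h^P = h(X^P) becomes a
  constant modulo X^P.\<close>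

lemma poly_power_card_power:
  fixes f :: "'a::{field,finite} poly"
  shows "f ^ (CARD('a) ^ s) = pcompose f (monom 1 (CARD('a) ^ s))"
proof -
  let ?P = "CARD('a) ^ s"
  have "f ^ ?P = (\<Sum>i\<le>degree f. monom (coeff f i) i) ^ ?P"
    by (simp add: poly_as_sum_of_monoms)
  also have "\<dots> = (\<Sum>i\<le>degree f. monom (coeff f i) i ^ ?P)"
    by (rule frobenius_power_sum) simp
  also have "\<dots> = (\<Sum>i\<le>degree f. smult (coeff f i) (monom 1 ?P ^ i))"
    by (simp add: monom_power finite_field_power_card_power smult_monom mult.commute)
  also have "\<dots> = pcompose f (monom 1 ?P)"
    by (simp add: pcompose_altdef poly_altdef coeff_map_poly degree_map_poly)
  finally show ?thesis .
qed

section \<open>Linear relations by counting\<close>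

lemma finite_polys_degree_less:
  "finite {p::'a::{comm_monoid_add,finite} poly. degree p < n}"
  "card {p::'a poly. degree p < n} \<le> CARD('a) ^ n"
proof -
  let ?S = "{p::'a poly. degree p < n}"
  let ?T = "Pi\<^sub>E {..<n} (\<lambda>_. UNIV :: 'a set)"
  let ?f = "\<lambda>p::'a poly. restrict (coeff p) {..<n}"
  have inj: "inj_on ?f ?S"
  proof (rule inj_onI)
    fix p r :: "'a poly"
    assume *: "p \<in> ?S" "r \<in> ?S" "?f p = ?f r"
    show "p = r"
    proof (rule poly_eqI)
      fix i
      show "coeff p i = coeff r i"
      proof (cases "i < n")
        case True
        then show ?thesis using *(3) by (metis lessThan_iff restrict_apply')
      next
        case False
        then show ?thesis using *(1,2) by (simp add: coeff_eq_0)
      qed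
    qed
  qed
  have sub: "?f ` ?S \<subseteq> ?T" by (auto split: if_splits)
  have fin: "finite ?T" by (simp add: finite_PiE)
  show "finite ?S" by (rule finite_imageD[OF finite_subset[OF sub fin] inj])
  have "card ?S \<le> card ?T" by (rule card_inj_on_le[OF inj sub fin])
  also have "card ?T = CARD('a) ^ n" by (subst card_PiE) simp_all
  finally show "card ?S \<le> CARD('a) ^ n" .
qed

text \<open>Pigeonhole in place of a dimension count: the coefficient families outnumber the
  possible sums, so two of them have the same sum, and their difference is the relation.\<close>

lemma linear_relation_by_counting:
  fixes v :: "'i \<Rightarrow> 'a::{field,finite} poly"
  assumes fin: "finite J" and deg: "\<And>i. i \<in> J \<Longrightarrow> degree (v i) < n" and card: "n < card J"
  obtains k where "\<exists>i\<in>J. k i \<noteq> 0" "(\<Sum>i\<in>J. smult (k i) (v i)) = 0"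
proof -
  let ?D = "Pi\<^sub>E J (\<lambda>_. UNIV :: 'a set)"
  let ?T = "{p::'a poly. degree p < n}"
  let ?g = "\<lambda>k. \<Sum>i\<in>J. smult (k i) (v i)"
  obtain j where "j \<in> J" using card by (metis card.empty equals0I less_nat_zero_code)
  then have n: "n > 0" using deg by fastforce
  have "?g ` ?D \<subseteq> ?T"
  proof (intro image_subsetI CollectI)
    fix k
    have "degree (?g k) \<le> n - 1"
    proof (rule degree_sum_le[OF fin])
      fix i assume "i \<in> J"
      then have "degree (v i) \<le> n - 1" using deg by fastforce
      then show "degree (smult (k i) (v i)) \<le> n - 1"
        using degree_smult_le le_trans by blast
    qed
    then show "degree (?g k) < n" using n by simp
  qed
  then have "card (?g ` ?D) \<le> CARD('a) ^ n"
    by (rule order_trans[OF card_mono[OF finite_polys_degree_less(1)] finite_polys_degree_less(2)])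
  also have "\<dots> < CARD('a) ^ card J"
    by (rule power_strict_increasing) (use card card_finite_field_ge_2[where 'a='a] in linarith)+
  also have "\<dots> = card ?D" using fin by (subst card_PiE) simp_all
  finally have "card (?g ` ?D) < card ?D" .
  then have "\<not> inj_on ?g ?D" using card_image[of ?g ?D] by linarith
  then obtain k k' where kk: "k \<in> ?D" "k' \<in> ?D" "?g k = ?g k'" "k \<noteq> k'"
    unfolding inj_on_def by blast
  show thesis
  proof (rule that[of "\<lambda>i. k i - k' i"])
    show "\<exists>i\<in>J. k i - k' i \<noteq> 0"
    proof (rule ccontr)
      assume "\<not> (\<exists>i\<in>J. k i - k' i \<noteq> 0)"
      then have "k i = k' i" if "i \<in> J" for i using that by simp
      then have "k = k'" by (rule PiE_ext[OF kk(1,2)])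
      then show False using kk(4) by contradiction
    qed
    show "?g (\<lambda>i. k i - k' i) = 0"
      using kk(3) by (simp add: smult_diff_left sum_subtractf)
  qed
qed

section \<open>Radical extensions\<close>

interpretation to_ac: field_hom to_ac
  by standard simp_all

interpretation map_to_ac: map_poly_inj_idom_hom to_ac ..

interpretation to_fract: inj_idom_hom to_fract
  by standard simp_all

interpretation map_to_fract: map_poly_inj_idom_hom to_fract ..

lemma order_power_eq:
  assumes "p \<noteq> 0"
  shows "order x (p ^ n) = n * order x (p::'a::idom poly)"
  using assms by (induction n) (simp_all add: order_mult)

text \<open>The minimal polynomial of \<open>Y\<close> divides X^d - u, so its constant term is, up
  to sign, a product of n roots each of which is a d-th root of \<open>u\<close>. The d-th power of
  that product is u^n.\<close>

lemma radical_norm_is_power: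
  fixes Y :: "'b::field alg_closure"
  assumes Y: "Y ^ d = to_ac u" and M: "M \<noteq> 0" "degree M < d" "poly (map_poly to_ac M) Y = 0"
  shows "\<exists>n b. 0 < n \<and> n < d \<and> b ^ d = u ^ n"
proof -
  let ?V = "\<lambda>M. M \<noteq> 0 \<and> poly (map_poly to_ac M) Y = 0"
  obtain N where N: "?V N" and min: "\<And>N'. ?V N' \<Longrightarrow> degree N \<le> degree N'"
    using ex_has_least_nat[of ?V M degree] M by blast
  have deg_pos: "degree N > 0"
  proof (rule ccontr)
    assume "\<not> degree N > 0"
    then obtain c where "N = [:c:]" by (auto elim: degree_eq_zeroE)
    then show False using N by (simp add: to_ac.map_poly_pCons_hom)
  qed
  define p where "p = monom 1 d - [:u:]"
  have pY: "poly (map_poly to_ac p) Y = 0"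
    using Y by (simp add: p_def map_to_ac.hom_minus poly_monom to_ac.map_poly_pCons_hom)
  have "map_poly to_ac p = map_poly to_ac N * map_poly to_ac (p div N) + map_poly to_ac (p mod N)"
    by (simp flip: map_to_ac.hom_mult map_to_ac.hom_add)
  then have "poly (map_poly to_ac (p mod N)) Y = 0"
    using pY N by (metis add_cancel_right_left mult_zero_left poly_add poly_mult)
  then have "p mod N = 0"
    using min[of "p mod N"] degree_mod_less'[of N p] N by force
  then have "N dvd p" by auto
  then have dvd: "map_poly to_ac N dvd map_poly to_ac p" by (rule map_to_ac.hom_dvd)
  define n where "n = degree N"
  have "map_poly to_ac N \<noteq> 0" using N by simp
  then obtain A where A: "size A = n"
      "map_poly to_ac N = smult (to_ac (lead_coeff N)) (\<Prod>x\<in>#A. [:-x, 1:])"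
    using alg_closed_imp_factorization[of "map_poly to_ac N"] by (auto simp: n_def)
  have root: "x ^ d = to_ac u" if "x \<in># A" for x
  proof -
    have "[:-x, 1:] dvd map_poly to_ac N"
      unfolding A(2) using that by (intro dvd_smult) (simp add: dvd_prod_mset)
    then have "poly (map_poly to_ac p) x = 0"
      using dvd dvd_trans poly_eq_0_iff_dvd by blast
    then show ?thesis by (simp add: p_def map_to_ac.hom_minus poly_monom to_ac.map_poly_pCons_hom)
  qed
  \<comment> \<open>The norm of \<open>Y\<close>; the sign turns the constant term into the product
    of the roots.\<close>
  define b where "b = (-1) ^ n * poly N 0 / lead_coeff N"
  have poly_prod: "poly (\<Prod>x\<in>#A. [:-x, 1:]) 0 = (-1) ^ size A * \<Prod>\<^sub># A" for A :: "'b alg_closure multiset"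
    by (induction A) auto
  have "to_ac (poly N 0) = poly (map_poly to_ac N) 0" by simp
  also have "\<dots> = to_ac (lead_coeff N) * ((-1) ^ n * \<Prod>\<^sub># A)"
    unfolding A(2) by (simp add: poly_prod A(1))
  finally have "to_ac b = (-1) ^ n * (-1) ^ n * \<Prod>\<^sub># A"
    unfolding b_def using N by (simp add: field_simps)
  then have b: "to_ac b = \<Prod>\<^sub># A"
    by (simp flip: power_add power_mult_distrib)
  have "(\<Prod>\<^sub># A) ^ d = to_ac u ^ size A"
    using root by (induction A) (auto simp: power_mult_distrib)
  then have "to_ac (b ^ d) = to_ac (u ^ n)"
    using b A(1) by simp
  then have "b ^ d = u ^ n" by (simp only: to_ac_eq_iff)
  moreover have "n < d" using min[of M] M unfolding n_def by linarith
  ultimately show ?thesis using deg_pos n_def by blast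
qed

text \<open>Clearing denominators in b^d = (c / h)^n gives b1^d h^n = c^n b2^d, and the orders at
  each point are compared modulo \<open>d\<close>.\<close>

lemma radical_relation_order:
  fixes h :: "'a::field poly" and U :: "'a poly poly" and Y :: "'a poly fract alg_closure"
  assumes h: "h \<noteq> 0" and c: "c \<noteq> 0" and Y: "Y ^ d = to_ac (to_fract [:c:] / to_fract h)"
    and U: "U \<noteq> 0" "degree U < d" "poly (map_poly to_ac (map_poly to_fract U)) Y = 0"
  shows "\<exists>n. 0 < n \<and> n < d \<and> (\<forall>x. d dvd n * order x h)"
proof -
  have "map_poly to_fract U \<noteq> 0" "degree (map_poly to_fract U) < d" using U by simp_all
  from radical_norm_is_power[OF Y this U(3)] obtain n b where n: "0 < n" "n < d"
    and b: "b ^ d = (to_fract [:c:] / to_fract h) ^ n" by blast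
  obtain b1 b2 where b12: "b = Fract b1 b2" "b2 \<noteq> 0" by (cases b) auto
  have "to_fract (b1 ^ d * h ^ n) = to_fract ([:c:] ^ n * b2 ^ d)"
    using b b12 h unfolding Fract_conv_to_fract
    by (simp add: field_simps to_fract.hom_power)
  then have eq: "b1 ^ d * h ^ n = [:c:] ^ n * b2 ^ d" by (simp only: to_fract_eq_iff)
  have nz: "[:c:] ^ n * b2 ^ d \<noteq> 0" using c b12 by simp
  then have b1: "b1 \<noteq> 0" unfolding eq[symmetric] using n by auto
  have "d dvd n * order x h" for x
  proof -
    have "order x (b1 ^ d * h ^ n) = d * order x b1 + n * order x h"
      using b1 h by (subst order_mult) (auto simp: order_power_eq)
    moreover have "order x ([:c:] ^ n * b2 ^ d) = d * order x b2"
      using b12 c by (subst order_mult) (auto simp: order_power_eq order_0I)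
    ultimately have "d * order x b1 + n * order x h = d * order x b2" using eq by simp
    then show ?thesis by (metis dvd_add_right_iff dvd_triv_left)
  qed
  then show ?thesis using n by blast
qed

section \<open>Norms from a Kummer extension\<close>

lemma degree_coeff_mult_le:
  fixes p r :: "'a::comm_semiring_0 poly poly"
  assumes "\<And>i. degree (coeff p i) \<le> A" "\<And>i. degree (coeff r i) \<le> B"
  shows "degree (coeff (p * r) i) \<le> A + B"
  unfolding coeff_mult
  by (intro degree_sum_le) (auto intro!: order_trans[OF degree_mult_le] add_mono assms)

lemma degree_coeff_prod_le:
  fixes f :: "'i \<Rightarrow> 'a::comm_semiring_1 poly poly"
  assumes "finite T" "\<And>t i. t \<in> T \<Longrightarrow> degree (coeff (f t) i) \<le> A"
  shows "degree (coeff (\<Prod>t\<in>T. f t) i) \<le> card T * A"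
  using assms
proof (induction T arbitrary: i rule: finite_induct)
  case empty
  then show ?case by (simp add: coeff_1)
next
  case (insert t T)
  then show ?case using degree_coeff_mult_le[of "f t" A "\<Prod>t\<in>T. f t" "card T * A" i] by simp
qed

text \<open>The norm of U(T) when T is a d-th root and \<open>z\<close> a primitive d-th root of
  unity: the conjugations are T -> z^t T.\<close>

definition twisted_norm :: "'b::comm_ring_1 \<Rightarrow> nat \<Rightarrow> 'b poly \<Rightarrow> 'b poly" where
  "twisted_norm z d U = (\<Prod>t<d. pcompose U [:0, z ^ t:])"

lemma pcompose_twisted_norm:
  assumes "z ^ d = (1::'b::idom)" "d > 0"
  shows "pcompose (twisted_norm z d U) [:0, z:] = twisted_norm z d U"
proof -
  have "pcompose (twisted_norm z d U) [:0, z:] = (\<Prod>t<d. pcompose U [:0, z ^ Suc t:])"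
    unfolding twisted_norm_def pcompose_prod
    by (intro prod.cong) (simp_all add: pcompose_assoc[symmetric] pcompose_pCons mult.commute)
  also have "\<dots> = (\<Prod>t\<in>{1..d}. pcompose U [:0, z ^ t:])"
    by (rule prod.reindex_bij_witness[of _ "\<lambda>t. t - 1" Suc]) auto
  also have "{1..d} = insert d {1..<d}" using assms(2) by auto
  also have "(\<Prod>t\<in>insert d {1..<d}. pcompose U [:0, z ^ t:]) = (\<Prod>t\<in>insert 0 {1..<d}. pcompose U [:0, z ^ t:])"
    using assms by (simp add: prod.insert)
  also have "insert 0 {1..<d} = {..<d}" using assms(2) by auto
  finally show ?thesis unfolding twisted_norm_def .
qed

text \<open>Invariance under T -> z T multiplies this coefficient by z^n, which is not 1. So the
  norm is a polynomial in T^d.\<close>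

lemma coeff_twisted_norm_eq_0:
  assumes "z ^ d = (1::'b::idom)" "\<And>n. 0 < n \<Longrightarrow> n < d \<Longrightarrow> z ^ n \<noteq> 1" "d > 0" "\<not> d dvd n"
  shows "coeff (twisted_norm z d U) n = 0"
proof -
  have "z ^ n = z ^ (d * (n div d) + n mod d)" by simp
  also have "\<dots> = z ^ (n mod d)" unfolding power_add power_mult by (simp add: assms(1))
  finally have "z ^ n \<noteq> 1"
    using assms(2)[of "n mod d"] assms(3,4) by (simp add: dvd_eq_mod_eq_0)
  moreover have "coeff (twisted_norm z d U) n = z ^ n * coeff (twisted_norm z d U) n"
    using pcompose_twisted_norm[OF assms(1,3), of U] coeff_pcompose_linear[of "twisted_norm z d U" z n]
    by simp
  ultimately show ?thesis by (simp add: algebra_simps)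
qed

lemma degree_twisted_norm_le: "degree (twisted_norm z d U) \<le> d * degree (U :: 'b::idom poly)"
proof -
  have "degree (twisted_norm z d U) \<le> (\<Sum>t<d. degree (pcompose U [:0, z ^ t:]))"
    unfolding twisted_norm_def by (rule order_trans[OF degree_prod_sum_le]) (simp_all only: o_def finite_lessThan order_refl)
  also have "\<dots> \<le> (\<Sum>t<d. degree U)"
  proof (rule sum_mono)
    fix t
    have "degree [:0, z ^ t:] \<le> 1" by simp
    then have "degree U * degree [:0, z ^ t:] \<le> degree U * 1" by (rule mult_left_mono) simp
    then show "degree (pcompose U [:0, z ^ t:]) \<le> degree U"
      using degree_pcompose_le[of U "[:0, z ^ t:]"] by simp
  qed
  finally show ?thesis by simp
qed

lemma twisted_norm_expand:
  assumes "z ^ d = (1::'b::idom)" "\<And>n. 0 < n \<Longrightarrow> n < d \<Longrightarrow> z ^ n \<noteq> 1" "d > 0" "degree U < d"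
  shows "twisted_norm z d U = (\<Sum>i<d. monom (coeff (twisted_norm z d U) (d * i)) (d * i))"
proof (rule poly_eqI)
  fix n
  let ?W = "twisted_norm z d U"
  show "coeff ?W n = coeff (\<Sum>i<d. monom (coeff ?W (d * i)) (d * i)) n"
  proof (cases "d dvd n \<and> n < d * d")
    case True
    then obtain i where i: "n = d * i" by blast
    then have "i < d" using True assms(3) by simp
    have "coeff (\<Sum>i<d. monom (coeff ?W (d * i)) (d * i)) n = (\<Sum>j<d. if j = i then coeff ?W n else 0)"
      unfolding coeff_sum by (intro sum.cong) (use assms(3) i in auto)
    then show ?thesis using \<open>i < d\<close> by simp
  next
    case False
    have "coeff ?W n = 0"
    proof (cases "d dvd n")
      case True
      have "degree ?W \<le> d * degree U" by (rule degree_twisted_norm_le)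
      also have "\<dots> < d * d" using assms(3,4) by simp
      finally show ?thesis using True False by (simp add: coeff_eq_0)
    qed (use coeff_twisted_norm_eq_0[OF assms(1-3)] in auto)
    moreover have "coeff (\<Sum>i<d. monom (coeff ?W (d * i)) (d * i)) n = 0"
      unfolding coeff_sum by (intro sum.neutral) (use False assms(3) in auto)
    ultimately show ?thesis by simp
  qed
qed

lemma ex_primitive_root_of_unity:
  assumes "d dvd CARD('a::{field,finite}) - 1" "d > 0"
  obtains z :: "'a::{field,finite}" where "z ^ d = 1" "\<And>n. 0 < n \<Longrightarrow> n < d \<Longrightarrow> z ^ n \<noteq> 1"
proof
  let ?N = "CARD('a) - 1"
  let ?z = "(field_gen :: 'a) ^ (?N div d)"
  have N: "?N > 0" using card_finite_field_ge_2[where 'a='a] by simp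
  have one: "?z ^ n = 1 \<longleftrightarrow> ?N dvd ?N div d * n" for n
    using field_gen_power_eq_iff[of "?N div d * n" 0, where 'a='a]
    by (simp add: power_mult cong_0_iff del: One_nat_def)
  show "?z ^ d = 1" unfolding one using assms by simp
  fix n assume n: "0 < n" "n < d"
  obtain t where t: "?N = d * t" using assms by blast
  have "t > 0" using N t by (metis mult_0_right neq0_conv)
  then have "?N div d * n < ?N" "?N div d * n > 0" using t n assms by simp_all
  then show "?z ^ n \<noteq> 1" unfolding one using dvd_imp_le by fastforce
qed

lemma monom_dvd_pcompose_monom_diff:
  "monom 1 P dvd pcompose h (monom 1 P) - [:poly h (0::'a::comm_ring_1):]"
  by (cases h rule: pCons_cases) (simp add: pcompose_pCons)

lemma diff_dvd_power_diff: "(x - y) dvd x ^ n - (y::'a::comm_ring_1) ^ n"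
  by (simp add: power_diff_sumr2)

lemma dvd_power_minus_1:
  assumes "d dvd q - (1::nat)" shows "d dvd q ^ s - 1"
proof (induction s)
  case (Suc s)
  show ?case
  proof (cases "q = 0")
    case False
    then have "q ^ Suc s - 1 = q * (q ^ s - 1) + (q - 1)"
      by (simp add: diff_mult_distrib2)
    then show ?thesis using Suc assms by simp
  qed (use assms in simp)
qed simp

text \<open>
  For a relation with small coefficients among the powers of \<open>G = h\<^bsup>(P-1)/d\<^esup>\<close> modulo \<open>X\<^bsup>P\<^esup>\<close>, where
  \<open>G\<close> behaves as a \<open>d\<close>-th root of \<open>h(0) / h\<close>, the norm is a polynomial of degree less than \<open>P\<close> and so vanishes
  identically; this contradicts that \<open>h(0) / h\<close> has degree \<open>d\<close> over the rational functions.\<close>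
lemma kummer_nonvanishing:
  fixes h :: "'a::{field,finite} poly" and U :: "'a poly poly"
  assumes d: "d dvd CARD('a) - 1" "d > 0"
    and h0: "poly h 0 \<noteq> 0"
    and ord: "\<And>n. (\<forall>x. d dvd n * order x h) \<Longrightarrow> d dvd n"
    and U: "U \<noteq> 0" "degree U < d" "\<And>i. degree (coeff U i) \<le> A"
    and P: "P = CARD('a) ^ s" "d * A + d * degree h < P"
    and dvd: "monom 1 P dvd poly U (h ^ ((P - 1) div d))"
  shows False
proof -
  obtain z :: 'a where z: "z ^ d = 1" "\<And>n. 0 < n \<Longrightarrow> n < d \<Longrightarrow> z ^ n \<noteq> 1"
    using ex_primitive_root_of_unity[OF d] by blast
  define G where "G = h ^ ((P - 1) div d)"
  define c where "c = poly h 0"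
  define W where "W = twisted_norm [:z:] d U"
  define e where "e = (\<lambda>i. coeff W (d * i))"
  have h: "h \<noteq> 0" using h0 by auto
  have zz: "[:z:] ^ d = 1" "\<And>n. 0 < n \<Longrightarrow> n < d \<Longrightarrow> [:z:] ^ n \<noteq> 1"
    using z by (simp_all add: poly_const_pow one_pCons)
  have W: "W = (\<Sum>i<d. monom (e i) (d * i))"
    unfolding W_def e_def by (rule twisted_norm_expand[OF zz d(2) U(2)])
  have deg_e: "degree (e i) \<le> d * A" for i
  proof -
    have "degree (coeff (pcompose U [:0, [:z:] ^ t:]) n) \<le> A" for t n
      using U(3)[of n] by (simp add: coeff_pcompose_linear poly_const_pow degree_smult_le order_trans[OF degree_smult_le])
    then show ?thesis
      unfolding e_def W_def twisted_norm_def
      using degree_coeff_prod_le[of "{..<d}" "\<lambda>t. pcompose U [:0, [:z:] ^ t:]" A "d * i"] by simp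
  qed
  have dP: "d * ((P - 1) div d) = P - 1"
    unfolding P(1) by (rule dvd_mult_div_cancel[OF dvd_power_minus_1[OF d(1)]])
  have P0: "P > 0" unfolding P(1) by simp
  \<comment> \<open>Modulo X^P the right-hand side is the constant h(0), so \<open>G\<close> is a
    d-th root of h(0) / h modulo X^P.\<close>
  have hG: "h * G ^ d = pcompose h (monom 1 P)"
  proof -
    have "h * G ^ d = h ^ Suc (P - 1)"
      unfolding G_def power_mult[symmetric] mult.commute[of _ d] dP by (simp only: power_Suc)
    also have "\<dots> = h ^ P" using P0 by simp
    finally show ?thesis unfolding P(1) by (simp add: poly_power_card_power)
  qed
  \<comment> \<open>This is h^d times the norm at \<open>G\<close>, with every h G^d replaced by the
    constant \<open>c\<close>. The factor h^d clears the denominators of c / h, and the degree stays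
    below \<open>P\<close>.\<close>
  define \<Phi> where "\<Phi> = (\<Sum>i<d. e i * [:c:] ^ i * h ^ (d - i))"
  have "h ^ d * poly W G - \<Phi> = (\<Sum>i<d. e i * h ^ (d - i) * ((h * G ^ d) ^ i - [:c:] ^ i))"
  proof -
    have "h ^ d * poly W G = (\<Sum>i<d. e i * h ^ (d - i) * (h * G ^ d) ^ i)"
      unfolding W poly_sum poly_monom sum_distrib_left
    proof (intro sum.cong refl)
      fix i assume "i \<in> {..<d}"
      then have "h ^ d = h ^ (d - i) * h ^ i" by (simp flip: power_add)
      then show "h ^ d * (e i * G ^ (d * i)) = e i * h ^ (d - i) * (h * G ^ d) ^ i"
        by (simp add: power_mult_distrib power_mult mult_ac)
    qed
    then show ?thesis unfolding \<Phi>_def by (simp add: right_diff_distrib sum_subtractf mult_ac)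
  qed
  also have "monom 1 P dvd \<dots>"
  proof (intro dvd_sum dvd_mult)
    fix i
    have "monom 1 P dvd h * G ^ d - [:c:]"
      unfolding hG c_def by (rule monom_dvd_pcompose_monom_diff)
    then show "monom 1 P dvd (h * G ^ d) ^ i - [:c:] ^ i"
      using diff_dvd_power_diff dvd_trans by blast
  qed
  finally have "monom 1 P dvd h ^ d * poly W G - \<Phi>" .
  moreover have "monom 1 P dvd poly W G"
  proof -
    \<comment> \<open>The factor t = 0 of the norm is \<open>U\<close> itself, so its divisibility
      by X^P passes to the whole norm.\<close>
    have "poly (pcompose U [:0, [:z:] ^ 0:]) G dvd poly W G"
      unfolding W_def twisted_norm_def poly_prod using d(2) by (intro dvd_prodI) auto
    then show ?thesis using dvd dvd_trans by (fastforce simp: poly_pcompose G_def)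
  qed
  ultimately have "monom 1 P dvd \<Phi>"
    by (metis dvd_diff_right_iff dvd_mult)
  moreover have "degree \<Phi> < P"
  proof -
    have "degree \<Phi> \<le> d * A + d * degree h"
      unfolding \<Phi>_def
    proof (intro degree_sum_le)
      fix i assume "i \<in> {..<d}"
      have "degree (e i * [:c:] ^ i * h ^ (d - i)) \<le> degree (e i) + degree ([:c:] ^ i) + degree (h ^ (d - i))"
        by (rule order_trans[OF degree_mult_le] add_right_mono degree_mult_le)+
      moreover have "degree ([:c:] ^ i) = 0" by (simp add: poly_const_pow)
      moreover have "degree (h ^ (d - i)) \<le> d * degree h"
        using degree_power_le[of h "d - i"] by (metis diff_le_self le_trans mult.commute mult_le_mono1)
      ultimately show "degree (e i * [:c:] ^ i * h ^ (d - i)) \<le> d * A + d * degree h"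
        using deg_e[of i] by linarith
    qed simp
    then show ?thesis using P(2) by simp
  qed
  ultimately have \<Phi>0: "\<Phi> = 0"
    using dvd_imp_degree_le[of "monom 1 P" \<Phi>] by (fastforce simp: degree_monom_eq)
  define \<phi> where "\<phi> = (\<lambda>p :: 'a poly. to_ac (to_fract p))"
  interpret \<phi>: inj_idom_hom \<phi>
    unfolding \<phi>_def by unfold_locales simp_all
  interpret map_\<phi>: map_poly_inj_idom_hom \<phi> ..
  have map_\<phi>: "map_poly \<phi> p = map_poly to_ac (map_poly to_fract p)" for p
    by (rule poly_eqI) (simp only: \<phi>.coeff_map_poly_hom to_ac.coeff_map_poly_hom to_fract.coeff_map_poly_hom, simp add: \<phi>_def)
  \<comment> \<open>A true d-th root of h(0) / h. The computation done for \<open>G\<close> modulo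
    X^P is now exact: \<open>\<Phi> = 0\<close> makes the norm vanish at \<open>Y\<close>, hence
    \<open>U\<close> at some conjugate z^t Y.\<close>
  obtain Y where Y: "Y ^ d = to_ac (to_fract [:c:] / to_fract h)"
    using nth_root_exists[OF d(2)] by blast
  have Yh: "\<phi> h * Y ^ d = \<phi> [:c:]" unfolding Y \<phi>_def using h by simp
  have "\<phi> h ^ d * poly (map_poly \<phi> W) Y = \<phi> \<Phi>"
    unfolding W \<Phi>_def map_\<phi>.hom_sum \<phi>.hom_sum poly_sum sum_distrib_left
  proof (intro sum.cong refl)
    fix i assume "i \<in> {..<d}"
    then have "\<phi> h ^ d = \<phi> h ^ (d - i) * \<phi> h ^ i" by (simp flip: power_add)
    then have "\<phi> h ^ d * (\<phi> (e i) * Y ^ (d * i)) = \<phi> (e i) * (\<phi> h * Y ^ d) ^ i * \<phi> h ^ (d - i)"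
      by (simp add: power_mult_distrib power_mult mult_ac)
    then show "\<phi> h ^ d * poly (map_poly \<phi> (monom (e i) (d * i))) Y = \<phi> (e i * [:c:] ^ i * h ^ (d - i))"
      unfolding Yh by (simp add: poly_monom \<phi>.hom_mult \<phi>.hom_power)
  qed
  then have "poly (map_poly \<phi> W) Y = 0" using h by (simp add: \<Phi>0)
  then have "(\<Prod>t<d. poly (map_poly \<phi> (pcompose U [:0, [:z:] ^ t:])) Y) = 0"
    unfolding W_def twisted_norm_def map_\<phi>.hom_prod poly_prod .
  then obtain t where "poly (map_poly \<phi> (pcompose U [:0, [:z:] ^ t:])) Y = 0"
    by (auto simp: prod_zero_iff)
  then have "poly (map_poly \<phi> U) (\<phi> ([:z:] ^ t) * Y) = 0"
    by (simp add: \<phi>.map_poly_pcompose poly_pcompose \<phi>.map_poly_pCons_hom mult.commute)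
  moreover have "(\<phi> ([:z:] ^ t) * Y) ^ d = to_ac (to_fract [:c:] / to_fract h)"
  proof -
    have "\<phi> ([:z:] ^ t) ^ d = \<phi> (([:z:] ^ d) ^ t)"
      by (simp add: \<phi>.hom_power mult.commute flip: power_mult)
    then show ?thesis by (simp add: power_mult_distrib Y zz)
  qed
  ultimately obtain n where n: "0 < n" "n < d" "\<forall>x. d dvd n * order x h"
    using radical_relation_order[OF h _ _ U(1,2)] h0 unfolding map_\<phi> c_def by blast
  then have "d dvd n" by (intro ord)
  then show False using n by (auto dest: dvd_imp_le)
qed


section \<open>Stepanov's method\<close>

text \<open>Group the terms into blocks by X^(i P). Once the power of X of the lowest nonzero block
  is cancelled, all later blocks are multiples of X^P, so that block alone would be a small relation
  among the powers of \<open>G\<close> modulo X^P.\<close>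

lemma stepanov_auxiliary_nonzero:
  fixes h :: "'a::{field,finite} poly" and k :: "nat \<times> nat \<times> nat \<Rightarrow> 'a"
  assumes d: "d dvd CARD('a) - 1" "d > 0"
    and h0: "poly h 0 \<noteq> 0"
    and ord: "\<And>n. (\<forall>x. d dvd n * order x h) \<Longrightarrow> d dvd n"
    and P: "P = CARD('a) ^ s" "d * A + d * degree h < P"
    and k: "\<exists>t\<in>{..<N} \<times> {..<d} \<times> {..A}. k t \<noteq> 0"
  shows "(\<Sum>(i, j, a)\<in>{..<N} \<times> {..<d} \<times> {..A}.
           smult (k (i, j, a)) (monom 1 (a + i * P) * h ^ ((P - 1) div d * j))) \<noteq> 0"
    (is "?H \<noteq> 0")
proof
  assume H: "?H = 0"
  define G where "G = h ^ ((P - 1) div d)"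
  define K where "K = (\<lambda>i j. \<Sum>a\<le>A. monom (k (i, j, a)) a)"
  define U where "U = (\<lambda>i. \<Sum>j<d. monom (K i j) j)"
  have coeff_K: "coeff (K i j) a = (if a \<le> A then k (i, j, a) else 0)" for i j a
    unfolding K_def coeff_sum coeff_monom by (simp add: if_distrib cong: if_cong)
  have coeff_U: "coeff (U i) j = (if j < d then K i j else 0)" for i j
    unfolding U_def coeff_sum coeff_monom by (simp add: if_distrib cong: if_cong)
  have "?H = (\<Sum>i<N. monom 1 (i * P) * poly (U i) G)"
    unfolding U_def K_def poly_sum poly_monom sum_distrib_left sum_distrib_right sum.cartesian_product
    by (rule sum.cong)
       (auto simp: G_def power_mult mult_monom mult.assoc[symmetric] smult_monom add_ac simp flip: mult_smult_left)
  with H have sum0: "(\<Sum>i<N. monom 1 (i * P) * poly (U i) G) = 0" by simp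
  obtain i j a where "i < N" "j < d" "a \<le> A" "k (i, j, a) \<noteq> 0" using k by auto
  then have "coeff (coeff (U i) j) a \<noteq> 0" by (simp add: coeff_U coeff_K)
  then have "U i \<noteq> 0" by auto
  define i0 where "i0 = (LEAST i. U i \<noteq> 0)"
  have U0: "U i0 \<noteq> 0" unfolding i0_def by (rule LeastI) fact
  have below: "U i' = 0" if "i' < i0" for i' using not_less_Least that unfolding i0_def by blast
  have "i0 \<le> i" unfolding i0_def by (rule Least_le) fact
  with \<open>i < N\<close> have i0: "i0 < N" by simp
  have split: "{..<N} = insert i0 ({..<i0} \<union> {i0<..<N})" using i0 by auto
  have "(\<Sum>i<N. monom 1 (i * P) * poly (U i) G) =
      monom 1 (i0 * P) * poly (U i0) G + (\<Sum>i\<in>{..<i0} \<union> {i0<..<N}. monom 1 (i * P) * poly (U i) G)"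
    unfolding split by (rule sum.insert) auto
  also have "(\<Sum>i\<in>{..<i0} \<union> {i0<..<N}. monom 1 (i * P) * poly (U i) G) =
      (\<Sum>i\<in>{i0<..<N}. monom 1 (i * P) * poly (U i) G)"
    by (rule sum.mono_neutral_right) (use below in auto)
  also have "\<dots> = (\<Sum>i\<in>{i0<..<N}. monom 1 (i0 * P) * (monom 1 P * (monom 1 ((i - Suc i0) * P) * poly (U i) G)))"
  proof (rule sum.cong)
    fix i assume "i \<in> {i0<..<N}"
    then obtain m where "i = Suc (i0 + m)" using less_imp_Suc_add by auto
    then have "i0 * P + (P + (i - Suc i0) * P) = i * P" by (simp add: algebra_simps)
    then show "monom 1 (i * P) * poly (U i) G = monom 1 (i0 * P) * (monom 1 P * (monom 1 ((i - Suc i0) * P) * poly (U i) G))"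
      by (simp add: mult_monom mult.assoc[symmetric] add.assoc)
  qed simp
  finally have "monom 1 (i0 * P) * (poly (U i0) G + monom 1 P * (\<Sum>i\<in>{i0<..<N}. monom 1 ((i - Suc i0) * P) * poly (U i) G)) = 0"
    unfolding sum0 by (simp add: sum_distrib_left distrib_left)
  then have "poly (U i0) G + monom 1 P * (\<Sum>i\<in>{i0<..<N}. monom 1 ((i - Suc i0) * P) * poly (U i) G) = 0"
    by (simp add: monom_eq_0_iff)
  then have dvd: "monom 1 P dvd poly (U i0) G"
    unfolding add_eq_0_iff2 by simp
  have "degree (U i0) \<le> d - 1"
    by (rule degree_le) (use d(2) in \<open>auto simp: coeff_U\<close>)
  then have "degree (U i0) < d" using d(2) by simp
  moreover have "degree (coeff (U i0) j) \<le> A" for j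
    by (rule degree_le) (simp add: coeff_U coeff_K)
  ultimately show False
    using kummer_nonvanishing[OF d h0 ord U0 _ _ P] dvd unfolding G_def by blast
qed

text \<open>Assumption \<open>N\<close> says that the free coefficients of \<open>H\<close>,
  \<open>N * (d * (A + 1))\<close> in number, exceed the degree bound of the polynomial that agrees
  with H^P g^d on the set. That polynomial can be made zero by a nontrivial choice, and then the
  degree of \<open>H\<close> bounds the set.\<close>

lemma stepanov_count:
  fixes h :: "'a::{field,finite} poly"
  assumes d: "d dvd CARD('a) - 1" "d > 0"
    and h0: "poly h 0 \<noteq> 0"
    and ord: "\<And>n. (\<forall>x. d dvd n * order x h) \<Longrightarrow> d dvd n"
    and P: "P = CARD('a) ^ s" "d * A + d * degree h < P"
    and N: "N + (A + degree h) * P + 1 < N * (d * (A + 1))"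
    and c: "c \<noteq> 0"
  shows "card {x :: 'a alg_closure. x ^ (P * P) = x \<and>
           poly (map_poly to_ac h) x ^ ((P * P - 1) div d) = to_ac c} \<le> A + (N + degree h) * P"
    (is "card ?X \<le> _")
proof -
  define w where "w = (P - 1) div d"
  have P0: "P > 0" unfolding P(1) by simp
  have dw: "d * w = P - 1"
    unfolding w_def P(1) by (rule dvd_mult_div_cancel[OF dvd_power_minus_1[OF d(1)]])
  \<comment> \<open>With g = h(x)^w the condition on \<open>x\<close> reads g^(P+1) = c: raising to
    the power \<open>P\<close> inverts \<open>g\<close> up to the constant \<open>c\<close>.\<close>
  have wP: "(P * P - 1) div d = w * (P + 1)"
  proof -
    have "P * P - 1 = d * (w * (P + 1))"
      unfolding mult.assoc[symmetric] dw using P0 by (simp add: algebra_simps)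
    then show ?thesis using d(2) by simp
  qed
  let ?J = "{..<N} \<times> {..<d} \<times> {..A}"
  \<comment> \<open>At a point of the set this is g^d times the P-th power of the (i, j, a) term of
    \<open>H\<close>: x^(P P) = x turns the exponent a + iP into i + aP, and g^(jP) g^d = c^j
    g^(d-j). The factor g^d avoids negative exponents.\<close>
  define v where "v = (\<lambda>(i, j, a). monom (c ^ j) (i + a * P) * h ^ (w * (d - j)))"
  have degv: "degree (v t) < N + (A + degree h) * P + 1" if "t \<in> ?J" for t
  proof -
    obtain i j a where "t = (i, j, a)" by (cases t)
    with that have t: "t = (i, j, a)" "i < N" "j < d" "a \<le> A" by auto
    have "degree (h ^ (w * (d - j))) \<le> degree h * (w * (d - j))" by (rule degree_power_le)
    also have "\<dots> \<le> degree h * P"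
    proof (rule mult_left_mono)
      have "w * (d - j) \<le> w * d" by simp
      then show "w * (d - j) \<le> P" using dw by (simp add: mult.commute)
    qed simp
    finally have "degree (v t) \<le> (i + a * P) + degree h * P"
      unfolding v_def t(1) prod.case
      by (intro order_trans[OF degree_mult_le] add_mono degree_monom_le)
    also have "\<dots> \<le> i + A * P + degree h * P" using t(4) by simp
    finally show ?thesis using t(2) by (simp add: algebra_simps)
  qed
  have cardJ: "N + (A + degree h) * P + 1 < card ?J"
    using N by (simp add: card_cartesian_product)
  have "finite ?J" by simp
  obtain k where k: "\<exists>t\<in>?J. k t \<noteq> 0" and rel: "(\<Sum>t\<in>?J. smult (k t) (v t)) = 0"
    by (rule linear_relation_by_counting[OF \<open>finite ?J\<close> degv cardJ])
  define H where "H = (\<Sum>(i, j, a)\<in>?J. smult (k (i, j, a)) (monom 1 (a + i * P) * h ^ (w * j)))"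
  have H0: "H \<noteq> 0"
    unfolding H_def w_def by (rule stepanov_auxiliary_nonzero[OF d h0 ord P k])
  have degH: "degree H \<le> A + (N + degree h) * P"
    unfolding H_def
  proof (intro degree_sum_le, safe)
    fix i j a assume t: "i < N" "j < d" "a \<le> A"
    have "degree (smult (k (i, j, a)) (monom 1 (a + i * P) * h ^ (w * j)))
        \<le> (a + i * P) + degree h * (w * j)"
      by (intro order_trans[OF degree_smult_le] order_trans[OF degree_mult_le] add_mono
            degree_monom_le degree_power_le)
    also have "\<dots> \<le> (A + N * P) + degree h * P"
    proof (intro add_mono mult_mono)
      have "w * j \<le> w * d" using t by simp
      then show "w * j \<le> P" using dw by (simp add: mult.commute)
    qed (use t in auto)
    finally show "degree (smult (k (i, j, a)) (monom 1 (a + i * P) * h ^ (w * j))) \<le> A + (N + degree h) * P"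
      by (simp add: algebra_simps)
  qed simp
  have "poly (map_poly to_ac H) x = 0" if "x \<in> ?X" for x
  proof -
    define g where "g = poly (map_poly to_ac h) x ^ w"
    have xP: "x ^ (P * P) = x" using that by simp
    have "poly (map_poly to_ac h) x ^ ((P * P - 1) div d) = to_ac c" using that by simp
    then have g: "g ^ (P + 1) = to_ac c" unfolding wP by (simp only: g_def power_mult)
    have g0: "g \<noteq> 0" using g c by auto
    let ?t = "\<lambda>(i, j, a). to_ac (k (i, j, a)) * (x ^ (a + i * P) * g ^ j)"
    have "poly (map_poly to_ac H) x = (\<Sum>t\<in>?J. ?t t)"
      unfolding H_def map_to_ac.hom_sum poly_sum
      by (intro sum.cong) (auto simp: to_ac.map_poly_hom_smult map_to_ac.hom_mult map_to_ac.hom_power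
           poly_monom g_def power_mult)
    moreover have "(\<Sum>t\<in>?J. ?t t) ^ P = (\<Sum>t\<in>?J. ?t t ^ P)"
      unfolding P(1) by (rule frobenius_power_sum) simp
    ultimately have "poly (map_poly to_ac H) x ^ P * g ^ d = (\<Sum>t\<in>?J. ?t t ^ P * g ^ d)"
      by (simp only: sum_distrib_right)
    also have "\<dots> = (\<Sum>t\<in>?J. poly (map_poly to_ac (smult (k t) (v t))) x)"
    proof (rule sum.cong[OF refl])
      fix t assume "t \<in> ?J"
      then obtain i j a where tt: "t = (i, j, a)" and t: "i < N" "j < d" "a \<le> A" by (cases t) auto
      have kP: "to_ac (k (i, j, a)) ^ P = to_ac (k (i, j, a))"
        unfolding P(1) to_ac_power[symmetric] finite_field_power_card_power ..
      have "(x ^ (a + i * P)) ^ P = (x ^ (P * P)) ^ i * x ^ (a * P)"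
        by (simp add: algebra_simps flip: power_mult power_add)
      then have xe: "(x ^ (a + i * P)) ^ P = x ^ (i + a * P)"
        unfolding xP by (simp add: power_add)
      have "g ^ d = g ^ j * g ^ (d - j)" using t(2) by (simp flip: power_add)
      then have ge: "(g ^ j) ^ P * g ^ d = to_ac c ^ j * g ^ (d - j)"
        unfolding g[symmetric] by (simp add: algebra_simps flip: power_mult power_add)
      show "?t t ^ P * g ^ d = poly (map_poly to_ac (smult (k t) (v t))) x"
        unfolding tt prod.case power_mult_distrib kP xe mult.assoc ge
        by (simp add: v_def to_ac.map_poly_hom_smult map_to_ac.hom_mult map_to_ac.hom_power
           poly_monom g_def power_mult mult_ac)
    qed
    also have "\<dots> = poly (map_poly to_ac (\<Sum>t\<in>?J. smult (k t) (v t))) x"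
      by (simp add: map_to_ac.hom_sum poly_sum)
    finally show ?thesis using g0 unfolding rel by simp
  qed
  then have "?X \<subseteq> {x. poly (map_poly to_ac H) x = 0}" by blast
  moreover have "map_poly to_ac H \<noteq> 0" using H0 by simp
  ultimately have "card ?X \<le> degree (map_poly to_ac H)"
    using card_mono[OF poly_roots_finite, of "map_poly to_ac H" ?X] card_poly_roots_bound[of "map_poly to_ac H"]
    by linarith
  then show ?thesis using degH by simp
qed

section \<open>Finite subfields of the algebraic closure\<close>

lemma of_nat_CARD_eq_0: "of_nat CARD('a::{field,finite}) = (0::'a)"
proof -
  have "(\<Sum>x\<in>UNIV. x + 1) = (\<Sum>x\<in>UNIV. x::'a)"
    by (rule sum.reindex_bij_witness[of _ "\<lambda>x. x - 1" "\<lambda>x. x + 1"]) auto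
  then show ?thesis by (simp add: sum.distrib)
qed

text \<open>For \<open>r > 0\<close> the field with q^r elements, kept inside one algebraic closure
  so that all extensions share a type.\<close>

definition frob_fixed :: "'a::{field,finite} itself \<Rightarrow> nat \<Rightarrow> 'a alg_closure set" where
  "frob_fixed _ r = {x. x ^ (CARD('a) ^ r) = x}"

text \<open>Since q is 0 in the field, X^Q - X has derivative -1, so its Q roots in the closure are
  simple.\<close>

lemma finite_card_frob_fixed:
  assumes "r > 0"
  shows "finite (frob_fixed TYPE('a::{field,finite}) r)" "card (frob_fixed TYPE('a) r) = CARD('a) ^ r"
proof -
  let ?Q = "CARD('a) ^ r"
  define f :: "'a alg_closure poly" where "f = monom 1 ?Q - [:0, 1:]"
  have "CARD('a) ^ 1 \<le> ?Q" using assms by (intro power_increasing) auto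
  then have Q: "?Q \<ge> 2" using card_finite_field_ge_2[where 'a='a] by simp
  have "degree [:0, 1 :: 'a alg_closure:] < ?Q" 
  proof -
    have "degree [:0, 1 :: 'a alg_closure:] = 1" by simp
    then show ?thesis using Q by linarith
  qed
  then have coeff_f: "coeff f ?Q = 1" by (simp add: f_def coeff_eq_0)
  have "degree f \<le> ?Q"
    unfolding f_def by (intro degree_diff_le degree_monom_le) (use Q in simp)
  then have deg: "degree f = ?Q" using coeff_f le_degree[of f ?Q] by simp
  then have lc: "lead_coeff f = 1" using coeff_f by simp
  then have f0: "f \<noteq> 0" by auto
  have "to_ac (of_nat CARD('a) :: 'a) = 0" by (simp only: of_nat_CARD_eq_0 to_ac_0)
  then have "of_nat CARD('a) = (0 :: 'a alg_closure)" by simp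
  then have pderiv: "pderiv f = - 1"
    using assms by (simp add: f_def pderiv_diff pderiv_monom pderiv_pCons one_pCons power_0_left)
  obtain A where A: "size A = ?Q" "f = (\<Prod>x\<in>#A. [:-x, 1:])"
    using alg_closed_imp_factorization[OF f0] lc deg by auto
  have count1: "count A x \<le> 1" for x
  proof (rule ccontr)
    assume "\<not> count A x \<le> 1"
    then have "count A x \<ge> 2" by simp
    then have "replicate_mset 2 x \<subseteq># A" by (simp add: count_le_replicate_mset_subset_eq[symmetric])
    then obtain B where "A = replicate_mset 2 x + B" by (metis subset_mset.le_iff_add)
    then have "f = [:-x, 1:] * ([:-x, 1:] * (\<Prod>x\<in>#B. [:-x, 1:]))"
      unfolding A(2) by (simp add: numeral_2_eq_2)
    then have "poly (pderiv f) x = 0"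
      by (simp only: pderiv_mult poly_add poly_mult) simp
    then show False by (simp add: pderiv)
  qed
  have "poly (\<Prod>x\<in>#A. [:-x, 1:]) y = 0 \<longleftrightarrow> y \<in># A" for y and A :: "'a alg_closure multiset"
    by (induction A) auto
  then have "poly f y = 0 \<longleftrightarrow> y \<in># A" for y unfolding A(2) .
  moreover have "poly f y = y ^ ?Q - y" for y by (simp add: f_def poly_monom)
  ultimately have fixed_eq: "frob_fixed TYPE('a) r = set_mset A"
    unfolding frob_fixed_def by auto
  then show "finite (frob_fixed TYPE('a) r)" by simp
  have "size A = (\<Sum>x\<in>set_mset A. count A x)" by (rule size_multiset_overloaded_eq)
  also have "\<dots> = (\<Sum>x\<in>set_mset A. 1)"
    by (intro sum.cong refl) (use count1 in \<open>metis One_nat_def count_eq_zero_iff le_Suc_eq le_zero_eq\<close>)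
  finally show "card (frob_fixed TYPE('a) r) = ?Q" using fixed_eq A(1) by simp
qed

text \<open>This is how coefficients, and values of the residue symbol, are recognised as elements
  of the base field.\<close>

lemma frob_fixed_1: "frob_fixed TYPE('a::{field,finite}) 1 = range to_ac"
proof (rule card_subset_eq[symmetric])
  show "finite (frob_fixed TYPE('a) 1)" by (simp add: finite_card_frob_fixed)
  show "range to_ac \<subseteq> frob_fixed TYPE('a) 1"
    by (auto simp: frob_fixed_def finite_field_power_card simp flip: to_ac_power)
  show "card (range (to_ac :: 'a \<Rightarrow> _)) = card (frob_fixed TYPE('a) 1)"
    by (simp add: finite_card_frob_fixed card_image inj_to_ac)
qed

lemma poly_map_to_ac_power:
  fixes h :: "'a::{field,finite} poly"
  shows "poly (map_poly to_ac h) x ^ (CARD('a) ^ r) = poly (map_poly to_ac h) (x ^ (CARD('a) ^ r))"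
proof -
  have "poly (map_poly to_ac h) x = (\<Sum>i\<le>degree h. to_ac (coeff h i) * x ^ i)"
    by (simp add: poly_altdef)
  then have "poly (map_poly to_ac h) x ^ (CARD('a) ^ r)
      = (\<Sum>i\<le>degree h. (to_ac (coeff h i) * x ^ i) ^ (CARD('a) ^ r))"
    by (simp add: frobenius_power_sum)
  also have "\<dots> = (\<Sum>i\<le>degree h. to_ac (coeff h i) * (x ^ (CARD('a) ^ r)) ^ i)"
    by (intro sum.cong refl)
       (simp add: power_mult_distrib finite_field_power_card_power mult.commute flip: to_ac_power power_mult)
  finally show ?thesis by (simp add: poly_altdef)
qed

section \<open>Character sums over extensions of even degree\<close>

text \<open>For Q a power of q, the points of the field with Q elements where the d-th power residue
  symbol of \<open>h\<close> has the value \<open>c\<close>.\<close>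

definition radical_fibre :: "'a::field poly \<Rightarrow> nat \<Rightarrow> nat \<Rightarrow> 'a \<Rightarrow> 'a alg_closure set" where
  "radical_fibre h d Q c = {x. x ^ Q = x \<and> poly (map_poly to_ac h) x ^ ((Q - 1) div d) = to_ac c}"

lemma card_radical_fibre_le:
  fixes h :: "'a::{field,finite} poly"
  assumes d: "d dvd CARD('a) - 1" "d > 1"
    and h0: "poly h 0 \<noteq> 0"
    and ord: "\<And>n. (\<forall>x. d dvd n * order x h) \<Longrightarrow> d dvd n"
    and s: "s > 0" and c: "c \<noteq> 0" and P: "P = CARD('a) ^ s"
  shows "real (card (radical_fibre h d (P * P) c)) \<le>
    real (P * P) / real d + real (2 * d * degree h + 3 * degree h + 8) * real P"
proof -
  let ?E = "degree h"
  show ?thesis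
  proof (cases "2 * d * ?E + 8 < P")
    case True
    \<comment> \<open>\<open>A\<close> near P / (2 d) keeps d A + d deg h below \<open>P\<close>
      while d (A + 1) > P / 2. \<open>N\<close> near P / d gives a degree of leading order P^2 / d;
      its surplus 2 deg h + 3 makes the unknowns outnumber the conditions.\<close>
    define A where "A = P div (2 * d)"
    define N where "N = P div d + 2 * ?E + 3"
    have A1: "2 * d * A \<le> P" unfolding A_def by (rule times_div_less_eq_dividend)
    have A2: "P < 2 * d * (A + 1)"
      unfolding A_def using d(2) by (simp add: dividend_less_times_div mult.commute)
    have N1: "d * (P div d) \<le> P" by (rule times_div_less_eq_dividend)
    have N2: "P < d * (P div d + 1)"
      using d(2) dividend_less_times_div[of d P] by (simp add: algebra_simps)
    have half: "2 * (P div d) \<le> P"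
    proof -
      have "2 * (P div d) \<le> d * (P div d)" using d(2) by (intro mult_right_mono) simp_all
      then show ?thesis using N1 by linarith
    qed
    have E4: "4 * ?E + 8 < P"
    proof -
      have "4 * ?E \<le> 2 * d * ?E" using d(2) by simp
      then show ?thesis using True by linarith
    qed
    have "d * A + d * ?E < P" using A1 True by (simp add: mult.assoc)
    moreover have "N + (A + ?E) * P + 1 < N * (d * (A + 1))"
    proof -
      have "(P + d * (2 * ?E + 2)) * (A + 1) \<le> N * d * (A + 1)"
        using N2 by (intro mult_right_mono) (simp_all add: N_def algebra_simps)
      moreover have "P * (?E + 1) \<le> d * (2 * ?E + 2) * (A + 1)"
      proof -
        have "P * (?E + 1) \<le> 2 * d * (A + 1) * (?E + 1)"
          using A2 by (intro mult_right_mono) simp_all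
        then show ?thesis by (simp add: algebra_simps)
      qed
      moreover have "(P + d * (2 * ?E + 2)) * (A + 1) = P * A + P + d * (2 * ?E + 2) * (A + 1)"
        by (simp add: algebra_simps)
      moreover have "N + (A + ?E) * P + 1 < P * A + P + P * (?E + 1)"
        using half E4 unfolding N_def by (simp add: algebra_simps)
      ultimately show ?thesis by (simp only: mult.assoc)
    qed
    ultimately have "card (radical_fibre h d (P * P) c) \<le> A + (N + ?E) * P"
      unfolding radical_fibre_def
      using stepanov_count[OF d(1) _ h0 ord P _ _ c, of A N] d(2) by simp
    also have "\<dots> \<le> P + (P div d + 3 * ?E + 3) * P"
    proof -
      have "A \<le> P" unfolding A_def by (rule div_le_dividend)
      moreover have "N + ?E = P div d + 3 * ?E + 3" by (simp add: N_def)
      ultimately show ?thesis by (simp only: add_le_cancel_right)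
    qed
    finally have "real (card (radical_fibre h d (P * P) c)) \<le> real (P + (P div d + 3 * ?E + 3) * P)"
      by (simp only: of_nat_le_iff)
    also have "\<dots> = real (P div d) * real P + real (3 * ?E + 4) * real P"
      by (simp add: algebra_simps)
    also have "\<dots> \<le> (real P / real d) * real P + real (2 * d * ?E + 3 * ?E + 8) * real P"
    proof (intro add_mono mult_right_mono)
      have "real (d * (P div d)) \<le> real P" using N1 by (simp only: of_nat_le_iff)
      then show "real (P div d) \<le> real P / real d" using d(2) by (simp add: field_simps)
    qed simp_all
    finally show ?thesis by simp
  next
    case False
    \<comment> \<open>Here \<open>P\<close> is bounded by a constant, so the trivial bound P^2 is
      already a constant times \<open>P\<close>.\<close>
    have fixed: "frob_fixed TYPE('a) (2 * s) = {x. x ^ (P * P) = x}"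
      unfolding frob_fixed_def P by (simp add: mult_2 power_add)
    have "card (radical_fibre h d (P * P) c) \<le> card (frob_fixed TYPE('a) (2 * s))"
      using s by (intro card_mono finite_card_frob_fixed) (auto simp: fixed radical_fibre_def)
    also have "\<dots> = P * P"
      using s by (subst finite_card_frob_fixed) (simp_all add: P mult_2 power_add)
    also have "\<dots> \<le> (2 * d * ?E + 3 * ?E + 8) * P"
      using False by (intro mult_right_mono) simp_all
    finally have "real (card (radical_fibre h d (P * P) c)) \<le> real ((2 * d * ?E + 3 * ?E + 8) * P)"
      by (simp only: of_nat_le_iff)
    also have "\<dots> \<le> real (P * P) / real d + real (2 * d * ?E + 3 * ?E + 8) * real P" by simp
    finally show ?thesis .
  qed
qed

lemma card_roots_of_unity_le:
  assumes "d > 0" shows "card {c::'a::idom. c ^ d = 1} \<le> d"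
proof -
  define p :: "'a poly" where "p = monom 1 d - 1"
  have "coeff p d = 1" using assms by (simp add: p_def)
  then have "p \<noteq> 0" by auto
  moreover have "degree p \<le> d" unfolding p_def by (intro degree_diff_le degree_monom_le) simp
  moreover have "{c. poly p c = 0} = {c. c ^ d = 1}" by (simp add: p_def poly_monom)
  ultimately show ?thesis using card_poly_roots_bound[of p] by simp
qed

text \<open>The exponent is that of the norm to the base field, so the character is lifted to the
  extension through the norm; \<open>of_ac\<close> takes the norm back to the base type.\<close>

definition ext_char_sum :: "'a::{field,finite} poly \<Rightarrow> nat \<Rightarrow> complex" where
  "ext_char_sum f r = (\<Sum>x\<in>frob_fixed TYPE('a) r.
     field_char (of_ac (poly (map_poly to_ac f) x ^ ((CARD('a) ^ r - 1) div (CARD('a) - 1)))))"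

text \<open>Split the sum by the value of the residue symbol. Each fibre has P^2 / d points up to a
  constant times P, and the main terms cancel because \<open>field_char\<close> sums to 0 over the
  d-th roots of unity.\<close>

lemma ext_char_sum_bound:
  fixes h :: "'a::{field,finite} poly"
  assumes dg: "d * g = CARD('a) - 1" and d: "d > 1"
    and h0: "poly h 0 \<noteq> 0"
    and ord: "\<And>n. (\<forall>x. d dvd n * order x h) \<Longrightarrow> d dvd n"
  shows "\<exists>C. \<forall>s>0. norm (ext_char_sum (h ^ g) (2 * s)) \<le> C * real (CARD('a) ^ s)"
proof (intro exI allI impI)
  fix s :: nat assume s: "s > 0"
  define P where "P = CARD('a) ^ s"
  define B where "B = real (2 * d * degree h + 3 * degree h + 8)"
  let ?E = "degree h"
  let ?F = "frob_fixed TYPE('a) (2 * s)"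
  let ?M = "{c::'a. c ^ d = 1}"
  let ?X = "radical_fibre h d (P * P)"
  let ?h = "\<lambda>x. poly (map_poly to_ac h) x"
  have N0: "CARD('a) - 1 > 0" using card_finite_field_ge_2[where 'a='a] by simp
  have P0: "P > 0" unfolding P_def by simp
  have dvd: "d dvd CARD('a) - 1" using dg by (metis dvd_triv_left)
  have PP: "P * P = CARD('a) ^ (2 * s)" unfolding P_def by (simp add: mult_2 power_add)
  have F: "?F = {x. x ^ (P * P) = x}" unfolding frob_fixed_def PP ..
  have finF: "finite ?F" and cardF: "card ?F = P * P"
    using s by (simp_all add: finite_card_frob_fixed PP)
  have exponent: "g * ((P * P - 1) div (CARD('a) - 1)) = (P * P - 1) div d"
  proof -
    obtain t where t: "P * P - 1 = (CARD('a) - 1) * t"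
      unfolding PP using dvd_power_minus_1[of "CARD('a) - 1" "CARD('a)" "2 * s"] by auto
    have "(P * P - 1) div (CARD('a) - 1) = t" unfolding t using N0 by simp
    moreover have "(P * P - 1) div d = g * t" unfolding t dg[symmetric] using d by (simp add: mult.assoc)
    ultimately show ?thesis by simp
  qed
  have dP: "d * ((P * P - 1) div d) = P * P - 1"
    unfolding PP by (rule dvd_mult_div_cancel[OF dvd_power_minus_1[OF dvd]])
  have PP1: "P * P = Suc (P * P - 1)" using P0 by simp
  have pos: "(P * P - 1) div d > 0"
  proof (rule ccontr)
    assume "\<not> (P * P - 1) div d > 0"
    then have "P * P - 1 = 0" using dP by simp
    moreover have "P \<ge> 2"
    proof -
      have "CARD('a) ^ 1 \<le> P" unfolding P_def using s by (intro power_increasing) auto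
      then show ?thesis using card_finite_field_ge_2[where 'a='a] by simp
    qed
    then have "P * P \<ge> 2 * 2" by (intro mult_mono) auto
    ultimately show False by simp
  qed
  \<comment> \<open>The symbol is a d-th root of unity in the closure; as \<open>d\<close> divides q
    - 1, Frobenius fixes it, so it lies in the base field.\<close>
  have value_in: "\<exists>c\<in>?M. x \<in> ?X c" if x: "x \<in> ?F" "?h x \<noteq> 0" for x
  proof -
    define y where "y = ?h x ^ ((P * P - 1) div d)"
    have "?h x ^ (P * P) = ?h x"
      using x(1) poly_map_to_ac_power[of h x "2 * s"] unfolding F PP by simp
    then have "?h x * ?h x ^ (P * P - 1) = ?h x" by (subst (asm) PP1) simp
    then have yd: "y ^ d = 1"
      unfolding y_def power_mult[symmetric] mult.commute[of _ d] dP using x(2) by simp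
    then have "y ^ (CARD('a) - 1) = 1" unfolding dg[symmetric] power_mult by simp
    then have "y ^ CARD('a) = y"
      by (metis mult.left_neutral power_minus_mult zero_less_card_finite)
    then have "y \<in> frob_fixed TYPE('a) 1" by (simp add: frob_fixed_def)
    then obtain c where c: "y = to_ac c" unfolding frob_fixed_1 by auto
    then have "to_ac (c ^ d) = to_ac 1" using yd by simp
    then have "c \<in> ?M" by (simp only: to_ac_eq_iff mem_Collect_eq)
    then show ?thesis using x c unfolding radical_fibre_def F y_def by blast
  qed
  have M0: "c \<noteq> 0" if "c \<in> ?M" for c using that d by (auto simp: power_0_left)
  have finM: "finite ?M" by simp
  have cardM: "card ?M \<le> d" using d by (intro card_roots_of_unity_le) simp
  have X_sub: "?X c \<subseteq> ?F" for c unfolding radical_fibre_def F by blast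
  have finX: "finite (?X c)" for c using X_sub finF finite_subset by blast
  have disj: "?X c \<inter> ?X c' = {}" if "c \<noteq> c'" for c c'
    using that unfolding radical_fibre_def by auto
  have X_nz: "?h x \<noteq> 0" if "x \<in> ?X c" "c \<in> ?M" for x c
  proof
    assume "?h x = 0"
    moreover note pos
    ultimately have "to_ac c = 0"
      using that(1) unfolding radical_fibre_def by (simp add: power_0_left)
    then show False using M0[OF that(2)] by simp
  qed
  define Z where "Z = {x\<in>?F. ?h x = 0}"
  have hne: "map_poly to_ac h \<noteq> 0" using h0 by auto
  have "card Z \<le> card {x. ?h x = 0}"
    unfolding Z_def by (rule card_mono[OF poly_roots_finite[OF hne]]) blast
  also have "\<dots> \<le> ?E" using card_poly_roots_bound[OF hne] by simp
  finally have cardZ: "card Z \<le> ?E" .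
  have F_split: "?F = Z \<union> (\<Union>c\<in>?M. ?X c)"
    using value_in X_sub unfolding Z_def by blast
  have cardU: "card (\<Union>c\<in>?M. ?X c) = (\<Sum>c\<in>?M. card (?X c))"
    by (rule card_UN_disjoint) (use finX disj in auto)
  have disjZ: "Z \<inter> (\<Union>c\<in>?M. ?X c) = {}" using X_nz unfolding Z_def by blast
  have total: "P * P = card Z + (\<Sum>c\<in>?M. card (?X c))"
  proof -
    have "card (Z \<union> (\<Union>c\<in>?M. ?X c)) = card Z + card (\<Union>c\<in>?M. ?X c)"
      by (rule card_Un_disjoint) (use finF finX disjZ in \<open>auto simp: Z_def\<close>)
    then show ?thesis unfolding F_split[symmetric] cardF cardU .
  qed
  have upper: "real (card (?X c)) \<le> real (P * P) / real d + B * real P" if "c \<in> ?M" for c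
    unfolding B_def by (rule card_radical_fibre_le[OF dvd d h0 ord s M0[OF that] P_def])
  \<comment> \<open>The lower bound for one fibre: at most d - 1 others, each bounded above, and at
    most deg h zeros must leave enough of the P^2 points.\<close>
  have dev: "\<bar>real (card (?X c)) - real (P * P) / real d\<bar> \<le> (real ?E + real d * B) * real P" if c: "c \<in> ?M" for c
  proof -
    have B0: "B \<ge> 0" unfolding B_def by simp
    have card': "card (?M - {c}) \<le> d - 1" using cardM c finM by (simp add: card_Diff_singleton)
    have "(\<Sum>c'\<in>?M - {c}. real (card (?X c'))) \<le> (\<Sum>c'\<in>?M - {c}. real (P * P) / real d + B * real P)"
      by (intro sum_mono upper) simp
    also have "\<dots> = real (card (?M - {c})) * (real (P * P) / real d + B * real P)" by simp
    also have "\<dots> \<le> real (d - 1) * (real (P * P) / real d + B * real P)"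
      using card' B0 by (intro mult_right_mono) simp_all
    also have "\<dots> = real (P * P) - real (P * P) / real d + real (d - 1) * B * real P"
      using d by (simp add: of_nat_diff field_simps)
    also have "\<dots> \<le> real (P * P) - real (P * P) / real d + real d * B * real P"
      using B0 by (intro add_left_mono mult_right_mono) simp_all
    finally have others: "(\<Sum>c'\<in>?M - {c}. real (card (?X c'))) \<le> \<dots>" .
    have "real (P * P) = real (card Z) + (\<Sum>c\<in>?M. real (card (?X c)))"
      by (subst total) simp
    also have "(\<Sum>c\<in>?M. real (card (?X c))) = real (card (?X c)) + (\<Sum>c'\<in>?M - {c}. real (card (?X c')))"
      by (rule sum.remove[OF finM c])
    finally have "real (card (?X c)) \<ge> real (P * P) / real d - real ?E - real d * B * real P"
      using others cardZ by linarith
    moreover have "real ?E \<le> real ?E * real P" using P0 by (simp add: mult_le_cancel_left1)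
    moreover have "B * real P \<le> real d * B * real P"
      using d B0 by (intro mult_right_mono) (simp_all add: mult_le_cancel_right1)
    moreover have "real ?E * real P \<ge> 0" by simp
    ultimately show ?thesis using upper[OF c] by (simp add: abs_le_iff distrib_right)
  qed
  let ?\<psi> = "\<lambda>x. field_char (of_ac (poly (map_poly to_ac (h ^ g)) x ^ ((CARD('a) ^ (2 * s) - 1) div (CARD('a) - 1))))"
  have psi: "?\<psi> x = field_char (of_ac (?h x ^ ((P * P - 1) div d)))" for x
    by (simp only: map_to_ac.hom_power poly_power power_mult[symmetric] PP[symmetric] exponent)
  have "ext_char_sum (h ^ g) (2 * s) = (\<Sum>x\<in>?F. ?\<psi> x)" unfolding ext_char_sum_def ..
  also have "\<dots> = (\<Sum>x\<in>(\<Union>c\<in>?M. ?X c). ?\<psi> x)"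
  proof (rule sum.mono_neutral_right[OF finF])
    show "(\<Union>c\<in>?M. ?X c) \<subseteq> ?F" using X_sub by blast
    show "\<forall>x\<in>?F - (\<Union>c\<in>?M. ?X c). ?\<psi> x = 0"
    proof
      fix x assume "x \<in> ?F - (\<Union>c\<in>?M. ?X c)"
      then have "?h x = 0" using value_in by blast
      moreover note pos
      ultimately show "?\<psi> x = 0" unfolding psi by (simp add: power_0_left)
    qed
  qed
  also have "\<dots> = (\<Sum>c\<in>?M. \<Sum>x\<in>?X c. ?\<psi> x)"
    by (rule sum.UNION_disjoint) (use finX disj in auto)
  also have "\<dots> = (\<Sum>c\<in>?M. field_char c * of_nat (card (?X c)))"
  proof (rule sum.cong[OF refl])
    fix c
    have "(\<Sum>x\<in>?X c. ?\<psi> x) = (\<Sum>x\<in>?X c. field_char c)"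
    proof (rule sum.cong[OF refl])
      fix x assume "x \<in> ?X c"
      then have "?h x ^ ((P * P - 1) div d) = to_ac c" unfolding radical_fibre_def by blast
      then show "?\<psi> x = field_char c" unfolding psi by (simp only: of_ac_to_ac)
    qed
    then show "(\<Sum>x\<in>?X c. ?\<psi> x) = field_char c * of_nat (card (?X c))" by (simp add: mult.commute)
  qed
  also have "\<dots> = (\<Sum>c\<in>?M. field_char c * of_real (real (card (?X c)) - real (P * P) / real d))"
  proof -
    have "(\<Sum>c\<in>?M. field_char c * of_real (real (P * P) / real d)) = 0"
      unfolding sum_distrib_right[symmetric] sum_field_char_roots_of_unity[OF dvd d] by simp
    then show ?thesis by (simp add: right_diff_distrib sum_subtractf)
  qed
  finally have "norm (ext_char_sum (h ^ g) (2 * s)) \<le>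
      (\<Sum>c\<in>?M. norm (field_char c * of_real (real (card (?X c)) - real (P * P) / real d)))"
    by (simp only: norm_sum)
  also have "\<dots> \<le> (\<Sum>c\<in>?M. (real ?E + real d * B) * real P)"
  proof (rule sum_mono)
    fix c assume c: "c \<in> ?M"
    then show "norm (field_char c * of_real (real (card (?X c)) - real (P * P) / real d)) \<le> (real ?E + real d * B) * real P"
      unfolding norm_mult norm_field_char[OF M0[OF c]] norm_of_real using dev[OF c] by simp
  qed
  also have "\<dots> = real (card ?M) * ((real ?E + real d * B) * real P)" by simp
  also have "\<dots> \<le> real d * ((real ?E + real d * B) * real P)"
    using cardM by (intro mult_right_mono) (simp_all add: B_def)
  finally show "norm (ext_char_sum (h ^ g) (2 * s)) \<le>
     real d * (real ?E + real d * B) * real (CARD('a) ^ s)"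
    unfolding P_def by (simp only: mult.assoc)
qed

section \<open>Characteristic polynomials of Frobenius orbits\<close>

lemma frobenius_hom: "idom_hom (\<lambda>x::'a::{field,finite} alg_closure. x ^ CARD('a))"
  by standard (simp_all add: frobenius_add power_mult_distrib)

interpretation frob: idom_hom "\<lambda>x::'a::{field,finite} alg_closure. x ^ CARD('a)"
  by (rule frobenius_hom)

interpretation map_frob: map_poly_idom_hom "\<lambda>x::'a::{field,finite} alg_closure. x ^ CARD('a)" ..

text \<open>For \<open>x\<close> in the field with q^r elements, its characteristic polynomial over
  the base field; it is a proper power of the minimal polynomial if \<open>x\<close> lies in a
  smaller extension.\<close>

definition frob_poly :: "nat \<Rightarrow> 'a::{field,finite} alg_closure \<Rightarrow> 'a poly" where
  "frob_poly r x = map_poly of_ac (\<Prod>i<r. [:- (x ^ (CARD('a) ^ i)), 1:])"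

lemma frobenius_power_inj:
  fixes x y :: "'a::{field,finite} alg_closure"
  assumes "x ^ (CARD('a) ^ i) = y ^ (CARD('a) ^ i)"
  shows "x = y"
proof -
  have "(x - y) ^ (CARD('a) ^ i) = 0" using assms by (simp add: frobenius_power_diff)
  then show ?thesis by simp
qed

lemma frob_fixed_shift:
  fixes x :: "'a::{field,finite} alg_closure"
  assumes "x \<in> frob_fixed TYPE('a) r"
  shows "x ^ (CARD('a) ^ (r + i)) = x ^ (CARD('a) ^ i)"
  using assms by (simp add: frob_fixed_def power_add power_mult)

text \<open>As x^(q^r) = x, Frobenius permutes the factors cyclically. It therefore fixes all
  coefficients, and \<open>of_ac\<close> loses nothing.\<close>

lemma map_frob_poly:
  fixes x :: "'a::{field,finite} alg_closure"
  assumes "x \<in> frob_fixed TYPE('a) r" "r > 0"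
  shows "map_poly to_ac (frob_poly r x) = (\<Prod>i<r. [:- (x ^ (CARD('a) ^ i)), 1:])"
proof -
  let ?q = "CARD('a)"
  let ?p = "\<Prod>i<r. [:- (x ^ (?q ^ i)), 1:]"
  have minus: "(- y) ^ ?q = - (y ^ ?q)" for y :: "'a alg_closure"
    using frobenius_power_minus[of y 1, where 'a='a] by simp
  have "map_poly (\<lambda>x. x ^ ?q) ?p = (\<Prod>i<r. [:- (x ^ (?q ^ Suc i)), 1:])"
    unfolding map_frob.hom_prod
    by (intro prod.cong) (simp_all add: frob.map_poly_pCons_hom minus mult.commute flip: power_mult)
  also have "\<dots> = (\<Prod>i\<in>{1..r}. [:- (x ^ (?q ^ i)), 1:])"
    by (rule prod.reindex_bij_witness[of _ "\<lambda>i. i - 1" Suc]) auto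
  also have "{1..r} = insert r {1..<r}" using assms(2) by auto
  also have "(\<Prod>i\<in>insert r {1..<r}. [:- (x ^ (?q ^ i)), 1:]) = (\<Prod>i\<in>insert 0 {1..<r}. [:- (x ^ (?q ^ i)), 1:])"
    using frob_fixed_shift[OF assms(1), of 0] by (simp add: prod.insert)
  also have "insert 0 {1..<r} = {..<r}" using assms(2) by auto
  finally have p: "map_poly (\<lambda>x. x ^ ?q) ?p = ?p" .
  have "coeff ?p i \<in> range to_ac" for i
  proof -
    have "coeff ?p i ^ ?q = coeff ?p i"
      using arg_cong[OF p, of "\<lambda>p. coeff p i"] by (simp only: frob.coeff_map_poly_hom)
    then have "coeff ?p i \<in> frob_fixed TYPE('a) 1" by (simp add: frob_fixed_def)
    then show ?thesis unfolding frob_fixed_1 .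
  qed
  then show ?thesis
    unfolding frob_poly_def by (intro poly_eqI) (simp add: coeff_map_poly to_ac_of_ac)
qed

lemma degree_frob_poly:
  fixes x :: "'a::{field,finite} alg_closure"
  assumes "x \<in> frob_fixed TYPE('a) r" "r > 0"
  shows "degree (frob_poly r x) = r" "lead_coeff (frob_poly r x) = 1"
proof -
  have "degree (\<Prod>i<r. [:- (x ^ (CARD('a) ^ i)), 1:]) = r"
    by (subst degree_prod_eq_sum_degree) auto
  then show d: "degree (frob_poly r x) = r"
    by (simp flip: map_frob_poly[OF assms])
  have "lead_coeff (map_poly to_ac (frob_poly r x)) = 1"
    unfolding map_frob_poly[OF assms] by (simp add: lead_coeff_prod)
  then have "to_ac (lead_coeff (frob_poly r x)) = to_ac 1" by simp
  then show "lead_coeff (frob_poly r x) = 1" by (simp only: to_ac_eq_iff)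
qed

lemma nat_geometric_sum: "q > 1 \<Longrightarrow> (\<Sum>i<r. q ^ i) = (q ^ r - 1) div (q - (1::nat))"
proof -
  assume q: "q > 1"
  have "(q - 1) * (\<Sum>i<r. q ^ i) + 1 = q ^ r"
  proof (induction r)
    case (Suc r)
    have "(q - 1) * (\<Sum>i<Suc r. q ^ i) + 1 = (q - 1) * q ^ r + ((q - 1) * (\<Sum>i<r. q ^ i) + 1)"
      by (simp add: algebra_simps)
    also have "\<dots> = q ^ Suc r" unfolding Suc using q by (simp add: algebra_simps diff_mult_distrib)
    finally show ?case .
  qed simp
  then have "q ^ r - 1 = (q - 1) * (\<Sum>i<r. q ^ i)" by simp
  then show ?thesis using q by simp
qed

text \<open>The conjugates of b - x multiply to its norm, whose exponent is 1 + q + ... + q^(r-1).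
  This links values of polynomials to character sums over extensions.\<close>

lemma poly_frob_poly:
  fixes x :: "'a::{field,finite} alg_closure"
  assumes "x \<in> frob_fixed TYPE('a) r" "r > 0"
  shows "to_ac (poly (frob_poly r x) b) = (to_ac b - x) ^ ((CARD('a) ^ r - 1) div (CARD('a) - 1))"
proof -
  have "to_ac (poly (frob_poly r x) b) = poly (map_poly to_ac (frob_poly r x)) (to_ac b)" by simp
  also have "\<dots> = (\<Prod>i<r. to_ac b - x ^ (CARD('a) ^ i))"
    unfolding map_frob_poly[OF assms] by (simp add: poly_prod)
  also have "\<dots> = (\<Prod>i<r. (to_ac b - x) ^ (CARD('a) ^ i))"
  proof (rule prod.cong[OF refl])
    fix i
    have "to_ac b ^ (CARD('a) ^ i) = to_ac b"
      unfolding to_ac_power[symmetric] finite_field_power_card_power ..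
    then show "to_ac b - x ^ (CARD('a) ^ i) = (to_ac b - x) ^ (CARD('a) ^ i)"
      by (simp add: frobenius_power_diff)
  qed
  also have "\<dots> = (to_ac b - x) ^ (\<Sum>i<r. CARD('a) ^ i)" by (simp add: power_sum)
  finally show ?thesis
    using nat_geometric_sum[of "CARD('a)" r] card_finite_field_ge_2[where 'a='a] by simp
qed

lemma poly_frob_poly_self:
  fixes x :: "'a::{field,finite} alg_closure"
  assumes "x \<in> frob_fixed TYPE('a) r" "r > 0"
  shows "poly (map_poly to_ac (frob_poly r x)) x = 0"
  unfolding map_frob_poly[OF assms] poly_prod using assms(2) by (intro prod_zero) (auto intro: bexI[of _ 0])

lemma prod_linear_factors_dvd:
  fixes p :: "'a::idom poly"
  assumes "finite S" "\<And>y. y \<in> S \<Longrightarrow> poly p y = 0"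
  shows "(\<Prod>y\<in>S. [:-y, 1:]) dvd p"
  using assms
proof (induction S arbitrary: p rule: finite_induct)
  case (insert y S)
  then obtain r where r: "p = [:-y, 1:] * r" by (metis insertI1 poly_eq_0_iff_dvd dvdE)
  have "poly r z = 0" if "z \<in> S" for z
    using insert.prems[of z] insert.hyps(2) that by (auto simp: r)
  then have "(\<Prod>y\<in>S. [:-y, 1:]) dvd r" by (rule insert.IH)
  then show ?case unfolding r prod.insert[OF insert.hyps] by (rule mult_dvd_mono[OF dvd_refl])
qed simp

section \<open>Multiplicities of roots counted by characteristic polynomials\<close>

definition frob_divisors :: "'a::{field,finite} poly \<Rightarrow> 'a alg_closure \<Rightarrow> nat set" where
  "frob_divisors f x = {r. r > 0 \<and> x \<in> frob_fixed TYPE('a) r \<and> frob_poly r x dvd f}"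

text \<open>Frobenius permutes the finitely many roots of \<open>f\<close>, so the orbit of
  \<open>x\<close> repeats, and by injectivity it returns to \<open>x\<close> itself.\<close>

lemma root_imp_frob_fixed:
  fixes x :: "'a::{field,finite} alg_closure"
  assumes f: "f \<noteq> 0" "poly (map_poly to_ac f) x = 0"
  shows "\<exists>r>0. x \<in> frob_fixed TYPE('a) r"
proof -
  let ?R = "{y. poly (map_poly to_ac f) y = 0}"
  let ?g = "\<lambda>i. x ^ (CARD('a) ^ i)"
  have "finite ?R" using f(1) by (intro poly_roots_finite) simp
  moreover have sub: "range ?g \<subseteq> ?R"
    using f(2) by (auto simp: power_0_left simp flip: poly_map_to_ac_power)
  ultimately have "finite (range ?g)" using finite_subset by blast
  then have "\<not> inj ?g" using finite_imageD by blast
  then obtain i j where ij: "i < j" "?g i = ?g j"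
    unfolding inj_on_def by (metis linorder_neqE_nat)
  have "(x ^ (CARD('a) ^ (j - i))) ^ (CARD('a) ^ i) = ?g j"
    using ij(1) by (simp flip: power_mult power_add)
  then have "x ^ (CARD('a) ^ (j - i)) = x"
    using frobenius_power_inj[of _ i x] ij(2) by metis
  then show ?thesis using ij(1) by (auto simp: frob_fixed_def intro!: exI[of _ "j - i"])
qed

text \<open>The characteristic polynomials of \<open>x\<close> are the powers of its minimal
  polynomial, so the number of those dividing \<open>f\<close> is the multiplicity of
  \<open>x\<close>. The induction strips one minimal polynomial off \<open>f\<close>, which shifts
  the remaining degrees by its degree.\<close>

lemma card_frob_divisors:
  fixes f :: "'a::{field,finite} poly"
  assumes "f \<noteq> 0"
  shows "finite (frob_divisors f x) \<and> card (frob_divisors f x) = order x (map_poly to_ac f)"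
  using assms
proof (induction "degree f" arbitrary: f rule: less_induct)
  case less
  let ?fix = "frob_fixed TYPE('a)"
  let ?y = "\<lambda>i. x ^ (CARD('a) ^ i)"
  show ?case
  proof (cases "poly (map_poly to_ac f) x = 0")
    case False
    have "frob_divisors f x = {}"
    proof (rule equals0I)
      fix r assume "r \<in> frob_divisors f x"
      then have r: "r > 0" "x \<in> ?fix r" "frob_poly r x dvd f" by (auto simp: frob_divisors_def)
      have "map_poly to_ac (frob_poly r x) dvd map_poly to_ac f"
        by (rule map_to_ac.hom_dvd) (rule r(3))
      then show False using False poly_frob_poly_self[OF r(2,1)] by (auto elim!: dvdE)
    qed
    then show ?thesis using False by (simp add: order_0I)
  next
    case True
    \<comment> \<open>The degree of \<open>x\<close> over the base field; minimality makes the first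
      \<open>\<delta>\<close> conjugates distinct, so \<open>frob_poly \<delta> x\<close> has
      \<open>x\<close> as a simple root.\<close>
    define \<delta> where "\<delta> = (LEAST r. r > 0 \<and> x \<in> ?fix r)"
    have \<delta>: "\<delta> > 0" "x \<in> ?fix \<delta>"
      using LeastI_ex[OF root_imp_frob_fixed[OF less.prems True]] unfolding \<delta>_def by auto
    have \<delta>_min: "\<delta> \<le> r" if "r > 0" "x \<in> ?fix r" for r
      unfolding \<delta>_def using that by (intro Least_le) simp
    have inj: "inj_on ?y {..<\<delta>}"
    proof -
      have False if ij: "i < j" "j < \<delta>" "?y i = ?y j" for i j
      proof -
        have "(x ^ (CARD('a) ^ (j - i))) ^ (CARD('a) ^ i) = ?y j"
          using ij(1) by (simp flip: power_mult power_add)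
        then have "x ^ (CARD('a) ^ (j - i)) = x"
          using frobenius_power_inj[of _ i x] ij(3) by metis
        then have "x \<in> ?fix (j - i)" by (simp add: frob_fixed_def)
        then show False using \<delta>_min[of "j - i"] ij by simp
      qed
      then show ?thesis unfolding inj_on_def by (metis lessThan_iff linorder_neqE_nat)
    qed
    define M where "M = frob_poly \<delta> x"
    have mapM: "map_poly to_ac M = (\<Prod>i<\<delta>. [:- ?y i, 1:])"
      unfolding M_def by (rule map_frob_poly[OF \<delta>(2,1)])
    have degM: "degree M = \<delta>" unfolding M_def by (rule degree_frob_poly[OF \<delta>(2,1)])
    have M0: "M \<noteq> 0" using degM \<delta>(1) by auto
    have "(\<Prod>y\<in>?y ` {..<\<delta>}. [:- y, 1:]) dvd map_poly to_ac f"
      by (rule prod_linear_factors_dvd)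
         (use True in \<open>auto simp: power_0_left simp flip: poly_map_to_ac_power\<close>)
    also have "(\<Prod>y\<in>?y ` {..<\<delta>}. [:- y, 1:]) = map_poly to_ac M"
      unfolding mapM by (rule prod.reindex[OF inj, unfolded o_def])
    finally have "M dvd f" by (rule to_ac.dvd_map_poly_hom_imp_dvd)
    then obtain f' where f': "f = M * f'" by blast
    have f'0: "f' \<noteq> 0" using less.prems f' by auto
    have "degree f = \<delta> + degree f'" unfolding f' using M0 f'0 degM by (simp add: degree_mult_eq)
    then have IH: "finite (frob_divisors f' x)" "card (frob_divisors f' x) = order x (map_poly to_ac f')"
      using less.hyps[OF _ f'0] \<delta>(1) by auto
    have prod_split: "(\<Prod>i<\<delta> + r. F i) = (\<Prod>i<\<delta>. F i) * (\<Prod>i<r. F (\<delta> + i))"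
      for r and F :: "nat \<Rightarrow> 'a alg_closure poly"
      by (induction r) (simp_all add: mult.assoc)
    have split: "frob_poly (\<delta> + r) x = M * frob_poly r x" if r: "r > 0" "x \<in> ?fix r" for r
    proof -
      have fixr: "x \<in> ?fix (\<delta> + r)"
        using frob_fixed_shift[OF \<delta>(2), of r] r(2) unfolding frob_fixed_def by simp
      have "map_poly to_ac (frob_poly (\<delta> + r) x) = (\<Prod>i<\<delta> + r. [:- ?y i, 1:])"
        using map_frob_poly[OF fixr] r by simp
      also have "\<dots> = (\<Prod>i<\<delta>. [:- ?y i, 1:]) * (\<Prod>i<r. [:- ?y (\<delta> + i), 1:])"
        by (rule prod_split)
      also have "\<dots> = map_poly to_ac (M * frob_poly r x)"
        unfolding map_to_ac.hom_mult mapM map_frob_poly[OF r(2,1)] frob_fixed_shift[OF \<delta>(2)] ..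
      finally show ?thesis by (simp only: map_to_ac.eq_iff)
    qed
    have "frob_divisors f x = insert \<delta> ((+) \<delta> ` frob_divisors f' x)"
    proof (intro subset_antisym subsetI)
      fix r assume "r \<in> frob_divisors f x"
      then have r: "r > 0" "x \<in> ?fix r" "frob_poly r x dvd f" by (auto simp: frob_divisors_def)
      have "\<delta> \<le> r" by (rule \<delta>_min[OF r(1,2)])
      show "r \<in> insert \<delta> ((+) \<delta> ` frob_divisors f' x)"
      proof (cases "r = \<delta>")
        case False
        define t where "t = r - \<delta>"
        have t: "r = \<delta> + t" "t > 0" using False \<open>\<delta> \<le> r\<close> unfolding t_def by auto
        have xt: "x \<in> ?fix t"
          using frob_fixed_shift[OF \<delta>(2), of t] r(2) unfolding t(1) frob_fixed_def by simp
        have "M * frob_poly t x dvd M * f'"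
          using r(3) unfolding t(1) split[OF t(2) xt] f' .
        then have "frob_poly t x dvd f'" using M0 by simp
        then have "t \<in> frob_divisors f' x" using t(2) xt by (simp add: frob_divisors_def)
        then show ?thesis unfolding t(1) by blast
      qed simp
    next
      fix r assume "r \<in> insert \<delta> ((+) \<delta> ` frob_divisors f' x)"
      then consider "r = \<delta>" | t where "r = \<delta> + t" "t \<in> frob_divisors f' x" by auto
      then show "r \<in> frob_divisors f x"
      proof cases
        case 1
        then show ?thesis using \<delta> unfolding frob_divisors_def f' M_def by simp
      next
        case 2
        then have t: "t > 0" "x \<in> ?fix t" "frob_poly t x dvd f'" by (auto simp: frob_divisors_def)
        have "x \<in> ?fix r"
          using frob_fixed_shift[OF \<delta>(2), of t] t(2) unfolding 2(1) frob_fixed_def by simp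
        moreover have "frob_poly r x dvd f"
          unfolding 2(1) split[OF t(1,2)] f' using t(3) by (rule mult_dvd_mono[OF dvd_refl])
        ultimately show ?thesis using t(1) 2(1) by (simp add: frob_divisors_def)
      qed
    qed
    moreover have "\<delta> \<notin> (+) \<delta> ` frob_divisors f' x" by (auto simp: frob_divisors_def)
    moreover have "card ((+) \<delta> ` frob_divisors f' x) = card (frob_divisors f' x)"
      by (rule card_image) simp
    ultimately have D: "finite (frob_divisors f x)" "card (frob_divisors f x) = Suc (card (frob_divisors f' x))"
      using IH(1) by simp_all
    have "order x (map_poly to_ac M) = 1"
    proof -
      have "{..<\<delta>} = insert 0 {0<..<\<delta>}" using \<delta>(1) by auto
      then have eq: "map_poly to_ac M = [:- x, 1:] * (\<Prod>i\<in>{0<..<\<delta>}. [:- ?y i, 1:])"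
        unfolding mapM by (simp del: mult_pCons_left)
      have "x \<noteq> ?y i" if "i \<in> {0<..<\<delta>}" for i
        using inj_onD[OF inj, of 0 i] that \<delta>(1) by auto
      then have "poly (\<Prod>i\<in>{0<..<\<delta>}. [:- ?y i, 1:]) x \<noteq> 0"
        unfolding poly_prod by (subst prod_zero_iff) auto
      then have 0: "order x (\<Prod>i\<in>{0<..<\<delta>}. [:- ?y i, 1:]) = 0" by (rule order_0I)
      have 1: "order x [:- x, 1:] = 1" using order_power_n_n[of x 1] by simp
      have nz: "[:- x, 1:] * (\<Prod>i\<in>{0<..<\<delta>}. [:- ?y i, 1:]) \<noteq> 0"
        using M0 unfolding eq[symmetric] by simp
      show ?thesis unfolding eq order_mult[OF nz] 0 1 by simp
    qed
    then have "order x (map_poly to_ac f) = Suc (order x (map_poly to_ac f'))"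
      unfolding f' map_to_ac.hom_mult using M0 f'0 by (subst order_mult) simp_all
    then show ?thesis using D IH(2) by simp
  qed
qed

lemma sum_order_alg_closed:
  fixes p :: "'a::alg_closed_field poly"
  assumes "p \<noteq> 0"
  shows "(\<Sum>x | poly p x = 0. order x p) = degree p"
proof -
  obtain A where A: "size A = degree p" "p = smult (lead_coeff p) (\<Prod>x\<in>#A. [:-x, 1:])"
    using alg_closed_imp_factorization[OF assms] by blast
  have nz: "(\<Prod>x\<in>#A. [:-x, 1:]) \<noteq> 0" for A :: "'a multiset"
    by (auto simp: prod_mset_zero_iff)
  have ord: "order y (\<Prod>x\<in>#A. [:-x, 1:]) = count A y" for y and A :: "'a multiset"
  proof (induction A)
    case empty
    then show ?case by (simp add: order_0I)
  next
    case (add x A)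
    have "order y [:-x, 1:] = (if x = y then 1 else 0)"
      using order_power_n_n[of x 1] by (auto intro: order_0I)
    then show ?case
      using nz[of A] add by (simp add: order_mult del: mult_pCons_left)
  qed
  have ordp: "order x p = count A x" for x
    using assms by (subst A(2)) (simp add: order_smult ord)
  have "poly p x = 0 \<longleftrightarrow> x \<in># A" for x
    unfolding order_root count_greater_zero_iff[symmetric] using assms by (simp add: ordp)
  then show ?thesis using A(1) by (simp add: size_multiset_overloaded_eq ordp)
qed

section \<open>The L-function of a product of linear forms\<close>

definition monics :: "nat \<Rightarrow> 'a::{field,finite} poly set" where
  "monics n = {f. degree f = n \<and> lead_coeff f = 1}"

lemma finite_monics [simp]: "finite (monics n :: 'a::{field,finite} poly set)"
  by (rule finite_subset[OF _ finite_polys_degree_less(1)[of "Suc n"]]) (auto simp: monics_def)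

lemma monics_0: "monics 0 = {1}"
  by (auto simp: monics_def one_pCons elim!: degree_eq_zeroE)

lemma monics_mult_iff:
  assumes "c \<in> monics r" "r \<le> n"
  shows "c * g \<in> monics n \<longleftrightarrow> g \<in> monics (n - r)"
proof (cases "g = 0")
  case True
  then show ?thesis by (simp add: monics_def)
next
  case False
  have c: "c \<noteq> 0" "degree c = r" "lead_coeff c = 1" using assms(1) by (auto simp: monics_def)
  have "lead_coeff (c * g) = lead_coeff g" unfolding lead_coeff_mult c(3) by simp
  moreover have "degree (c * g) = r + degree g" using c False by (simp add: degree_mult_eq)
  ultimately show ?thesis using assms(2) unfolding monics_def by auto
qed

text \<open>The multiplicities of the roots sum to the degree. This yields the factor n in the
  recurrence for the coefficients of the L-function.\<close>

lemma card_frob_divisor_pairs: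
  fixes f :: "'a::{field,finite} poly"
  assumes "f \<in> monics n"
  shows "card (SIGMA r:{1..n}. {x \<in> frob_fixed TYPE('a) r. frob_poly r x dvd f}) = n" (is "card ?E = n")
proof -
  let ?R = "{x. poly (map_poly to_ac f) x = 0}"
  have f0: "f \<noteq> 0" and deg: "degree f = n" using assms by (auto simp: monics_def)
  have finR: "finite ?R" using f0 by (intro poly_roots_finite) simp
  have root: "poly (map_poly to_ac f) x = 0" if "r \<in> frob_divisors f x" for r x
  proof -
    have "map_poly to_ac (frob_poly r x) dvd map_poly to_ac f"
      using that by (intro map_to_ac.hom_dvd) (simp add: frob_divisors_def)
    then show ?thesis
      using that poly_frob_poly_self[of x r]
      by (auto simp: frob_divisors_def map_to_ac.hom_mult elim!: dvdE)
  qed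
  have le: "r \<le> n" if "r \<in> frob_divisors f x" for r x
    using that dvd_imp_degree_le[of "frob_poly r x" f] degree_frob_poly(1)[of x r] f0 deg
    by (auto simp: frob_divisors_def)
  have "?E = prod.swap ` (SIGMA x:?R. frob_divisors f x)"
  proof (intro subset_antisym subsetI)
    fix t assume "t \<in> ?E"
    then obtain r x where t: "t = (r, x)" "r \<in> frob_divisors f x" by (auto simp: frob_divisors_def)
    then have "(x, r) \<in> (SIGMA x:?R. frob_divisors f x)" using root by auto
    then show "t \<in> prod.swap ` (SIGMA x:?R. frob_divisors f x)" unfolding t(1) by (metis image_eqI swap_simp)
  next
    fix t assume "t \<in> prod.swap ` (SIGMA x:?R. frob_divisors f x)"
    then obtain r x where t: "t = (r, x)" "r \<in> frob_divisors f x" by auto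
    then show "t \<in> ?E" using le[OF t(2)] unfolding t(1) by (auto simp: frob_divisors_def)
  qed
  then have "card ?E = card (SIGMA x:?R. frob_divisors f x)"
    by (simp add: card_image inj_on_def)
  also have "\<dots> = (\<Sum>x\<in>?R. order x (map_poly to_ac f))"
    using finR card_frob_divisors[OF f0] by (subst card_SigmaI) auto
  also have "\<dots> = n" using f0 deg by (subst sum_order_alg_closed) simp_all
  finally show ?thesis .
qed

text \<open>The i-th character is \<open>field_char\<close> to the power \<open>e i\<close>. A
  trivial character has a positive multiple of q - 1 as exponent, so that it still vanishes at 0;
  not all of them may be trivial.\<close>

locale linear_char_sum =
  fixes I :: "'i set" and a :: "'i \<Rightarrow> 'a::{field,finite}" and e :: "'i \<Rightarrow> nat"
  assumes finI: "finite I" and inj: "inj_on a I" and e_pos: "\<And>i. i \<in> I \<Longrightarrow> e i > 0"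
    and nontrivial: "\<exists>i\<in>I. \<not> CARD('a) - 1 dvd e i"
begin

definition poly_char :: "'a poly \<Rightarrow> complex" where
  "poly_char f = field_char (\<Prod>i\<in>I. poly f (a i) ^ e i)"

lemma poly_char_mult: "poly_char (f * g) = poly_char f * poly_char g"
  by (simp add: poly_char_def power_mult_distrib prod.distrib field_char_mult)

lemma poly_char_1: "poly_char 1 = 1"
  by (simp add: poly_char_def)

definition L_coeff :: "nat \<Rightarrow> complex" where
  "L_coeff n = (\<Sum>f\<in>monics n. poly_char f)"

text \<open>
  By interpolation, the value of a monic polynomial of degree at least \<open>card I\<close> at one of the points can be
  multiplied by any nonzero constant without changing its other values.\<close>
lemma L_coeff_eq_0:
  assumes n: "card I \<le> n"
  shows "L_coeff n = 0"
proof -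
  obtain i0 where i0: "i0 \<in> I" "\<not> CARD('a) - 1 dvd e i0" using nontrivial by blast
  define b :: 'a where "b = field_gen"
  have b0: "b \<noteq> 0" by (simp add: b_def)
  define \<Lambda> where "\<Lambda> = (\<Prod>j\<in>I - {i0}. smult (1 / (a i0 - a j)) [:- a j, 1:])"
  have \<Lambda>_i0: "poly \<Lambda> (a i0) = 1"
    unfolding \<Lambda>_def poly_prod
  proof (intro prod.neutral ballI)
    fix j assume "j \<in> I - {i0}"
    then have "a i0 - a j \<noteq> 0" using inj i0(1) by (auto simp: inj_on_def)
    then show "poly (smult (1 / (a i0 - a j)) [:- a j, 1:]) (a i0) = 1"
      by (simp flip: diff_divide_distrib)
  qed
  have \<Lambda>_j: "poly \<Lambda> (a j) = 0" if "j \<in> I" "j \<noteq> i0" for j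
    unfolding \<Lambda>_def poly_prod using that finI by (intro prod_zero) (auto intro!: bexI[of _ j])
  have "degree \<Lambda> \<le> (\<Sum>j\<in>I - {i0}. degree (smult (1 / (a i0 - a j)) [:- a j, 1:]))"
    unfolding \<Lambda>_def by (rule order_trans[OF degree_prod_sum_le]) (use finI in \<open>simp_all only: o_def finite_Diff order_refl\<close>)
  also have "\<dots> \<le> (\<Sum>j\<in>I - {i0}. 1)"
    by (intro sum_mono order_trans[OF degree_smult_le]) simp
  also have "\<dots> = card I - 1" using i0(1) finI by simp
  also have "\<dots> < n" using n i0(1) finI card_gt_0_iff[of I] by force
  finally have deg\<Lambda>: "degree \<Lambda> < n" .
  define T where "T = (\<lambda>c (f :: 'a poly). f + smult ((c - 1) * poly f (a i0)) \<Lambda>)"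
  have T_val: "poly (T c f) (a i) = (if i = i0 then c else 1) * poly f (a i)" if "i \<in> I" for c f i
    using that \<Lambda>_i0 \<Lambda>_j[of i] by (auto simp: T_def algebra_simps)
  have T_inv: "T c' (T c f) = f" if "c' * c = 1" for c c' f
  proof -
    have T_eq: "T c f = f + smult ((c - 1) * poly f (a i0)) \<Lambda>" for c f by (simp add: T_def)
    have val: "poly (T c f) (a i0) = c * poly f (a i0)" using T_val[OF i0(1)] by simp
    have "T c' (T c f) = f + smult ((c - 1) * poly f (a i0) + (c' - 1) * (c * poly f (a i0))) \<Lambda>"
      unfolding T_eq[of c'] val unfolding T_eq smult_add_left add.assoc ..
    also have "(c - 1) * poly f (a i0) + (c' - 1) * (c * poly f (a i0)) = (c' * c - 1) * poly f (a i0)"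
      by (simp add: algebra_simps)
    finally show ?thesis using that by simp
  qed
  have T_monic: "T c f \<in> monics n" if "f \<in> monics n" for c f
  proof -
    have small: "degree (smult ((c - 1) * poly f (a i0)) \<Lambda>) < degree f"
      using that deg\<Lambda> by (auto simp: monics_def intro: le_less_trans[OF degree_smult_le])
    then have deg: "degree (T c f) = degree f" unfolding T_def by (rule degree_add_eq_left)
    moreover have "lead_coeff (T c f) = lead_coeff f"
      unfolding deg unfolding T_def coeff_add coeff_eq_0[OF small] by simp
    ultimately show ?thesis using that by (auto simp: monics_def)
  qed
  have T_char: "poly_char (T b f) = field_char (b ^ e i0) * poly_char f" for f
  proof -
    have "(\<Prod>i\<in>I. poly (T b f) (a i) ^ e i) =
        (\<Prod>i\<in>I. (if i = i0 then b ^ e i0 else 1) * poly f (a i) ^ e i)"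
      by (intro prod.cong refl) (auto simp: T_val power_mult_distrib)
    also have "\<dots> = b ^ e i0 * (\<Prod>i\<in>I. poly f (a i) ^ e i)"
      using i0(1) finI by (simp add: prod.distrib)
    finally show ?thesis by (simp add: poly_char_def field_char_mult)
  qed
  have "L_coeff n = (\<Sum>f\<in>monics n. poly_char (T b f))"
    unfolding L_coeff_def
    by (rule sum.reindex_bij_witness[of _ "T b" "T (inverse b)"])
       (use T_inv T_monic b0 in auto)
  also have "\<dots> = field_char (b ^ e i0) * L_coeff n"
    by (simp add: T_char L_coeff_def sum_distrib_left)
  finally have "(1 - field_char (b ^ e i0)) * L_coeff n = 0" by (simp add: algebra_simps)
  moreover have "field_char (b ^ e i0) \<noteq> 1"
    unfolding b_def field_char_gen_power_eq_1_iff by (rule i0(2))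
  ultimately show ?thesis by simp
qed

lemma L_coeff_0: "L_coeff 0 = 1"
  by (simp add: L_coeff_def monics_0 poly_char_1)

definition ext_sum :: "nat \<Rightarrow> complex" where
  "ext_sum r = (\<Sum>x\<in>frob_fixed TYPE('a) r. poly_char (frob_poly r x))"

text \<open>Newton's identity by double counting of triples (f, r, x) with
  \<open>frob_poly r x\<close> dividing \<open>f\<close>. Each \<open>f\<close> occurs n times; for
  a fixed pair (r, x) the cofactor of \<open>f\<close> runs through the monic polynomials of degree
  n - r, and multiplicativity splits the sum.\<close>

lemma L_coeff_recurrence:
  "of_nat n * L_coeff n = (\<Sum>r\<in>{1..n}. ext_sum r * L_coeff (n - r))"
proof -
  let ?fix = "frob_fixed TYPE('a)"
  have "of_nat n * L_coeff n = (\<Sum>f\<in>monics n. of_nat n * poly_char f)"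
    by (simp add: L_coeff_def sum_distrib_left)
  also have "\<dots> = (\<Sum>f\<in>monics n. \<Sum>(r, x)\<in>(SIGMA r:{1..n}. {x \<in> ?fix r. frob_poly r x dvd f}). poly_char f)"
    by (intro sum.cong refl) (simp add: card_frob_divisor_pairs del: One_nat_def)
  also have "\<dots> = (\<Sum>f\<in>monics n. \<Sum>r\<in>{1..n}. \<Sum>x\<in>?fix r. if frob_poly r x dvd f then poly_char f else 0)"
  proof (rule sum.cong[OF refl])
    fix f :: "'a poly"
    have fin: "finite (?fix r)" if "r \<in> {1..n}" for r using that by (simp add: finite_card_frob_fixed)
    have "(\<Sum>(r, x)\<in>(SIGMA r:{1..n}. {x \<in> ?fix r. frob_poly r x dvd f}). poly_char f) =
        (\<Sum>r\<in>{1..n}. \<Sum>x\<in>{x \<in> ?fix r. frob_poly r x dvd f}. poly_char f)"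
      by (rule sum.Sigma[symmetric]) (use fin in auto)
    also have "\<dots> = (\<Sum>r\<in>{1..n}. \<Sum>x\<in>?fix r. if frob_poly r x dvd f then poly_char f else 0)"
      by (intro sum.cong refl sum.inter_filter fin)
    finally show "(\<Sum>(r, x)\<in>(SIGMA r:{1..n}. {x \<in> ?fix r. frob_poly r x dvd f}). poly_char f) = \<dots>" .
  qed
  also have "\<dots> = (\<Sum>r\<in>{1..n}. \<Sum>x\<in>?fix r. \<Sum>f\<in>monics n. if frob_poly r x dvd f then poly_char f else 0)"
    by (subst sum.swap, intro sum.cong refl, rule sum.swap)
  also have "\<dots> = (\<Sum>r\<in>{1..n}. \<Sum>x\<in>?fix r. poly_char (frob_poly r x) * L_coeff (n - r))"
  proof (intro sum.cong refl)
    fix r x assume r: "r \<in> {1..n}" and x: "x \<in> ?fix r"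
    define c where "c = frob_poly r x"
    have cm: "c \<in> monics r"
      using degree_frob_poly[OF x] r unfolding c_def monics_def by simp
    then have c0: "c \<noteq> 0" by (auto simp: monics_def)
    have iff: "c * g \<in> monics n \<longleftrightarrow> g \<in> monics (n - r)" for g
      using monics_mult_iff[OF cm] r by simp
    have "(\<Sum>f\<in>monics n. if c dvd f then poly_char f else 0) = (\<Sum>f | f \<in> monics n \<and> c dvd f. poly_char f)"
      by (simp add: sum.inter_filter)
    also have "{f. f \<in> monics n \<and> c dvd f} = (*) c ` monics (n - r)"
      using iff by (auto elim!: dvdE)
    also have "(\<Sum>f\<in>(*) c ` monics (n - r). poly_char f) = (\<Sum>g\<in>monics (n - r). poly_char (c * g))"
      using c0 by (subst sum.reindex) (auto simp: inj_on_def)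
    also have "\<dots> = poly_char c * L_coeff (n - r)"
      by (simp add: poly_char_mult L_coeff_def sum_distrib_left)
    finally show "(\<Sum>f\<in>monics n. if frob_poly r x dvd f then poly_char f else 0) =
        poly_char (frob_poly r x) * L_coeff (n - r)" unfolding c_def .
  qed
  finally show ?thesis by (simp add: ext_sum_def sum_distrib_right)
qed

lemma ext_sum_eq:
  assumes "r > 0"
  shows "ext_sum r = ext_char_sum (\<Prod>i\<in>I. [:a i, - 1:] ^ e i) r"
  unfolding ext_sum_def ext_char_sum_def
proof (rule sum.cong[OF refl])
  fix x assume x: "x \<in> frob_fixed TYPE('a) r"
  let ?m = "(CARD('a) ^ r - 1) div (CARD('a) - 1)"
  have "to_ac (\<Prod>i\<in>I. poly (frob_poly r x) (a i) ^ e i) = (\<Prod>i\<in>I. (to_ac (a i) - x) ^ e i) ^ ?m"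
    by (simp only: to_ac_prod to_ac_power poly_frob_poly[OF x assms] prod_power_distrib
         power_mult[symmetric] mult.commute)
  also have "(\<Prod>i\<in>I. (to_ac (a i) - x) ^ e i) = poly (map_poly to_ac (\<Prod>i\<in>I. [:a i, - 1:] ^ e i)) x"
    by (simp add: map_to_ac.hom_prod map_to_ac.hom_power poly_prod to_ac.map_poly_pCons_hom)
  finally have "of_ac (poly (map_poly to_ac (\<Prod>i\<in>I. [:a i, - 1:] ^ e i)) x ^ ?m) =
      (\<Prod>i\<in>I. poly (frob_poly r x) (a i) ^ e i)" by (rule of_ac_eqI)
  then show "poly_char (frob_poly r x) =
      field_char (of_ac (poly (map_poly to_ac (\<Prod>i\<in>I. [:a i, - 1:] ^ e i)) x ^ ?m))"
    by (simp only: poly_char_def)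
qed

lemma ext_sum_1: "ext_sum 1 = (\<Sum>x\<in>UNIV. field_char (\<Prod>i\<in>I. (a i - x) ^ e i))"
proof -
  have N: "CARD('a) - 1 > 0" using card_finite_field_ge_2[where 'a='a] by simp
  have "ext_sum 1 = (\<Sum>x\<in>range to_ac. field_char (of_ac (poly (map_poly to_ac (\<Prod>i\<in>I. [:a i, - 1:] ^ e i)) x)))"
    using N by (simp add: ext_sum_eq ext_char_sum_def flip: frob_fixed_1)
  also have "\<dots> = (\<Sum>x\<in>UNIV. field_char (poly (\<Prod>i\<in>I. [:a i, - 1:] ^ e i) x))"
    by (subst sum.reindex) (simp_all add: inj_to_ac)
  finally show ?thesis by (simp add: poly_prod)
qed

lemma ext_sum_bound:
  assumes nz: "\<And>i. i \<in> I \<Longrightarrow> a i \<noteq> 0"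
  shows "\<exists>C. \<forall>s>0. norm (ext_sum (2 * s)) \<le> C * real (CARD('a) ^ s)"
proof -
  let ?N = "CARD('a) - 1"
  have N: "?N > 0" using card_finite_field_ge_2[where 'a='a] by simp
  \<comment> \<open>With this divisor pulled out, \<open>field_char\<close> to the power
    \<open>g\<close> has exact order \<open>d\<close>, and the reduced exponents e i / g together
    have no common factor with \<open>d\<close>.\<close>
  define g where "g = Gcd (insert ?N (e ` I))"
  have gN: "g dvd ?N" unfolding g_def by (rule Gcd_dvd) simp
  have ge: "g dvd e i" if "i \<in> I" for i unfolding g_def using that by (intro Gcd_dvd) simp
  define d where "d = ?N div g"
  have dg: "d * g = ?N" using gN by (simp add: d_def)
  have g0: "g > 0" using gN N by (auto intro!: Nat.gr0I)
  have d1: "d > 1"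
  proof -
    have "d \<noteq> 0" using dg N by (metis less_not_refl mult_0)
    moreover have "d \<noteq> 1" using dg ge nontrivial by auto
    ultimately show ?thesis by simp
  qed
  define h where "h = (\<Prod>i\<in>I. [:a i, - 1:] ^ (e i div g))"
  have hg: "(\<Prod>i\<in>I. [:a i, - 1:] ^ e i) = h ^ g"
    unfolding h_def prod_power_distrib
    by (intro prod.cong refl) (simp add: ge flip: power_mult)
  have h0: "poly h 0 \<noteq> 0" unfolding h_def poly_prod using nz finI by (simp add: prod_zero_iff)
  have order_lin: "order y [:b, - 1:] = (if y = b then 1 else 0)" for y b :: 'a
  proof (cases "y = b")
    case True
    have "order b [:b, - 1:] = order b (smult (- 1) [:- b, 1:])" by simp
    also have "\<dots> = order b [:- b, 1:]" by (rule order_smult) simp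
    finally show ?thesis using True order_power_n_n[of b 1] by simp
  qed (auto intro: order_0I)
  have order_h: "order (a j) h = e j div g" if "j \<in> I" for j
  proof -
    have "order y (\<Prod>i\<in>J. [:a i, - 1:] ^ (e i div g)) = (\<Sum>i\<in>J. e i div g * (if y = a i then 1 else 0))"
      if "finite J" for y J
      using that
    proof (induction J rule: finite_induct)
      case empty
      then show ?case by (simp add: order_0I)
    next
      case (insert i J)
      have "(\<Prod>i\<in>insert i J. [:a i, - 1:] ^ (e i div g)) \<noteq> 0" using insert.hyps by simp
      then show ?case
        unfolding prod.insert[OF insert.hyps] sum.insert[OF insert.hyps] using insert.IH
        by (subst order_mult) (simp_all add: order_power_eq order_lin)
    qed
    then have "order (a j) h = (\<Sum>i\<in>I. e i div g * (if a j = a i then 1 else 0))"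
      unfolding h_def using finI by blast
    also have "\<dots> = (\<Sum>i\<in>I. if i = j then e j div g else 0)"
      by (intro sum.cong refl) (use inj that in \<open>auto simp: inj_on_def\<close>)
    also have "\<dots> = e j div g" using that finI by simp
    finally show ?thesis .
  qed
  \<comment> \<open>The order of \<open>h\<close> at a i is e i / g. So d g = q - 1 divides n times
    every generator of the gcd \<open>g\<close>, hence n g.\<close>
  have ord: "d dvd n" if n: "\<forall>x. d dvd n * order x h" for n
  proof -
    have "?N dvd n * m" if "m \<in> insert ?N (e ` I)" for m
    proof (cases "m = ?N")
      case False
      then obtain i where i: "i \<in> I" "m = e i" using \<open>m \<in> _\<close> by auto
      have "d dvd n * (e i div g)" using n order_h[OF i(1)] by metis
      then have "d * g dvd n * (e i div g) * g" by simp
      also have "n * (e i div g) * g = n * m" using ge[OF i(1)] i(2) by (simp add: mult.assoc)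
      finally show ?thesis unfolding dg .
    qed simp
    then have "?N dvd Gcd ((*) n ` insert ?N (e ` I))" by (intro Gcd_greatest) auto
    then have "?N dvd n * g" unfolding Gcd_mult g_def[symmetric] dvd_normalize_iff .
    then have "d * g dvd n * g" unfolding dg .
    then show ?thesis using g0 by simp
  qed
  from ext_char_sum_bound[OF dg d1 h0 ord]
  obtain C where "\<forall>s>0. norm (ext_char_sum (h ^ g) (2 * s)) \<le> C * real (CARD('a) ^ s)" by blast
  then show ?thesis by (intro exI[of _ C]) (simp add: ext_sum_eq hg)
qed

end

section \<open>Power sums\<close>

lemma sum_mset_eq_sum_count:
  "(\<Sum>x\<in>#M. f x) = (\<Sum>x\<in>set_mset M. of_nat (count M x) * (f x :: 'b::comm_semiring_1))"
proof (induction M)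
  case (add x M)
  have "(\<Sum>y\<in>set_mset (add_mset x M). of_nat (count (add_mset x M) y) * f y) =
      (\<Sum>y\<in>insert x (set_mset M). (if y = x then f y else 0) + of_nat (count M y) * f y)"
    by (intro sum.cong) (auto simp: algebra_simps)
  also have "\<dots> = f x + (\<Sum>y\<in>insert x (set_mset M). of_nat (count M y) * f y)"
    by (simp add: sum.distrib)
  also have "(\<Sum>y\<in>insert x (set_mset M). of_nat (count M y) * f y) = (\<Sum>y\<in>set_mset M. of_nat (count M y) * f y)"
    by (rule sum.mono_neutral_right) (auto simp: not_in_iff)
  finally show ?case using add by simp
qed simp

text \<open>A polynomial that vanishes at all other elements combines consecutive power sums into a
  nonzero multiple of z0^s. This can stay below a constant times q^s only if \<open>z0\<close> has
  modulus at most \<open>q\<close>.\<close>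

lemma norm_le_of_power_sums:
  fixes B :: "complex multiset" and q :: real
  assumes q: "q > 0" and bound: "\<And>s. s > 0 \<Longrightarrow> norm (\<Sum>z\<in>#B. z ^ s) \<le> C * q ^ s" and z0: "z0 \<in># B"
  shows "norm z0 \<le> q"
proof (rule ccontr)
  assume "\<not> norm z0 \<le> q"
  then have ratio: "norm z0 / q > 1" using q by simp
  define p where "p = (\<Prod>z\<in>set_mset B - {z0}. [:- z, 1:])"
  have p0: "poly p z0 \<noteq> 0" unfolding p_def poly_prod by (simp add: prod_zero_iff)
  have pz: "poly p z = 0" if "z \<in># B" "z \<noteq> z0" for z
    unfolding p_def poly_prod using that by (intro prod_zero) (auto intro!: bexI[of _ z])
  define K where "K = (\<Sum>k\<le>degree p. norm (coeff p k) * C * q ^ k)"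
  define c where "c = norm (of_nat (count B z0) * poly p z0)"
  have c0: "c > 0" unfolding c_def using p0 z0 by simp
  have le_K: "c * (norm z0 / q) ^ s \<le> K" if s: "s > 0" for s
  proof -
    have "(\<Sum>z\<in>#B. poly p z * z ^ s) = (\<Sum>z\<in>set_mset B. of_nat (count B z) * (poly p z * z ^ s))"
      by (rule sum_mset_eq_sum_count)
    also have "\<dots> = (\<Sum>z\<in>{z0}. of_nat (count B z) * (poly p z * z ^ s))"
      by (rule sum.mono_neutral_right) (use z0 pz in auto)
    finally have "c * norm z0 ^ s = norm (\<Sum>z\<in>#B. poly p z * z ^ s)"
      by (simp add: c_def norm_mult norm_power)
    also have "(\<Sum>z\<in>#B. poly p z * z ^ s) = (\<Sum>z\<in>#B. \<Sum>k\<le>degree p. coeff p k * z ^ (s + k))"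
      by (simp add: poly_altdef sum_distrib_left sum_distrib_right power_add mult_ac)
    also have "\<dots> = (\<Sum>k\<le>degree p. \<Sum>z\<in>#B. coeff p k * z ^ (s + k))"
      by (induction B) (simp_all add: sum.distrib)
    also have "norm \<dots> \<le> (\<Sum>k\<le>degree p. norm (coeff p k) * (C * q ^ (s + k)))"
    proof (rule sum_norm_le)
      fix k
      have "norm (\<Sum>z\<in>#B. coeff p k * z ^ (s + k)) = norm (coeff p k) * norm (\<Sum>z\<in>#B. z ^ (s + k))"
        unfolding sum_mset_distrib_left[symmetric] norm_mult ..
      also have "\<dots> \<le> norm (coeff p k) * (C * q ^ (s + k))"
        using s by (intro mult_left_mono bound) simp_all
      finally show "norm (\<Sum>z\<in>#B. coeff p k * z ^ (s + k)) \<le> norm (coeff p k) * (C * q ^ (s + k))" .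
    qed
    also have "\<dots> = K * q ^ s"
      by (simp add: K_def sum_distrib_left sum_distrib_right power_add mult_ac)
    finally show ?thesis using q by (simp add: power_divide field_simps)
  qed
  obtain s where "K / c < (norm z0 / q) ^ s" using real_arch_pow[OF ratio] by blast
  also have "\<dots> \<le> (norm z0 / q) ^ Suc s" using ratio by (intro power_increasing) auto
  finally have "K < c * (norm z0 / q) ^ Suc s" using c0 by (simp add: field_simps)
  then show False using le_K[of "Suc s"] by simp
qed

lemma complex_poly_reciprocal_factorization:
  fixes p :: "complex poly"
  assumes "coeff p 0 = 1"
  obtains B where "size B = degree p" "p = (\<Prod>w\<in>#B. [:1, - w:])"
proof -
  have p0: "p \<noteq> 0" using assms by auto
  obtain A where A: "size A = degree p" "p = smult (lead_coeff p) (\<Prod>x\<in>#A. [:-x, 1:])"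
    using alg_closed_imp_factorization[OF p0] by blast
  have nz: "x \<noteq> 0" if "x \<in># A" for x
  proof
    assume "x = 0"
    have "[:-x, 1:] dvd p" by (subst A(2)) (use that in \<open>auto intro!: dvd_smult dvd_prod_mset\<close>)
    then have "poly p 0 = 0" using \<open>x = 0\<close> by (auto elim!: dvdE)
    then show False using assms by (simp add: poly_0_coeff_0)
  qed
  let ?B = "image_mset (\<lambda>x. 1 / x) A"
  have "(\<Prod>x\<in>#A. [:-x, 1:]) = smult (\<Prod>x\<in>#A. - x) (\<Prod>w\<in>#?B. [:1, - w:])"
    using nz
  proof (induction A)
    case (add x A)
    then have "[:-x, 1:] = smult (- x) [:1, - (1 / x):]" by simp
    then show ?case using add by (simp add: mult.commute[of x] del: mult_pCons_left smult_pCons)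
  qed simp
  then have "p = smult (lead_coeff p * (\<Prod>x\<in>#A. - x)) (\<Prod>w\<in>#?B. [:1, - w:])" using A(2) by simp
  then obtain c where c: "p = smult c (\<Prod>w\<in>#?B. [:1, - w:])" by blast
  have "poly (\<Prod>w\<in>#B. [:1, - w:]) 0 = 1" for B :: "complex multiset" by (induction B) auto
  then have "c = poly p 0" by (subst c) simp
  then have "c = 1" using assms by (simp add: poly_0_coeff_0)
  then show thesis using c A(1) by (intro that[of ?B]) simp_all
qed

text \<open>The logarithmic derivative with the division cleared. For one factor, -wX = -(1 - wX)(wX
  + w^2 X^2 + ...); the product rule adds the factors up.\<close>

lemma fps_log_deriv_prod:
  fixes B :: "complex multiset"
  defines "F \<equiv> fps_of_poly (\<Prod>w\<in>#B. [:1, - w:])"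
  shows "fps_X * fps_deriv F = - (F * (\<Sum>w\<in>#B. Abs_fps (\<lambda>r. if r = 0 then 0 else w ^ r)))"
  unfolding F_def
proof (induction B)
  case (add w B)
  let ?G = "fps_of_poly (\<Prod>w\<in>#B. [:1, - w:])"
  let ?l = "fps_of_poly [:1, - w:]"
  let ?V = "Abs_fps (\<lambda>r. if r = 0 then 0 else w ^ r)"
  have l: "?l = 1 - fps_const w * fps_X"
    by (simp add: fps_of_poly_pCons fps_const_neg[symmetric] mult.commute del: fps_const_neg)
  have "fps_X * fps_deriv ?l = - (?l * ?V)"
    unfolding l
  proof (rule fps_ext)
    fix n
    show "fps_nth (fps_X * fps_deriv (1 - fps_const w * fps_X)) n = fps_nth (- ((1 - fps_const w * fps_X) * ?V)) n"
      by (cases n) (auto simp: left_diff_distrib mult.assoc fps_X_mult_nth power_Suc[symmetric] simp del: power_Suc split: nat.splits)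
  qed
  moreover have "fps_X * fps_deriv (?l * ?G) = fps_X * fps_deriv ?l * ?G + ?l * (fps_X * fps_deriv ?G)"
    by (simp add: algebra_simps)
  ultimately have "fps_X * fps_deriv (?l * ?G) =
      - (?l * ?V) * ?G + ?l * - (?G * (\<Sum>w\<in>#B. Abs_fps (\<lambda>r. if r = 0 then 0 else w ^ r)))"
    by (simp only: add.IH)
  then show ?case by (simp add: fps_of_poly_mult algebra_simps del: mult_pCons_left)
qed simp

section \<open>Weil's bound for products of linear forms\<close>

context linear_char_sum
begin

theorem weil_bound:
  assumes nz: "\<And>i. i \<in> I \<Longrightarrow> a i \<noteq> 0"
  shows "norm (\<Sum>x\<in>UNIV. field_char (\<Prod>i\<in>I. (a i - x) ^ e i)) \<le> (real (card I) - 1) * sqrt (real CARD('a))"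
proof -
  have cardI: "card I > 0" using nontrivial finI by (auto simp: card_gt_0_iff)
  define L where "L = (\<Sum>n<card I. monom (L_coeff n) n)"
  have coeff_L: "coeff L n = L_coeff n" for n
    unfolding L_def coeff_sum coeff_monom using L_coeff_eq_0[of n]
    by (cases "n < card I") (simp_all add: if_distrib cong: if_cong)
  obtain B where B: "size B = degree L" "L = (\<Prod>w\<in>#B. [:1, - w:])"
    using complex_poly_reciprocal_factorization[of L] by (auto simp: coeff_L L_coeff_0)
  have "degree L \<le> card I - 1"
    by (rule degree_le) (use cardI in \<open>auto simp: coeff_L intro!: L_coeff_eq_0\<close>)
  then have sizeB: "size B \<le> card I - 1" using B(1) by simp
  define F where "F = fps_of_poly L"
  define S where "S = Abs_fps (\<lambda>r. if r = 0 then 0 else ext_sum r)"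
  define V where "V = (\<Sum>w\<in>#B. Abs_fps (\<lambda>r. if r = 0 then 0 else w ^ r))"
  have F0: "F \<noteq> 0" using L_coeff_0 coeff_L[of 0] by (auto simp: F_def)
  have "fps_X * fps_deriv F = S * F"
  proof (rule fps_ext)
    fix n
    have "fps_nth (fps_X * fps_deriv F) n = of_nat n * L_coeff n"
      by (cases n) (simp_all add: F_def coeff_L)
    also have "\<dots> = (\<Sum>r\<in>{1..n}. ext_sum r * L_coeff (n - r))" by (rule L_coeff_recurrence)
    also have "\<dots> = (\<Sum>r\<in>{0..n}. fps_nth S r * fps_nth F (n - r))"
      by (rule sum.mono_neutral_cong_left) (auto simp: S_def F_def coeff_L)
    finally show "fps_nth (fps_X * fps_deriv F) n = fps_nth (S * F) n" by (simp add: fps_mult_nth)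
  qed
  moreover have "fps_X * fps_deriv F = - (F * V)"
    unfolding F_def B(2) V_def by (rule fps_log_deriv_prod)
  ultimately have "S * F = - V * F" by (simp add: mult.commute)
  \<comment> \<open>The recurrence and the factorization give two formulas for X F', and the nonzero
    series \<open>F\<close> cancels.\<close>
  then have SV: "S = - V" using F0 by (simp only: mult_cancel_right) simp
  have V_nth: "fps_nth V r = (\<Sum>w\<in>#B. w ^ r)" if "r > 0" for r
    unfolding V_def using that by (induction B) simp_all
  have ext: "ext_sum r = - (\<Sum>w\<in>#B. w ^ r)" if "r > 0" for r
  proof -
    have "ext_sum r = fps_nth S r" using that by (simp add: S_def)
    then show ?thesis using V_nth[OF that] by (simp add: SV)
  qed
  obtain C where C: "\<And>s. s > 0 \<Longrightarrow> norm (ext_sum (2 * s)) \<le> C * real (CARD('a) ^ s)"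
    using ext_sum_bound[OF nz] by blast
  have small: "norm w \<le> sqrt (real CARD('a))" if "w \<in># B" for w
  proof -
    \<comment> \<open>Sums are bounded in even degrees only, so the criterion is applied to the
      squares, whose s-th power sum is the negated \<open>ext_sum (2 * s)\<close>.\<close>
    have "norm (w ^ 2) \<le> real CARD('a)"
    proof (rule norm_le_of_power_sums)
      show "w ^ 2 \<in># image_mset (\<lambda>w. w ^ 2) B" using that by simp
      fix s :: nat assume s: "s > 0"
      have "(\<Sum>z\<in>#image_mset (\<lambda>w. w ^ 2) B. z ^ s) = (\<Sum>w\<in>#B. w ^ (2 * s))"
        by (simp add: image_mset.compositionality o_def power_mult)
      then have "norm (\<Sum>z\<in>#image_mset (\<lambda>w. w ^ 2) B. z ^ s) = norm (ext_sum (2 * s))"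
        using s by (simp add: ext)
      also have "\<dots> \<le> C * real (CARD('a) ^ s)" by (rule C[OF s])
      finally show "norm (\<Sum>z\<in>#image_mset (\<lambda>w. w ^ 2) B. z ^ s) \<le> C * real CARD('a) ^ s" by simp
    qed simp
    then show ?thesis by (intro real_le_rsqrt) (simp add: norm_power)
  qed
  have "norm (ext_sum 1) = norm (\<Sum>w\<in>#B. w)" by (simp add: ext)
  also have "\<dots> \<le> real (size B) * sqrt (real CARD('a))"
    using small
  proof (induction B)
    case (add w B)
    have "norm (\<Sum>w\<in>#add_mset w B. w) \<le> norm w + norm (\<Sum>w\<in>#B. w)" by (simp add: norm_triangle_ineq)
    also have "\<dots> \<le> sqrt (real CARD('a)) + real (size B) * sqrt (real CARD('a))"
      using add.IH add.prems by (intro add_mono) auto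
    finally show ?case by (simp add: algebra_simps)
  qed simp
  also have "\<dots> \<le> (real (card I) - 1) * sqrt (real CARD('a))"
    using sizeB cardI by (intro mult_right_mono) auto
  finally show ?thesis unfolding ext_sum_1 .
qed

end

section \<open>Sieving by characters\<close>

text \<open>A divisor d > 1 contains a prime l, and being an l-th power is tested by g^((q-1)/l) =
  1, as the discrete logarithm shows.\<close>

lemma e_free_iff:
  fixes g :: "'a::{field,finite}"
  assumes e: "e dvd CARD('a) - 1"
  shows "e_free e g \<longleftrightarrow> g \<noteq> 0 \<and> (\<forall>l\<in>prime_factors e. g ^ ((CARD('a) - 1) div l) \<noteq> 1)"
proof -
  let ?N = "CARD('a) - 1"
  have N: "?N > 0" using card_finite_field_ge_2[where 'a='a] by simp
  have e0: "e > 0" using e N by (auto intro!: Nat.gr0I)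
  show ?thesis
  proof (intro iffI conjI ballI)
    assume free: "e_free e g"
    then show g0: "g \<noteq> 0" by (simp add: e_free_def)
    fix l assume "l \<in> prime_factors e"
    then have l: "prime l" "l dvd e" by auto
    show "g ^ (?N div l) \<noteq> 1"
    proof
      assume one: "g ^ (?N div l) = 1"
      obtain t where t: "?N = l * t" using dvd_trans[OF l(2) e] by blast
      have t0: "t > 0" using t N by (auto intro!: Nat.gr0I)
      define k where "k = field_log g"
      have g: "g = field_gen ^ k" using g0 by (simp add: k_def field_gen_power_log)
      have "(field_gen :: 'a) ^ (k * t) = field_gen ^ 0"
        using one l(1) prime_gt_0_nat[OF l(1)] unfolding t g by (simp add: power_mult)
      then have "l * t dvd k * t" unfolding field_gen_power_eq_iff t by (simp add: cong_0_iff)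
      then have "l dvd k" using t0 by simp
      then obtain j where "k = j * l" by (metis dvdE mult.commute)
      then have "g = (field_gen ^ j) ^ l" unfolding g by (simp add: power_mult)
      then show False using free l unfolding e_free_def by (metis not_prime_1)
    qed
  next
    assume *: "g \<noteq> 0 \<and> (\<forall>l\<in>prime_factors e. g ^ (?N div l) \<noteq> 1)"
    show "e_free e g"
      unfolding e_free_def
    proof (intro conjI allI impI)
      fix h d assume hd: "d dvd e \<and> g = h ^ d"
      show "d = 1"
      proof (rule ccontr)
        assume "d \<noteq> 1"
        then obtain l where l: "prime l" "l dvd d" using prime_factor_nat by blast
        then have le: "l dvd e" using hd dvd_trans by blast
        have d0: "d > 0" using hd e0 by (auto intro!: Nat.gr0I)
        then have h0: "h \<noteq> 0" using hd * by (auto simp: power_0_left)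
        have "d * (?N div l) = d div l * ?N"
          using l(2) dvd_trans[OF le e] by (metis div_mult_swap dvd_div_mult mult.commute)
        then have "g ^ (?N div l) = (h ^ ?N) ^ (d div l)"
          using hd by (simp add: mult.commute flip: power_mult)
        also have "\<dots> = 1" by (simp only: finite_field_power_card_minus_1[OF h0] power_one)
        finally show False using * l(1) le e0 by (auto simp: prime_factors_dvd)
      qed
    qed (use * in simp)
  qed
qed

text \<open>If g is \<open>field_gen\<close> to the power k, then g is a power with exponent gcd(k,
  q - 1). Freeness makes this gcd 1, and the inverse of k modulo q - 1 recovers every nonzero
  element as a power of g.\<close>

lemma e_free_imp_primitive:
  fixes g :: "'a::{field,finite}"
  assumes "e_free (CARD('a) - 1) g"
  shows "primitive_element g"
proof -
  let ?N = "CARD('a) - 1"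
  have N: "?N > 0" using card_finite_field_ge_2[where 'a='a] by simp
  have g0: "g \<noteq> 0" using assms by (simp add: e_free_def)
  define k where "k = field_log g"
  have g: "g = field_gen ^ k" using g0 by (simp add: k_def field_gen_power_log)
  have cop: "coprime k ?N"
  proof (rule ccontr)
    assume "\<not> coprime k ?N"
    then have "gcd k ?N \<noteq> 1" by (simp only: coprime_iff_gcd_eq_1 not_False_eq_True)
    moreover have "gcd k ?N dvd ?N" by simp
    moreover have "g = (field_gen ^ (k div gcd k ?N)) ^ gcd k ?N"
      unfolding g power_mult[symmetric] by simp
    ultimately show False using assms unfolding e_free_def by blast
  qed
  have "y \<in> range (\<lambda>j. g ^ j)" if y: "y \<noteq> 0" for y
  proof -
    obtain u where "[k * u = 1] (mod ?N)" using cong_solve_coprime_nat[OF cop] unfolding One_nat_def by blast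
    then have "[k * u * field_log y = 1 * field_log y] (mod ?N)" by (rule cong_scalar_right)
    then have "[k * (u * field_log y) = field_log y] (mod ?N)" by (simp only: mult.assoc mult_1)
    then have "g ^ (u * field_log y) = field_gen ^ field_log y"
      unfolding g power_mult[symmetric] field_gen_power_eq_iff .
    then show ?thesis using field_gen_power_log[OF y] by (metis rangeI)
  qed
  then show ?thesis unfolding primitive_element_def using g0 by auto
qed

text \<open>The coefficient mu(m) / phi(m) of the classical character expansion, at one prime: 0
  indexes the trivial character, every other \<open>j\<close> below \<open>l\<close> a character of
  order \<open>l\<close>.\<close>

definition sieve_weight :: "nat \<Rightarrow> nat \<Rightarrow> real" where
  "sieve_weight l j = (if j = 0 then 1 else - 1 / (real l - 1))"

text \<open>The geometric sum separates w = 1 from the other l-th roots of unity, and the factor 1 -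
  1/l normalizes the second value to 1. These factors make up \<open>prime_theta\<close>.\<close>

lemma sum_sieve_weight_roots:
  fixes w :: complex
  assumes l: "l \<ge> 2" and w: "w ^ l = 1"
  shows "of_real (1 - 1 / real l) * (\<Sum>j<l. of_real (sieve_weight l j) * w ^ j) = of_bool (w \<noteq> 1)"
proof -
  define c where "c = complex_of_real (1 / (real l - 1))"
  have sum: "(\<Sum>j<l. w ^ j) = (if w = 1 then of_nat l else 0)"
    using w by (simp add: geometric_sum)
  have "(\<Sum>j<l. of_real (sieve_weight l j) * w ^ j) = (\<Sum>j<l. (if j = 0 then 1 + c else 0) - c * w ^ j)"
    by (intro sum.cong refl) (auto simp: sieve_weight_def c_def)
  also have "\<dots> = (1 + c) - c * (\<Sum>j<l. w ^ j)"
    using l by (simp add: sum_subtractf sum_distrib_left)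
  finally have eq: "(\<Sum>j<l. of_real (sieve_weight l j) * w ^ j) = (1 + c) - c * (if w = 1 then of_nat l else 0)"
    unfolding sum .
  have l1: "real l - 1 \<noteq> 0" "real l \<noteq> 0" using l by auto
  show ?thesis
  proof (cases "w = 1")
    case True
    have "1 + 1 / (real l - 1) - 1 / (real l - 1) * real l = 0" using l1 by (simp add: field_simps)
    then have "complex_of_real (1 + 1 / (real l - 1) - 1 / (real l - 1) * real l) = 0" by (simp only: of_real_0)
    then have "(1 + c) - c * of_nat l = 0" by (simp add: c_def)
    then show ?thesis using True unfolding eq by simp
  next
    case False
    have "(1 - 1 / real l) * (1 + 1 / (real l - 1)) = 1" using l1 by (simp add: field_simps)
    then have "complex_of_real ((1 - 1 / real l) * (1 + 1 / (real l - 1))) = 1" by (simp only: of_real_1)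
    then have "complex_of_real (1 - 1 / real l) * (1 + c) = 1" by (simp only: c_def of_real_mult of_real_add of_real_1)
    then show ?thesis using False unfolding eq by simp
  qed
qed

text \<open>The l - 1 nontrivial characters share total weight 1. Each prime thus contributes a
  factor 2, which is the origin of W(e).\<close>

lemma sum_abs_sieve_weight:
  assumes "l \<ge> 2" shows "(\<Sum>j<l. \<bar>sieve_weight l j\<bar>) = 2"
proof -
  have "(\<Sum>j<l. \<bar>sieve_weight l j\<bar>) = \<bar>sieve_weight l 0\<bar> + (\<Sum>j\<in>{1..<l}. \<bar>sieve_weight l j\<bar>)"
    using assms by (simp add: lessThan_atLeast0 sum.atLeast_Suc_lessThan)
  also have "(\<Sum>j\<in>{1..<l}. \<bar>sieve_weight l j\<bar>) = (\<Sum>j\<in>{1..<l}. 1 / (real l - 1))"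
    using assms by (intro sum.cong refl) (auto simp: sieve_weight_def)
  also have "\<dots> = 1" using assms by (simp add: of_nat_diff)
  finally show ?thesis by (simp add: sieve_weight_def)
qed

text \<open>An index picks, for each prime \<open>l\<close> of \<open>e\<close>, a power of a
  character of order \<open>l\<close>; together they describe the characters of order dividing the
  product of these primes.\<close>

definition sieve_index :: "nat \<Rightarrow> (nat \<Rightarrow> nat) set" where
  "sieve_index e = (\<Pi>\<^sub>E l\<in>prime_factors e. {..<l})"

definition sieve_coeff :: "nat \<Rightarrow> (nat \<Rightarrow> nat) \<Rightarrow> real" where
  "sieve_coeff e b = (\<Prod>l\<in>prime_factors e. sieve_weight l (b l))"

text \<open>The summand \<open>N\<close> makes the power vanish at \<open>0\<close> for the trivial index, too.\<close>
definition sieve_exp :: "nat \<Rightarrow> nat \<Rightarrow> (nat \<Rightarrow> nat) \<Rightarrow> nat" where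
  "sieve_exp N e b = (\<Sum>l\<in>prime_factors e. b l * (N div l)) + N"

text \<open>The value at -1 of the indexed character when (q - 1) / 2 is odd: only the component at
  2 sees -1.\<close>

definition sieve_sign :: "nat \<Rightarrow> (nat \<Rightarrow> nat) \<Rightarrow> real" where
  "sieve_sign e b = (\<Prod>l\<in>prime_factors e. if l = 2 then (-1) ^ b l else 1)"

lemma finite_sieve_index [simp]: "finite (sieve_index e)"
  by (simp add: sieve_index_def finite_PiE)

text \<open>For nonzero \<open>g\<close>, the product over the primes of the local identities
  \<open>sum_sieve_weight_roots\<close> at field_char(g^((q-1)/l)), multiplied out.\<close>

lemma e_free_expansion:
  fixes g :: "'a::{field,finite}"
  assumes e: "e dvd CARD('a) - 1"
  shows "of_bool (e_free e g) = complex_of_real (prime_theta e) *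
    (\<Sum>b\<in>sieve_index e. of_real (sieve_coeff e b) * field_char (g ^ sieve_exp (CARD('a) - 1) e b))"
proof (cases "g = 0")
  case True
  have N: "CARD('a) - 1 > 0" using card_finite_field_ge_2[where 'a='a] by simp
  then have pos: "sieve_exp (CARD('a) - 1) e b > 0" for b by (simp add: sieve_exp_def)
  have zero: "field_char ((0 :: 'a) ^ sieve_exp (CARD('a) - 1) e b) = 0" for b
    by (simp only: zero_power[OF pos] field_char_0)
  show ?thesis unfolding True zero by (simp add: e_free_def)
next
  case False
  let ?N = "CARD('a) - 1"
  let ?L = "prime_factors e"
  let ?w = "\<lambda>l. field_char (g ^ (?N div l))"
  have l2: "l \<ge> 2" if "l \<in> ?L" for l using that prime_ge_2_nat by auto
  have wl: "?w l ^ l = 1" if "l \<in> ?L" for l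
  proof -
    have "l dvd ?N" using that e dvd_trans by auto
    then have "(g ^ (?N div l)) ^ l = 1"
      unfolding power_mult[symmetric] using finite_field_power_card_minus_1[OF False] by simp
    then show ?thesis by (simp flip: field_char_power)
  qed
  have summand: "of_real (sieve_coeff e b) * field_char (g ^ sieve_exp ?N e b) =
      (\<Prod>l\<in>?L. of_real (sieve_weight l (b l)) * ?w l ^ b l)" for b
  proof -
    have "g ^ sieve_exp ?N e b = (\<Prod>l\<in>?L. (g ^ (?N div l)) ^ b l)"
      unfolding sieve_exp_def power_add finite_field_power_card_minus_1[OF False]
      by (simp add: power_sum mult.commute flip: power_mult)
    then show ?thesis
      by (simp add: sieve_coeff_def field_char_prod field_char_power prod.distrib)
  qed
  have "(\<Sum>b\<in>sieve_index e. of_real (sieve_coeff e b) * field_char (g ^ sieve_exp ?N e b)) =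
      (\<Prod>l\<in>?L. \<Sum>j<l. of_real (sieve_weight l j) * ?w l ^ j)"
    unfolding summand sieve_index_def by (rule prod_sum_PiE[symmetric]) simp_all
  then have "complex_of_real (prime_theta e) *
      (\<Sum>b\<in>sieve_index e. of_real (sieve_coeff e b) * field_char (g ^ sieve_exp ?N e b)) =
      (\<Prod>l\<in>?L. of_real (1 - 1 / real l) * (\<Sum>j<l. of_real (sieve_weight l j) * ?w l ^ j))"
    unfolding prime_theta_def of_real_prod by (simp add: prod.distrib)
  also have "\<dots> = (\<Prod>l\<in>?L. of_bool (?w l \<noteq> 1))"
    by (intro prod.cong refl sum_sieve_weight_roots l2 wl)
  also have "\<dots> = of_bool (\<forall>l\<in>?L. g ^ (?N div l) \<noteq> 1)"
    by (auto simp: field_char_eq_1_iff prod_zero_iff intro!: prod.neutral)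
  finally show ?thesis using False by (simp add: e_free_iff[OF e])
qed

lemma sum_abs_sieve_coeff: "(\<Sum>b\<in>sieve_index e. \<bar>sieve_coeff e b\<bar>) = real (prime_W e)"
proof -
  have "(\<Sum>b\<in>sieve_index e. \<bar>sieve_coeff e b\<bar>) = (\<Prod>l\<in>prime_factors e. \<Sum>j<l. \<bar>sieve_weight l j\<bar>)"
    unfolding sieve_index_def sieve_coeff_def abs_prod by (rule prod_sum_PiE[symmetric]) simp_all
  also have "\<dots> = (\<Prod>l\<in>prime_factors e. 2)"
    by (intro prod.cong refl sum_abs_sieve_weight) (auto intro: prime_ge_2_nat)
  finally show ?thesis by (simp add: prime_W_def prime_omega_def)
qed

text \<open>The factor at the prime 2 is 1 - 1 = 0, so each sign carries exactly half of the weight.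
  Evenness of \<open>e\<close> enters here.\<close>

lemma sum_signed_sieve_coeff:
  assumes "even e" "e > 0"
  shows "(\<Sum>b\<in>sieve_index e. \<bar>sieve_coeff e b\<bar> * sieve_sign e b) = 0"
proof -
  let ?s = "\<lambda>l j. \<bar>sieve_weight l j\<bar> * (if l = 2 then (-1) ^ j else 1)"
  have "(\<Sum>b\<in>sieve_index e. \<bar>sieve_coeff e b\<bar> * sieve_sign e b) = (\<Prod>l\<in>prime_factors e. \<Sum>j<l. ?s l j)"
    unfolding sieve_index_def sieve_coeff_def sieve_sign_def abs_prod prod.distrib[symmetric]
    by (rule prod_sum_PiE[symmetric]) simp_all
  also have "\<dots> = 0"
  proof (rule prod_zero)
    have "(\<Sum>j<2. ?s 2 j) = 0" by (simp add: numeral_2_eq_2 sieve_weight_def)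
    moreover have "2 \<in> prime_factors e" using assms by (simp add: prime_factors_dvd)
    ultimately show "\<exists>l\<in>prime_factors e. (\<Sum>j<l. ?s l j) = 0" by blast
  qed simp
  finally show ?thesis .
qed

lemma sieve_sign_cases: "sieve_sign e b = 1 \<or> sieve_sign e b = -1"
proof -
  have "sieve_sign e b ^ 2 = (\<Prod>l\<in>prime_factors e. 1)"
    unfolding sieve_sign_def prod_power_distrib by (intro prod.cong refl) (simp flip: power_mult)
  then show ?thesis by (simp add: power2_eq_1_iff)
qed

lemma field_char_minus_1:
  assumes "(-1 :: 'a::{field,finite}) \<noteq> 1" shows "field_char (-1 :: 'a) = -1"
proof -
  have "field_char (-1 :: 'a) ^ 2 = 1" by (simp flip: field_char_power)
  then show ?thesis using assms by (simp add: power2_eq_1_iff field_char_eq_1_iff)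
qed

text \<open>As q - 1 is twice an odd number, (q - 1) / l is odd for l = 2 and even for odd
  l.\<close>

lemma field_char_minus_1_sieve_exp:
  assumes e: "e dvd CARD('a::{field,finite}) - 1" and q: "CARD('a) mod 4 = 3" and m1: "(-1 :: 'a) \<noteq> 1"
  shows "field_char ((-1 :: 'a) ^ sieve_exp (CARD('a) - 1) e b) = of_real (sieve_sign e b)"
proof -
  let ?N = "CARD('a) - 1"
  have evN: "even ?N" and oddN2: "odd (?N div 2)" using q by presburger+
  have "(-1 :: 'a) ^ sieve_exp ?N e b = (\<Prod>l\<in>prime_factors e. (-1) ^ (b l * (?N div l)))"
    unfolding sieve_exp_def power_add using evN by (simp add: power_sum)
  then have "field_char ((-1 :: 'a) ^ sieve_exp ?N e b) = (\<Prod>l\<in>prime_factors e. (-1) ^ (b l * (?N div l)))"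
    by (simp add: field_char_prod field_char_power field_char_minus_1[OF m1])
  also have "\<dots> = (\<Prod>l\<in>prime_factors e. of_real (if l = 2 then (-1) ^ b l else 1))"
  proof (intro prod.cong refl)
    fix l assume l: "l \<in> prime_factors e"
    show "(-1 :: complex) ^ (b l * (?N div l)) = of_real (if l = 2 then (-1) ^ b l else 1)"
    proof (cases "l = 2")
      case True
      have "(-1 :: complex) ^ (b l * (?N div l)) = ((-1) ^ (?N div 2)) ^ b l"
        unfolding True by (simp only: power_mult[symmetric] mult.commute)
      also have "(-1 :: complex) ^ (?N div 2) = -1" using oddN2 by (simp add: minus_one_power_iff)
      finally show ?thesis using True by simp
    next
      case False
      have "prime l" "l dvd ?N" using l e dvd_trans by auto
      then have "odd l" using False primes_dvd_imp_eq two_is_prime_nat by blast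
      obtain t where t: "?N = l * t" using \<open>l dvd ?N\<close> by blast
      then have "even t" using evN \<open>odd l\<close> by simp
      moreover have "?N div l = t" using t \<open>odd l\<close> by (auto intro!: Nat.gr0I)
      ultimately show ?thesis using False by simp
    qed
  qed
  finally show ?thesis unfolding sieve_sign_def of_real_prod .
qed

definition sieve_zero :: "nat \<Rightarrow> nat \<Rightarrow> nat" where
  "sieve_zero e = (\<lambda>l\<in>prime_factors e. 0)"

lemma sieve_zero_in: "sieve_zero e \<in> sieve_index e"
  by (auto simp: sieve_zero_def sieve_index_def dest!: in_prime_factors_imp_prime intro: prime_gt_0_nat)

lemma sieve_zero_simps [simp]:
  "sieve_coeff e (sieve_zero e) = 1" "sieve_sign e (sieve_zero e) = 1"
  "sieve_exp N e (sieve_zero e) = N"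
  by (simp_all add: sieve_zero_def sieve_coeff_def sieve_sign_def sieve_exp_def sieve_weight_def)

text \<open>Cancel the factor \<open>t\<close> common to all N / l. Modulo a prime \<open>l\<close>
  of \<open>e\<close> only the summand of \<open>l\<close> survives, so \<open>l\<close> divides b l
  < l. Hence only the zero index gives a trivial character.\<close>

lemma sieve_exp_dvd_imp_zero:
  assumes e: "e dvd N" "N > 0" and b: "b \<in> sieve_index e" and dvd: "N dvd sieve_exp N e b"
  shows "b = sieve_zero e"
proof -
  let ?L = "prime_factors e"
  let ?R = "\<Prod>?L"
  have "?R dvd N"
  proof -
    have "?R dvd e"
    proof -
      have "e > 0" using e by (auto intro!: Nat.gr0I)
      then have "e = (\<Prod>l\<in>?L. l ^ multiplicity l e)" by (simp add: prime_factorization_nat)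
      also have "?R dvd \<dots>"
        by (intro prod_dvd_prod dvd_power) (auto simp: prime_factors_multiplicity)
      finally show ?thesis .
    qed
    then show ?thesis using e(1) dvd_trans by blast
  qed
  then obtain t where t: "N = ?R * t" by blast
  have t0: "t > 0" and R0: "?R > 0" using t e(2) by (auto intro!: Nat.gr0I)
  have R_split: "?R = l * \<Prod>(?L - {l})" if "l \<in> ?L" for l
    using that by (simp add: prod.remove)
  have div: "N div l = \<Prod>(?L - {l}) * t" if l: "l \<in> ?L" for l
  proof -
    have "l > 0" using l by (auto intro: prime_gt_0_nat)
    then show ?thesis unfolding t by (subst R_split[OF l]) (simp add: mult.assoc)
  qed
  have "N dvd (\<Sum>l\<in>?L. b l * (N div l))" using dvd by (simp add: sieve_exp_def)
  also have "(\<Sum>l\<in>?L. b l * (N div l)) = (\<Sum>l\<in>?L. b l * \<Prod>(?L - {l})) * t"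
    unfolding sum_distrib_right by (intro sum.cong refl) (simp add: div mult.assoc)
  finally have R_dvd: "?R dvd (\<Sum>l\<in>?L. b l * \<Prod>(?L - {l}))" unfolding t using t0 by simp
  have "b l = 0" if l: "l \<in> ?L" for l
  proof -
    have pl: "prime l" using l by auto
    have "l dvd (\<Sum>l\<in>?L. b l * \<Prod>(?L - {l}))"
      using R_dvd R_split[OF l] by (metis dvd_mult_left)
    also have "(\<Sum>l\<in>?L. b l * \<Prod>(?L - {l})) = b l * \<Prod>(?L - {l}) + (\<Sum>j\<in>?L - {l}. b j * \<Prod>(?L - {j}))"
      by (rule sum.remove) (use l in auto)
    finally have "l dvd b l * \<Prod>(?L - {l}) + (\<Sum>j\<in>?L - {l}. b j * \<Prod>(?L - {j}))" .
    moreover have "l dvd (\<Sum>j\<in>?L - {l}. b j * \<Prod>(?L - {j}))"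
    proof (intro dvd_sum dvd_mult)
      fix j assume "j \<in> ?L - {l}"
      then show "l dvd \<Prod>(?L - {j})" using l by (intro dvd_prodI) auto
    qed
    ultimately have "l dvd b l * \<Prod>(?L - {l})" by (simp add: dvd_add_left_iff)
    moreover have "\<not> l dvd \<Prod>(?L - {l})"
    proof
      assume "l dvd \<Prod>(?L - {l})"
      then obtain j where "j \<in> ?L - {l}" "l dvd j"
        using prime_dvd_prod_iff[of "?L - {l}" l "\<lambda>x. x"] pl by auto
      then show False using pl primes_dvd_imp_eq[of l j] by auto
    qed
    ultimately have "l dvd b l" using pl prime_dvd_mult_iff by blast
    moreover have "b l < l" using b l by (auto simp: sieve_index_def)
    ultimately show ?thesis by (auto dest: dvd_imp_le)
  qed
  then show ?thesis
    by (intro PiE_ext[OF b[unfolded sieve_index_def] sieve_zero_in[unfolded sieve_index_def]])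
       (simp add: sieve_zero_def)
qed

lemma prime_theta_pos: "prime_theta e > 0"
  unfolding prime_theta_def
proof (rule prod_pos)
  fix l assume "l \<in> prime_factors e"
  then have "l \<ge> 2" by (auto dest!: in_prime_factors_imp_prime intro: prime_ge_2_nat)
  then show "0 < 1 - 1 / real l" by simp
qed

section \<open>Consecutive e-free elements\<close>

text \<open>Since n < q, some \<open>t\<close> differs from all -i with i < n. Substituting t - x
  for x replaces the points i by the nonzero points t + i, as \<open>weil_bound\<close>
  requires.\<close>

lemma weil_bound_consecutive:
  fixes \<epsilon> :: "nat \<Rightarrow> nat"
  assumes n: "n < CARD('a::{field,finite})" and inj: "inj_on (of_nat :: nat \<Rightarrow> 'a) {..<n}"
    and pos: "\<And>i. i < n \<Longrightarrow> \<epsilon> i > 0" and nontriv: "\<exists>i<n. \<not> CARD('a) - 1 dvd \<epsilon> i"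
  shows "norm (\<Sum>x\<in>UNIV. field_char (\<Prod>i<n. (x + of_nat i :: 'a) ^ \<epsilon> i)) \<le> (real n - 1) * sqrt (real CARD('a))"
proof -
  have "card ((\<lambda>i. - of_nat i :: 'a) ` {..<n}) \<le> n" using card_image_le[of "{..<n}"] by simp
  then have "(\<lambda>i. - of_nat i :: 'a) ` {..<n} \<noteq> UNIV" using n by (metis not_le)
  then obtain t :: 'a where t: "t \<notin> (\<lambda>i. - of_nat i) ` {..<n}" by blast
  interpret linear_char_sum "{..<n}" "\<lambda>i. t + of_nat i" \<epsilon>
    by standard (use inj pos nontriv in \<open>auto simp: inj_on_def\<close>)
  have "norm (\<Sum>x\<in>UNIV. field_char (\<Prod>i<n. (t + of_nat i - x) ^ \<epsilon> i)) \<le> (real (card {..<n}) - 1) * sqrt (real CARD('a))"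
    by (rule weil_bound) (use t in \<open>auto simp: eq_neg_iff_add_eq_0\<close>)
  also have "(\<Sum>x\<in>UNIV. field_char (\<Prod>i<n. (t + of_nat i - x) ^ \<epsilon> i)) = (\<Sum>x\<in>UNIV. field_char (\<Prod>i<n. (x + of_nat i :: 'a) ^ \<epsilon> i))"
    by (rule sum.reindex_bij_witness[of _ "\<lambda>x. t - x" "\<lambda>x. t - x"]) (auto simp: algebra_simps)
  finally show ?thesis by simp
qed

text \<open>
  The reflection \<open>g \<mapsto> - (g + n - 1)\<close> reverses the tuple of characters and multiplies the character sum by
  the product of the signs, so that only tuples with product of signs \<open>1\<close> contribute.\<close>
lemma num_consecutive_free_lower_bound:
  assumes n: "0 < n" "n < CARD('a::{field,finite})" and inj: "inj_on (of_nat :: nat \<Rightarrow> 'a) {..<n}"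
    and e: "e dvd CARD('a) - 1" "even e" and q: "CARD('a) mod 4 = 3" and m1: "(-1 :: 'a) \<noteq> 1"
  shows "real (num_consecutive_free TYPE('a) n e) \<ge> prime_theta e ^ n *
    (real CARD('a) - real n - (real (prime_W e) ^ n / 2 - 1) * ((real n - 1) * sqrt (real CARD('a))))"
proof -
  let ?N = "CARD('a) - 1"
  let ?B = "\<Pi>\<^sub>E i\<in>{..<n}. sieve_index e"
  have N: "?N > 0" using card_finite_field_ge_2[where 'a='a] by simp
  have e0: "e > 0" using e(1) N by (auto intro!: Nat.gr0I)
  define K where "K = (real n - 1) * sqrt (real CARD('a))"
  define w where "w = (\<lambda>\<beta>. \<Prod>i<n. sieve_coeff e (\<beta> i))"
  define \<sigma> where "\<sigma> = (\<lambda>\<beta>. \<Prod>i<n. sieve_sign e (\<beta> i))"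
  define S where "S = (\<lambda>\<beta>. \<Sum>g\<in>UNIV. field_char (\<Prod>i<n. (g + of_nat i :: 'a) ^ sieve_exp ?N e (\<beta> i)))"
  define \<beta>0 where "\<beta>0 = (\<lambda>i\<in>{..<n}. sieve_zero e)"
  have finB: "finite ?B" by (simp add: finite_PiE)
  have \<beta>0: "\<beta>0 \<in> ?B" by (simp add: \<beta>0_def sieve_zero_in)
  have "complex_of_real (real (num_consecutive_free TYPE('a) n e)) =
      (\<Sum>g\<in>UNIV. \<Prod>i<n. of_bool (e_free e (g + of_nat i :: 'a)))"
  proof -
    have "(\<Prod>i<n. of_bool (e_free e (g + of_nat i :: 'a))) = (of_bool (\<forall>i<n. e_free e (g + of_nat i)) :: complex)" for g
      by (auto simp: prod_zero_iff intro!: prod.neutral)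
    then show ?thesis
      by (simp add: num_consecutive_free_def sum.If_cases of_bool_def)
  qed
  also have "\<dots> = (\<Sum>g\<in>UNIV. of_real (prime_theta e) ^ n * (\<Sum>\<beta>\<in>?B. \<Prod>i<n.
        of_real (sieve_coeff e (\<beta> i)) * field_char ((g + of_nat i :: 'a) ^ sieve_exp ?N e (\<beta> i))))"
    unfolding e_free_expansion[OF e(1)]
  proof (intro sum.cong refl)
    fix g :: 'a
    have "(\<Prod>i<n. \<Sum>b\<in>sieve_index e. complex_of_real (sieve_coeff e b) * field_char ((g + of_nat i) ^ sieve_exp ?N e b)) =
        (\<Sum>\<beta>\<in>?B. \<Prod>i<n. of_real (sieve_coeff e (\<beta> i)) * field_char ((g + of_nat i) ^ sieve_exp ?N e (\<beta> i)))"
      by (rule prod_sum_PiE) simp_all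
    then show "(\<Prod>i<n. of_real (prime_theta e) * (\<Sum>b\<in>sieve_index e. complex_of_real (sieve_coeff e b) * field_char ((g + of_nat i) ^ sieve_exp ?N e b))) =
        of_real (prime_theta e) ^ n * (\<Sum>\<beta>\<in>?B. \<Prod>i<n. of_real (sieve_coeff e (\<beta> i)) * field_char ((g + of_nat i) ^ sieve_exp ?N e (\<beta> i)))"
      by (subst prod.distrib) (simp only: prod_constant card_lessThan)
  qed
  also have "\<dots> = of_real (prime_theta e) ^ n * (\<Sum>\<beta>\<in>?B. of_real (w \<beta>) * S \<beta>)"
    unfolding S_def w_def sum_distrib_left[symmetric] of_real_prod
    by (subst sum.swap) (simp add: prod.distrib field_char_prod sum_distrib_left)
  finally have count: "complex_of_real (real (num_consecutive_free TYPE('a) n e)) =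
      of_real (prime_theta e) ^ n * (\<Sum>\<beta>\<in>?B. of_real (w \<beta>) * S \<beta>)" .
  define rev where "rev = (\<lambda>\<beta>. \<lambda>i\<in>{..<n}. \<beta> (n - 1 - i) :: nat \<Rightarrow> nat)"
  have rev_in: "rev \<beta> \<in> ?B" if "\<beta> \<in> ?B" for \<beta>
    using that unfolding rev_def by (auto simp: PiE_def Pi_def)
  have rev_rev: "rev (rev \<beta>) = \<beta>" if "\<beta> \<in> ?B" for \<beta>
    by (rule extensionalityI[of _ "{..<n}"]) (use that in \<open>auto simp: rev_def PiE_def\<close>)
  have w_rev: "w (rev \<beta>) = w \<beta>" for \<beta>
    unfolding w_def rev_def
    by (rule prod.reindex_bij_witness[of _ "\<lambda>i. n - 1 - i" "\<lambda>i. n - 1 - i"]) auto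
  have S_rev: "S (rev \<beta>) = of_real (\<sigma> \<beta>) * S \<beta>" for \<beta>
  proof -
    have "S (rev \<beta>) = (\<Sum>g\<in>UNIV. field_char (\<Prod>i<n. (- (g + of_nat (n - 1)) + of_nat i :: 'a) ^ sieve_exp ?N e (rev \<beta> i)))"
      unfolding S_def
      by (rule sum.reindex_bij_witness[of _ "\<lambda>g. - (g + of_nat (n - 1))" "\<lambda>g. - (g + of_nat (n - 1))"]) auto
    also have "\<dots> = (\<Sum>g\<in>UNIV. field_char (\<Prod>i<n. (-1) ^ sieve_exp ?N e (\<beta> i) * (g + of_nat i :: 'a) ^ sieve_exp ?N e (\<beta> i)))"
    proof (intro sum.cong refl arg_cong[of _ _ field_char])
      fix g :: 'a
      show "(\<Prod>i<n. (- (g + of_nat (n - 1)) + of_nat i) ^ sieve_exp ?N e (rev \<beta> i)) =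
          (\<Prod>i<n. (-1) ^ sieve_exp ?N e (\<beta> i) * (g + of_nat i) ^ sieve_exp ?N e (\<beta> i))"
      proof (rule prod.reindex_bij_witness[of _ "\<lambda>i. n - 1 - i" "\<lambda>i. n - 1 - i"])
        fix i assume i: "i \<in> {..<n}"
        then have "of_nat (n - 1) = (of_nat i + of_nat (n - 1 - i) :: 'a)"
          by (simp flip: of_nat_add)
        then have "- (g + of_nat (n - 1)) + of_nat i = -1 * (g + of_nat (n - 1 - i) :: 'a)"
          by (simp add: algebra_simps)
        then show "(-1) ^ sieve_exp ?N e (\<beta> (n - 1 - i)) * (g + of_nat (n - 1 - i)) ^ sieve_exp ?N e (\<beta> (n - 1 - i)) =
            (- (g + of_nat (n - 1)) + of_nat i) ^ sieve_exp ?N e (rev \<beta> i)"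
          using i by (simp only: power_mult_distrib[symmetric] rev_def restrict_apply if_True)
      qed auto
    qed
    also have "\<dots> = of_real (\<sigma> \<beta>) * S \<beta>"
      by (simp add: prod.distrib field_char_mult field_char_prod field_char_minus_1_sieve_exp[OF e(1) q m1]
          S_def \<sigma>_def sum_distrib_left del: One_nat_def)
    finally show ?thesis .
  qed
  have \<sigma>_cases: "\<sigma> \<beta> = 1 \<or> \<sigma> \<beta> = -1" for \<beta>
  proof -
    have "\<sigma> \<beta> ^ 2 = (\<Prod>i<n. 1)"
      unfolding \<sigma>_def prod_power_distrib
      by (intro prod.cong refl) (use sieve_sign_cases[of e] in \<open>auto simp: power2_eq_1_iff\<close>)
    then show ?thesis by (simp add: power2_eq_1_iff)
  qed
  \<comment> \<open>Averaging the sum with its reflected form kills the tuples with sign -1 and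
    keeps the weight of the others.\<close>
  define v where "v = (\<lambda>\<beta>. w \<beta> * (1 + \<sigma> \<beta>) / 2)"
  have "(\<Sum>\<beta>\<in>?B. of_real (w \<beta>) * S \<beta>) = (\<Sum>\<beta>\<in>?B. of_real (w (rev \<beta>)) * S (rev \<beta>))"
    by (rule sum.reindex_bij_witness[of _ rev rev]) (use rev_in rev_rev in auto)
  also have "\<dots> = (\<Sum>\<beta>\<in>?B. of_real (w \<beta>) * (of_real (\<sigma> \<beta>) * S \<beta>))" by (simp add: w_rev S_rev)
  finally have "(\<Sum>\<beta>\<in>?B. of_real (w \<beta>) * S \<beta>) =
      ((\<Sum>\<beta>\<in>?B. of_real (w \<beta>) * S \<beta>) + (\<Sum>\<beta>\<in>?B. of_real (w \<beta>) * (of_real (\<sigma> \<beta>) * S \<beta>))) / 2" by simp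
  also have "\<dots> = (\<Sum>\<beta>\<in>?B. of_real (v \<beta>) * S \<beta>)"
    unfolding sum.distrib[symmetric] sum_divide_distrib v_def
    by (intro sum.cong refl) (simp add: algebra_simps add_divide_distrib)
  also have "\<dots> = of_real (v \<beta>0) * S \<beta>0 + (\<Sum>\<beta>\<in>?B - {\<beta>0}. of_real (v \<beta>) * S \<beta>)"
    by (rule sum.remove[OF finB \<beta>0])
  finally have split: "(\<Sum>\<beta>\<in>?B. of_real (w \<beta>) * S \<beta>) =
      of_real (v \<beta>0) * S \<beta>0 + (\<Sum>\<beta>\<in>?B - {\<beta>0}. of_real (v \<beta>) * S \<beta>)" .
  have v\<beta>0: "v \<beta>0 = 1" by (simp add: v_def w_def \<sigma>_def \<beta>0_def)
  have S\<beta>0: "S \<beta>0 = of_nat (CARD('a) - n)"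
  proof -
    let ?Z = "(\<lambda>i. - of_nat i :: 'a) ` {..<n}"
    have cardZ: "card ?Z = n" using inj by (subst card_image) (auto simp: inj_on_def)
    have "field_char (\<Prod>i<n. (g + of_nat i :: 'a) ^ sieve_exp ?N e (\<beta>0 i)) = of_bool (g \<notin> ?Z)" for g
    proof (cases "g \<in> ?Z")
      case True
      then obtain i where "i < n" "g + of_nat i = 0" by auto
      then have zero: "(\<Prod>i<n. (g + of_nat i :: 'a) ^ sieve_exp ?N e (\<beta>0 i)) = 0"
        using N by (intro prod_zero) (auto simp: \<beta>0_def intro!: bexI[of _ i])
      show ?thesis unfolding zero using True by simp
    next
      case False
      have "(g + of_nat i) ^ ?N = 1" if "i < n" for i
        by (rule finite_field_power_card_minus_1) (use False that in \<open>auto simp: eq_neg_iff_add_eq_0\<close>)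
      then have one: "(\<Prod>i<n. (g + of_nat i :: 'a) ^ sieve_exp ?N e (\<beta>0 i)) = 1"
        by (intro prod.neutral) (simp add: \<beta>0_def)
      show ?thesis unfolding one using False by simp
    qed
    then have "S \<beta>0 = of_nat (card (- ?Z))"
      unfolding S_def by (simp add: of_bool_def sum.If_cases Compl_eq)
    also have "card (- ?Z) = CARD('a) - n" by (simp add: Compl_eq_Diff_UNIV card_Diff_subset cardZ)
    finally show ?thesis .
  qed
  have S_bound: "norm (S \<beta>) \<le> K" if \<beta>: "\<beta> \<in> ?B - {\<beta>0}" for \<beta>
    unfolding S_def K_def
  proof (rule weil_bound_consecutive[OF n(2) inj])
    show "sieve_exp ?N e (\<beta> i) > 0" for i using N by (simp add: sieve_exp_def)
    show "\<exists>i<n. \<not> ?N dvd sieve_exp ?N e (\<beta> i)"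
    proof (rule ccontr)
      assume "\<not> (\<exists>i<n. \<not> ?N dvd sieve_exp ?N e (\<beta> i))"
      then have "\<beta> i = sieve_zero e" if "i < n" for i
        using that sieve_exp_dvd_imp_zero[OF e(1) N] \<beta> by (auto simp: PiE_def Pi_def)
      then have "\<beta> = \<beta>0" using \<beta> \<beta>0 by (intro PiE_ext[of \<beta> "{..<n}" _ \<beta>0]) (auto simp: \<beta>0_def)
      then show False using \<beta> by simp
    qed
  qed
  \<comment> \<open>As \<open>1 + \<sigma> \<beta>\<close> is 0 or 2, it passes through the absolute
    value, and the total splits into W(e)^n and a signed sum that vanishes.\<close>
  have abs_v: "\<bar>v \<beta>\<bar> = (\<bar>w \<beta>\<bar> + \<bar>w \<beta>\<bar> * \<sigma> \<beta>) / 2" for \<beta>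
    using \<sigma>_cases[of \<beta>] by (auto simp: v_def)
  have sum_w: "(\<Sum>\<beta>\<in>?B. \<bar>w \<beta>\<bar>) = real (prime_W e) ^ n"
    unfolding w_def abs_prod
    by (subst prod_sum_PiE[symmetric]) (simp_all add: sum_abs_sieve_coeff)
  have sum_w\<sigma>: "(\<Sum>\<beta>\<in>?B. \<bar>w \<beta>\<bar> * \<sigma> \<beta>) = 0"
    unfolding w_def \<sigma>_def abs_prod prod.distrib[symmetric]
    by (subst prod_sum_PiE[symmetric]) (use n(1) in \<open>simp_all add: sum_signed_sieve_coeff[OF e(2) e0] power_0_left\<close>)
  have "(\<Sum>\<beta>\<in>?B. \<bar>v \<beta>\<bar>) = real (prime_W e) ^ n / 2"
    unfolding abs_v sum_divide_distrib[symmetric] sum.distrib sum_w sum_w\<sigma> by simp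
  moreover have "(\<Sum>\<beta>\<in>?B. \<bar>v \<beta>\<bar>) = \<bar>v \<beta>0\<bar> + (\<Sum>\<beta>\<in>?B - {\<beta>0}. \<bar>v \<beta>\<bar>)"
    by (rule sum.remove[OF finB \<beta>0])
  ultimately have sum_v: "(\<Sum>\<beta>\<in>?B - {\<beta>0}. \<bar>v \<beta>\<bar>) = real (prime_W e) ^ n / 2 - 1" using v\<beta>0 by simp
  define D where "D = (\<Sum>\<beta>\<in>?B - {\<beta>0}. of_real (v \<beta>) * S \<beta>)"
  have "norm D \<le> (\<Sum>\<beta>\<in>?B - {\<beta>0}. \<bar>v \<beta>\<bar> * K)"
    unfolding D_def by (rule sum_norm_le) (simp add: norm_mult mult_left_mono S_bound)
  also have "\<dots> = (real (prime_W e) ^ n / 2 - 1) * K" by (simp only: sum_distrib_right[symmetric] sum_v)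
  finally have D: "Re D \<ge> - ((real (prime_W e) ^ n / 2 - 1) * K)"
    using abs_Re_le_cmod[of D] by linarith
  have "real (num_consecutive_free TYPE('a) n e) = Re (complex_of_real (real (num_consecutive_free TYPE('a) n e)))"
    by simp
  also have "\<dots> = prime_theta e ^ n * (real (CARD('a) - n) + Re D)"
    unfolding count split v\<beta>0 S\<beta>0 D_def[symmetric] by (simp flip: of_real_power)
  also have "\<dots> \<ge> prime_theta e ^ n * (real CARD('a) - real n - (real (prime_W e) ^ n / 2 - 1) * K)"
  proof (rule mult_left_mono)
    show "prime_theta e ^ n \<ge> 0" using prime_theta_pos[of e] by simp
  qed (use D n in \<open>simp add: of_nat_diff\<close>)
  finally show ?thesis unfolding K_def .
qed


theorem theorem4:
  fixes p k q n :: nat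
  assumes "prime p" and "k \<ge> 1" and "q = p ^ k"
    and "CARD('a::{field,finite}) = q"
    and "q mod 4 = 3" and "q \<ge> 7"
    and "3 \<le> n" and "n \<le> p"
  shows "(\<forall>e::nat. e dvd q - 1 \<and> even e \<longrightarrow>
            real (num_consecutive_free TYPE('a) n e)
              \<ge> prime_theta e ^ n * (real q - (real n - 1) / 2 * real (prime_W e) ^ n * sqrt (real q)))
       \<and> (real n - 1)\<^sup>2 / 4 * real (prime_W (q - 1)) ^ (2 * n)
            = (real n - 1)\<^sup>2 * 2 ^ (2 * (n * prime_omega (q - 1) - 1))
       \<and> (real q \<ge> (real n - 1)\<^sup>2 / 4 * real (prime_W (q - 1)) ^ (2 * n) \<longrightarrow>
            (\<exists>g::'a. \<forall>i<n. primitive_element (g + of_nat i)))"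
proof -
  note q = \<open>CARD('a) = q\<close>
  have n3: "real n \<ge> 3" using \<open>3 \<le> n\<close> by simp
  have "p ^ 1 \<le> p ^ k"
    using \<open>k \<ge> 1\<close> prime_gt_0_nat[OF \<open>prime p\<close>] by (intro power_increasing) auto
  then have nq: "n \<le> q" using \<open>n \<le> p\<close> \<open>q = p ^ k\<close> by simp
  have char: "CHAR('a) = p"
  proof -
    have "CHAR('a) dvd q" using of_nat_CARD_eq_0[where 'a='a] unfolding of_nat_eq_0_iff_char_dvd q .
    moreover from this have "CHAR('a) > 0" using \<open>q \<ge> 7\<close> by (auto intro!: Nat.gr0I)
    then have "prime CHAR('a)" by (rule prime_CHAR_semidom)
    ultimately show ?thesis
      using \<open>prime p\<close> \<open>q = p ^ k\<close> prime_dvd_power primes_dvd_imp_eq by blast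
  qed
  have inj: "inj_on (of_nat :: nat \<Rightarrow> 'a) {..<n}"
  proof -
    have False if "i < j" "j < n" "(of_nat i :: 'a) = of_nat j" for i j
    proof -
      have "(of_nat (j - i) :: 'a) = 0" using that by (simp add: of_nat_diff)
      then have "p dvd j - i" unfolding of_nat_eq_0_iff_char_dvd char .
      then show False using that \<open>n \<le> p\<close> by (auto dest!: dvd_imp_le)
    qed
    then show ?thesis unfolding inj_on_def by (metis lessThan_iff linorder_neqE_nat)
  qed
  have m1: "(-1 :: 'a) \<noteq> 1"
  proof
    assume "(-1 :: 'a) = 1"
    then have "(of_nat 2 :: 'a) = of_nat 0" by (simp add: eq_neg_iff_add_eq_0 numeral_eq_Suc)
    then show False using inj_onD[OF inj, of 2 0] \<open>3 \<le> n\<close> by simp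
  qed
  have W2: "prime_W e \<ge> 2" if "e dvd q - 1" "even e" for e
  proof -
    have "e > 0" using that(1) \<open>q \<ge> 7\<close> by (auto intro!: Nat.gr0I)
    then have "2 \<in> prime_factors e" using that(2) by (simp add: prime_factors_dvd)
    then have "card (prime_factors e) > 0" unfolding card_gt_0_iff by blast
    then have "(2::nat) ^ 1 \<le> 2 ^ card (prime_factors e)" by (intro power_increasing) auto
    then show ?thesis by (simp add: prime_W_def prime_omega_def)
  qed
  have sqrt2: "sqrt (real q) \<ge> 2" using \<open>q \<ge> 7\<close> by (intro real_le_rsqrt) simp
  \<comment> \<open>n = q must be set apart, because then no translation moves the points away from
    0; but the claimed bound is negative in that case.\<close>
  have full: "real n < real q \<or> real q < (real n - 1) / 2 * real (prime_W e) ^ n * sqrt (real q)"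
    if "e dvd q - 1" "even e" for e
  proof (cases "n < q")
    case False
    then have "n = q" using nq by simp
    have "2 \<le> real (prime_W e) ^ 1" using W2[OF that] by simp
    also have "\<dots> \<le> real (prime_W e) ^ n"
      using W2[OF that] \<open>3 \<le> n\<close> by (intro power_increasing) auto
    finally have "2 \<le> real (prime_W e) ^ n" .
    then have "(real n - 1) / 2 * 2 * 2 \<le> (real n - 1) / 2 * real (prime_W e) ^ n * sqrt (real q)"
      using sqrt2 n3 by (intro mult_mono) auto
    then show ?thesis using n3 \<open>n = q\<close> by simp
  qed simp
  have bound: "real (num_consecutive_free TYPE('a) n e) >
      prime_theta e ^ n * (real q - (real n - 1) / 2 * real (prime_W e) ^ n * sqrt (real q))"
    if e: "e dvd q - 1" "even e" and less: "n < q" for e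
  proof -
    let ?W = "real (prime_W e) ^ n"
    \<comment> \<open>q >= 7 gives sqrt q >= 2 and n >= 3 gives n < 2 (n - 1), so the trivial
      tuple's share of the error bound outweighs the loss of \<open>n\<close> in the main
      term.\<close>
    have "(real n - 1) * sqrt (real q) \<ge> (real n - 1) * 2" using sqrt2 n3 by (intro mult_left_mono) auto
    moreover have "real n < (real n - 1) * 2" using n3 by simp
    ultimately have "real n < (real n - 1) * sqrt (real q)" by (rule less_le_trans[rotated])
    then have "real q - (real n - 1) / 2 * ?W * sqrt (real q) <
        real q - real n - (?W / 2 - 1) * ((real n - 1) * sqrt (real q))"
      by (simp add: field_simps)
    then have "prime_theta e ^ n * (real q - (real n - 1) / 2 * ?W * sqrt (real q)) <
        prime_theta e ^ n * (real q - real n - (?W / 2 - 1) * ((real n - 1) * sqrt (real q)))"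
      using prime_theta_pos by (intro mult_strict_left_mono zero_less_power)
    also have "\<dots> \<le> real (num_consecutive_free TYPE('a) n e)"
      using num_consecutive_free_lower_bound[of n e, where 'a='a] inj m1 e less \<open>3 \<le> n\<close> \<open>q mod 4 = 3\<close>
      unfolding q by simp
    finally show ?thesis .
  qed
  show ?thesis
  proof (intro conjI allI impI)
    fix e assume "e dvd q - 1 \<and> even e"
    then have e: "e dvd q - 1" "even e" by auto
    show "real (num_consecutive_free TYPE('a) n e) \<ge>
        prime_theta e ^ n * (real q - (real n - 1) / 2 * real (prime_W e) ^ n * sqrt (real q))"
    proof (cases "n < q")
      case True
      then show ?thesis using bound[OF e] by simp
    next
      case False
      then have "real q - (real n - 1) / 2 * real (prime_W e) ^ n * sqrt (real q) \<le> 0"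
        using full[OF e] by simp
      then have "prime_theta e ^ n * (real q - (real n - 1) / 2 * real (prime_W e) ^ n * sqrt (real q)) \<le> 0"
        using prime_theta_pos[of e] by (intro mult_nonneg_nonpos) (simp_all add: less_imp_le)
      then show ?thesis by simp
    qed
  next
    have ev: "q - 1 dvd q - 1" "even (q - 1)" using \<open>q mod 4 = 3\<close> by (simp, presburger)
    define \<omega> where "\<omega> = prime_omega (q - 1)"
    have "\<omega> \<noteq> 0"
    proof
      assume "\<omega> = 0"
      then show False using W2[OF ev] by (simp add: prime_W_def \<omega>_def)
    qed
    then have "n * \<omega> \<ge> 1" using \<open>3 \<le> n\<close> by simp
    then obtain m where m: "n * \<omega> = Suc m" by (cases "n * \<omega>") auto
    have "real (prime_W (q - 1)) ^ (2 * n) = 2 ^ (2 * (n * \<omega>))"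
      by (simp add: prime_W_def \<omega>_def mult_ac flip: power_mult)
    also have "\<dots> = 4 * 2 ^ (2 * m)" unfolding m by simp
    finally show "(real n - 1)\<^sup>2 / 4 * real (prime_W (q - 1)) ^ (2 * n)
            = (real n - 1)\<^sup>2 * 2 ^ (2 * (n * prime_omega (q - 1) - 1))"
      unfolding \<omega>_def[symmetric] m by simp
  next
    have ev: "q - 1 dvd q - 1" "even (q - 1)" using \<open>q mod 4 = 3\<close> by (simp, presburger)
    let ?W = "real (prime_W (q - 1))"
    assume large: "real q \<ge> (real n - 1)\<^sup>2 / 4 * ?W ^ (2 * n)"
    have "((real n - 1) / 2 * ?W ^ n)\<^sup>2 \<le> real q"
      using large by (simp add: power_mult_distrib power_divide power_mult mult.commute power_even_eq)
    then have "(real n - 1) / 2 * ?W ^ n \<le> sqrt (real q)" by (rule real_le_rsqrt)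
    then have "(real n - 1) / 2 * ?W ^ n * sqrt (real q) \<le> sqrt (real q) * sqrt (real q)"
      by (rule mult_right_mono) simp
    then have nonneg: "real q - (real n - 1) / 2 * ?W ^ n * sqrt (real q) \<ge> 0" by simp
    then have less: "n < q" using full[OF ev] by auto
    have "0 \<le> prime_theta (q - 1) ^ n * (real q - (real n - 1) / 2 * ?W ^ n * sqrt (real q))"
      using nonneg prime_theta_pos[of "q - 1"] by simp
    \<comment> \<open>The lower bound may be 0 at the threshold; strictness of \<open>bound\<close>
      still makes the count positive.\<close>
    then have "num_consecutive_free TYPE('a) n (q - 1) > 0"
      using bound[OF ev less] by linarith
    then obtain g :: 'a where "\<forall>i<n. e_free (q - 1) (g + of_nat i)"
      unfolding num_consecutive_free_def card_gt_0_iff by blast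
    then show "\<exists>g::'a. \<forall>i<n. primitive_element (g + of_nat i)"
      using e_free_imp_primitive[where 'a='a] unfolding q by blast
  qed
qed

end
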